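(* Let $d\ge2$, $k\ge1$, and let $T\subset\mathbb R^d$ be a $d$-simplex. The space of shape functions $$\Sigma_{k,\phi}^{\operatorname{div},+}(T;\mathbb S):=\mathbb B_{k+1}(\operatorname{div},T;\mathbb S)\oplus\bigoplus_{\ell=0}^{d-1}\bigoplus_{f\in\Delta_\ell(T)}\big(\mathbb B_k\mathscr N^f(\mathbb S)\oplus\mathbb B_k\Phi^f(\mathbb S)\big)$$ is uniquely determined by the degrees of freedom $$\int_F\boldsymbol\tau\boldsymbol n_F\cdot\boldsymbol q\,\mathrm ds,\quad F\in\Delta_{d-1}(T),\ \boldsymbol q\in\mathbb P_k(F;\mathbb R^d);\qquad\int_T\boldsymbol\tau:\boldsymbol q\,\mathrm dx,\quad\boldsymbol q\in\mathbb P_{k-1}(T;\mathbb S).$$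
   Context: $\mathbb S$: real symmetric $d\times d$ matrices; $\operatorname{sym}\boldsymbol\tau=(\boldsymbol\tau+\boldsymbol\tau^{\intercal})/2$. $H_0(\operatorname{div},T;\mathbb S)$: $L^2$ symmetric tensor fields on $T$ with row-wise divergence in $L^2$ and $\boldsymbol\tau\boldsymbol n|_{\partial T}=0$. $\Delta_\ell(T)$: set of $\ell$-dimensional subsimplices; $\boldsymbol n_F$: unit normal of a face $F$. $T$ has vertices $\texttt v_0,\dots,\texttt v_d$, barycenter $\texttt v_c$; $T_i$ is the simplex obtained from $T$ by replacing $\texttt v_i$ by $\texttt v_c$; $T^{\rm R}=\{T_0,\dots,T_d\}$. Subsimplices $f$ of $T$ are identified with subsets of $\{0,\dots,d\}$, $f^*=\{0,\dots,d\}\setminus f$, $f(0)$ is a fixed (say first) vertex of $f$. $\boldsymbol t_{i,j}=\texttt v_j-\texttt v_i$ for $i,j\in\{0,\dots,d,c\}$. $\mathscr T^f$ is the tangent space of $f$, $\mathscr N^f$ its orthogonal complement, $\mathscr N^f(\mathbb S)=\operatorname{sym}(\mathscr N^f\otimes\mathscr N^f)\oplus\operatorname{sym}(\mathscr T^f\otimes\mathscr N^f)$. $\lambda_i$: barycentric coordinates of $T$; $\lambda_i^{\rm R}$: continuous piecewise linear function on $T^{\rm R}$ with $\lambda_i^{\rm R}(\texttt v_j)=\delta_{ij}$ ($i,j\in\{0,\dots,d,c\}$). $\mathbb P_r(f)=\{0\}$ for $r<0$, $\mathbb P_r(f)=\mathbb R$ for a vertex $f$ and $r\ge0$. For $f\in\Delta_\ell(T)$: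 $\mathbb B_k\mathscr N^f(\mathbb S)=b_f\mathbb P_{k-\ell-1}(f)\otimes\mathscr N^f(\mathbb S)$, where $b_f=\prod_{i\in f}\lambda_i$ and $\mathbb P_r(f)$ is extended to $T$ as homogeneous polynomials of degree $r$ in $\lambda_i$, $i\in f$; and $\mathbb B_k\Phi^f(\mathbb S)=\mathbb P_{k-\ell-1}(f)\otimes\operatorname{span}\{b_f^{\rm R}\boldsymbol\phi^f_{ij}:i,j\in f^*,i<j\}$, where $b_f^{\rm R}=\prod_{i\in f}\lambda_i^{\rm R}$, $\mathbb P_r(f)$ is extended as homogeneous polynomials of degree $r$ in $\lambda_i^{\rm R}$, $i\in f$, and $$\boldsymbol\phi^f_{ij}=\chi_{T_i}\operatorname{sym}(\boldsymbol t_{f(0),c}\otimes\boldsymbol t_{f(0),j})-\chi_{T_j}\operatorname{sym}(\boldsymbol t_{f(0),c}\otimes\boldsymbol t_{f(0),i})$$ ($\chi$: characteristic function; $\mathbb B_k\Phi^F(\mathbb S)=\{0\}$ for $F\in\Delta_{d-1}(T)$). $\mathbb B_{k+1}(\operatorname{div},T;\mathbb S)=H_0(\operatorname{div},T;\mathbb S)\cap\mathbb P_{k+1}(T;\mathbb S)$. *)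

theory Defs
  imports "HOL-Analysis.Analysis" "HOL-Library.Function_Algebras"
begin

text \<open>
  Functions with values in a real vector space form a real vector space under pointwise operations,
  so that the library notions \<open>span\<close> and \<open>linear\<close> apply to spaces of scalar, vector and tensor fields.
\<close>

instantiation "fun" :: (type, real_vector) real_vector
begin

definition scaleR_fun :: "real \<Rightarrow> ('a \<Rightarrow> 'b) \<Rightarrow> 'a \<Rightarrow> 'b"
  where "scaleR_fun c f = (\<lambda>x. c *\<^sub>R f x)"

instance
  by standard (simp_all add: scaleR_fun_def plus_fun_def fun_eq_iff algebra_simps)

end


subsection \<open>Symmetric matrices\<close>

definition sym_mats :: "(real^'n^'n) set"
  where "sym_mats = {A. transpose A = A}"

definition symm :: "real^'n^'n \<Rightarrow> real^'n^'n"
  where "symm A = (1/2) *\<^sub>R (A + transpose A)"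

definition tensor :: "real^'n \<Rightarrow> real^'n \<Rightarrow> real^'n^'n"  (infixl "\<otimes>\<^sub>t" 70)
  where "a \<otimes>\<^sub>t b = (\<chi> i j. a $ i * b $ j)"


subsection \<open>The simplex, its subsimplices and its barycentric refinement\<close>

text \<open>
  A simplex is given by its vertices \<open>v 0, \<dots>, v d\<close>, where \<open>d = CARD('n)\<close>; a subsimplex is
  identified with the set of indices of its vertices.
\<close>

definition is_simplex :: "(nat \<Rightarrow> real^'n) \<Rightarrow> bool"
  where "is_simplex v \<longleftrightarrow> inj_on v {0..CARD('n)} \<and> \<not> affine_dependent (v ` {0..CARD('n)})"

definition subsimplices :: "nat \<Rightarrow> nat \<Rightarrow> nat set set"
  where "subsimplices d l = {f. f \<subseteq> {0..d} \<and> card f = Suc l}"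

definition face :: "(nat \<Rightarrow> real^'n) \<Rightarrow> nat set \<Rightarrow> (real^'n) set"
  where "face v f = convex hull (v ` f)"

definition cell :: "(nat \<Rightarrow> real^'n) \<Rightarrow> (real^'n) set"
  where "cell v = face v {0..CARD('n)}"

definition barycenter :: "(nat \<Rightarrow> real^'n) \<Rightarrow> real^'n"
  where "barycenter v = (1 / (real CARD('n) + 1)) *\<^sub>R (\<Sum>i\<in>{0..CARD('n)}. v i)"

definition subcell :: "(nat \<Rightarrow> real^'n) \<Rightarrow> nat \<Rightarrow> (real^'n) set"
  where "subcell v i = cell (v(i := barycenter v))"

definition tangent_space :: "(nat \<Rightarrow> real^'n) \<Rightarrow> nat set \<Rightarrow> (real^'n) set"
  where "tangent_space v f = span {v j - v i | i j. i \<in> f \<and> j \<in> f}"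

definition normal_space :: "(nat \<Rightarrow> real^'n) \<Rightarrow> nat set \<Rightarrow> (real^'n) set"
  where "normal_space v f = (tangent_space v f)\<^sup>\<bottom>"

definition unit_normals :: "(nat \<Rightarrow> real^'n) \<Rightarrow> (nat set \<Rightarrow> real^'n) \<Rightarrow> bool"
  where "unit_normals v n \<longleftrightarrow>
    (\<forall>F \<in> subsimplices CARD('n) (CARD('n) - 1). norm (n F) = 1 \<and> n F \<in> normal_space v F)"

text \<open>\<open>normal_tensors v f\<close> is \<open>\<N>\<^sup>f(\<S>) = sym(\<N>\<^sup>f \<otimes> \<N>\<^sup>f) \<oplus> sym(\<T>\<^sup>f \<otimes> \<N>\<^sup>f)\<close>.\<close>

definition normal_tensors :: "(nat \<Rightarrow> real^'n) \<Rightarrow> nat set \<Rightarrow> (real^'n^'n) set"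
  where "normal_tensors v f =
    {A + B | A B.
      A \<in> span {symm (a \<otimes>\<^sub>t b) | a b. a \<in> normal_space v f \<and> b \<in> normal_space v f} \<and>
      B \<in> span {symm (a \<otimes>\<^sub>t b) | a b. a \<in> tangent_space v f \<and> b \<in> normal_space v f}}"


subsection \<open>Barycentric coordinates\<close>

definition bary :: "(nat \<Rightarrow> real^'n) \<Rightarrow> nat \<Rightarrow> real^'n \<Rightarrow> real"
  where "bary v i x =
    (THE u. (\<Sum>j\<in>{0..CARD('n)}. u j) = 1 \<and> (\<Sum>j\<in>{0..CARD('n)}. u j *\<^sub>R v j) = x \<and>
            (\<forall>j. j \<notin> {0..CARD('n)} \<longrightarrow> u j = 0)) i"

text \<open>
  The continuous piecewise linear nodal function of the barycentric refinement at the vertex \<open>v i\<close>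
  of the original simplex, extended by zero outside of the simplex to make it unique.
\<close>

definition baryR :: "(nat \<Rightarrow> real^'n) \<Rightarrow> nat \<Rightarrow> real^'n \<Rightarrow> real"
  where "baryR v i =
    (THE g. continuous_on (cell v) g \<and>
            (\<forall>m\<in>{0..CARD('n)}. \<exists>a b. \<forall>x\<in>subcell v m. g x = a \<bullet> x + b) \<and>
            (\<forall>j\<in>{0..CARD('n)}. g (v j) = (if j = i then 1 else 0)) \<and>
            g (barycenter v) = 0 \<and>
            (\<forall>x. x \<notin> cell v \<longrightarrow> g x = 0))"


subsection \<open>Polynomial spaces\<close>

definition polys :: "nat \<Rightarrow> (real^'n \<Rightarrow> real) set"
  where "polys r = span {\<lambda>x. \<Prod>i\<in>UNIV. (x $ i) ^ a i | a :: 'n \<Rightarrow> nat. sum a UNIV \<le> r}"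

text \<open>
  Polynomial functions on a set \<open>D\<close> are represented by restrictions of polynomials, extended by
  zero; thus two polynomials are identified iff they agree on \<open>D\<close>.
\<close>

definition polys_on :: "nat \<Rightarrow> (real^'n) set \<Rightarrow> (real^'n \<Rightarrow> real) set"
  where "polys_on r D = {\<lambda>x. if x \<in> D then p x else 0 | p. p \<in> polys r}"

definition vec_polys_on :: "nat \<Rightarrow> (real^'n) set \<Rightarrow> (real^'n \<Rightarrow> real^'n) set"
  where "vec_polys_on r D = {q. \<forall>i. (\<lambda>x. q x $ i) \<in> polys_on r D}"

definition sym_polys_on :: "nat \<Rightarrow> (real^'n) set \<Rightarrow> (real^'n \<Rightarrow> real^'n^'n) set"
  where "sym_polys_on r D =
    {q. (\<forall>i j. (\<lambda>x. q x $ i $ j) \<in> polys_on r D) \<and> (\<forall>x. q x \<in> sym_mats)}"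

text \<open>
  Homogeneous polynomials of degree \<open>r\<close> in the functions \<open>mu i\<close>, \<open>i \<in> f\<close>. The degree is an
  integer; for \<open>r < 0\<close> there are no monomials and the space is zero.
\<close>

definition hom_polys :: "(nat \<Rightarrow> real^'n \<Rightarrow> real) \<Rightarrow> nat set \<Rightarrow> int \<Rightarrow> (real^'n \<Rightarrow> real) set"
  where "hom_polys mu f r =
    span {\<lambda>x. \<Prod>i\<in>f. mu i x ^ a i | a :: nat \<Rightarrow> nat. int (sum a f) = r}"


subsection \<open>The space \<open>H\<^sub>0(div, T; \<S>)\<close>\<close>

definition L2_on :: "(real^'n) set \<Rightarrow> (real^'n \<Rightarrow> 'b::euclidean_space) set"
  where "L2_on T = {u. u \<in> borel_measurable (lebesgue_on T) \<and>
                       integrable (lebesgue_on T) (\<lambda>x. (norm (u x))\<^sup>2)}"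

text \<open>\<open>Dphi x\<close> is the Jacobian matrix of \<open>phi\<close> at \<open>x\<close>, with the partial derivatives of \<open>phi $ i\<close> in row \<open>i\<close>.\<close>

definition C1_field :: "(real^'n \<Rightarrow> real^'n) \<Rightarrow> (real^'n \<Rightarrow> real^'n^'n) \<Rightarrow> bool"
  where "C1_field phi Dphi \<longleftrightarrow>
    (\<forall>x. (phi has_derivative (\<lambda>h. Dphi x *v h)) (at x)) \<and> continuous_on UNIV Dphi"

definition has_weak_div ::
    "(real^'n \<Rightarrow> real^'n^'n) \<Rightarrow> (real^'n \<Rightarrow> real^'n) \<Rightarrow> (real^'n) set \<Rightarrow> bool"
  where "has_weak_div tau g T \<longleftrightarrow>
    (\<forall>phi Dphi. C1_field phi Dphi \<and> compact (closure {x. phi x \<noteq> 0}) \<and>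
        closure {x. phi x \<noteq> 0} \<subseteq> interior T \<longrightarrow>
      (LINT x|lebesgue_on T. tau x \<bullet> Dphi x) = - (LINT x|lebesgue_on T. g x \<bullet> phi x))"

text \<open>
  The normal trace of a field \<open>tau\<close> with divergence \<open>g\<close> is the functional
  \<open>phi \<mapsto> \<integral>\<^sub>T tau : \<nabla>phi + \<integral>\<^sub>T g \<cdot> phi\<close> on fields \<open>phi\<close> which need not vanish on the boundary
  (Green's formula). The inner product of matrices is the Frobenius product.
\<close>

definition H0_div :: "(real^'n) set \<Rightarrow> (real^'n \<Rightarrow> real^'n^'n) set"
  where "H0_div T = {tau \<in> L2_on T. (AE x in lebesgue_on T. tau x \<in> sym_mats) \<and>
    (\<exists>g \<in> L2_on T. has_weak_div tau g T \<and>
      (\<forall>phi Dphi. C1_field phi Dphi \<longrightarrow>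
        (LINT x|lebesgue_on T. tau x \<bullet> Dphi x) + (LINT x|lebesgue_on T. g x \<bullet> phi x) = 0))}"


subsection \<open>The shape function space\<close>

definition bubble_div :: "(nat \<Rightarrow> real^'n) \<Rightarrow> nat \<Rightarrow> (real^'n \<Rightarrow> real^'n^'n) set"
  where "bubble_div v r = H0_div (cell v) \<inter> sym_polys_on r (cell v)"

text \<open>For \<open>f\<close> of dimension \<open>l\<close> we have \<open>k - l - 1 = k - card f\<close>.\<close>

definition bubble_normal :: "(nat \<Rightarrow> real^'n) \<Rightarrow> nat \<Rightarrow> nat set \<Rightarrow> (real^'n \<Rightarrow> real^'n^'n) set"
  where "bubble_normal v k f =
    span {\<lambda>x. ((\<Prod>i\<in>f. bary v i x) * p x) *\<^sub>R A | p A.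
            p \<in> hom_polys (bary v) f (int k - int (card f)) \<and> A \<in> normal_tensors v f}"

text \<open>Here \<open>p0\<close> is the index of the distinguished vertex \<open>f(0)\<close> of the subsimplex; below, \<open>base f\<close>.\<close>

definition phi_fun :: "(nat \<Rightarrow> real^'n) \<Rightarrow> nat \<Rightarrow> nat \<Rightarrow> nat \<Rightarrow> real^'n \<Rightarrow> real^'n^'n"
  where "phi_fun v p0 i j x =
    indicator (subcell v i) x *\<^sub>R symm ((barycenter v - v p0) \<otimes>\<^sub>t (v j - v p0))
    - indicator (subcell v j) x *\<^sub>R symm ((barycenter v - v p0) \<otimes>\<^sub>t (v i - v p0))"

definition bubble_phi ::
    "(nat \<Rightarrow> real^'n) \<Rightarrow> (nat set \<Rightarrow> nat) \<Rightarrow> nat \<Rightarrow> nat set \<Rightarrow> (real^'n \<Rightarrow> real^'n^'n) set"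
  where "bubble_phi v base k f =
    span {\<lambda>x. p x *\<^sub>R w x | p w.
            p \<in> hom_polys (baryR v) f (int k - int (card f)) \<and>
            w \<in> span {\<lambda>x. (\<Prod>m\<in>f. baryR v m x) *\<^sub>R phi_fun v (base f) i j x | i j.
                       i \<in> {0..CARD('n)} - f \<and> j \<in> {0..CARD('n)} - f \<and> i < j}}"

datatype summand = Bubble | Normal "nat set" | Phi "nat set"

definition summands :: "nat \<Rightarrow> summand set"
  where "summands d = {Bubble} \<union> (\<Union>l<d. \<Union>f\<in>subsimplices d l. {Normal f, Phi f})"

fun component ::
    "(nat \<Rightarrow> real^'n) \<Rightarrow> (nat set \<Rightarrow> nat) \<Rightarrow> nat \<Rightarrow> summand \<Rightarrow> (real^'n \<Rightarrow> real^'n^'n) set"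
  where
    "component v base k Bubble = bubble_div v (k + 1)"
  | "component v base k (Normal f) = bubble_normal v k f"
  | "component v base k (Phi f) = bubble_phi v base k f"

definition shape_space ::
    "(nat \<Rightarrow> real^'n) \<Rightarrow> (nat set \<Rightarrow> nat) \<Rightarrow> nat \<Rightarrow> (real^'n \<Rightarrow> real^'n^'n) set"
  where "shape_space v base k =
    {\<Sum>s\<in>summands CARD('n). g s | g. \<forall>s\<in>summands CARD('n). g s \<in> component v base k s}"

text \<open>
  Tensor fields are identified when they agree almost everywhere on the simplex \<open>T\<close> (the values of
  the characteristic functions on the interfaces between the subcells are immaterial), so directness
  of a sum of spaces of fields means: a vanishing sum has vanishing terms, almost everywhere on \<open>T\<close>.
\<close>

definition direct_sum_ae ::
    "(real^'n) set \<Rightarrow> 'i set \<Rightarrow> ('i \<Rightarrow> (real^'n \<Rightarrow> real^'n^'n) set) \<Rightarrow> bool"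
  where "direct_sum_ae T I V \<longleftrightarrow>
    (\<forall>g. (\<forall>s\<in>I. g s \<in> V s) \<and> (AE x in lebesgue_on T. (\<Sum>s\<in>I. g s x) = 0) \<longrightarrow>
         (\<forall>s\<in>I. AE x in lebesgue_on T. g s x = 0))"


subsection \<open>Degrees of freedom\<close>

text \<open>
  The surface (\<open>d - 1\<close>-dimensional Lebesgue) measure on the hyperplane through \<open>a\<close> with unit
  normal \<open>n\<close>: the measure of \<open>A\<close> is the volume of the prism of height one over \<open>A\<close>.
\<close>

definition hyperplane_measure :: "real^'n \<Rightarrow> real^'n \<Rightarrow> (real^'n) measure"
  where "hyperplane_measure a n =
    distr (restrict_space lborel {y. 0 \<le> (y - a) \<bullet> n \<and> (y - a) \<bullet> n \<le> 1}) borel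
          (\<lambda>y. y - ((y - a) \<bullet> n) *\<^sub>R n)"

text \<open>
  The fields in \<open>shape_space\<close> are piecewise polynomial, so their traces on a facet are restrictions.
  On a facet, the closed subcells overlap only in a set of surface measure zero.
\<close>

definition face_dof ::
    "(nat \<Rightarrow> real^'n) \<Rightarrow> (nat set \<Rightarrow> real^'n) \<Rightarrow> nat set \<Rightarrow> (real^'n \<Rightarrow> real^'n^'n) \<Rightarrow>
     (real^'n \<Rightarrow> real^'n) \<Rightarrow> real"
  where "face_dof v n F tau q =
    (LINT x : face v F | hyperplane_measure (v (Min F)) (n F). (tau x *v n F) \<bullet> q x)"

definition cell_dof ::
    "(nat \<Rightarrow> real^'n) \<Rightarrow> (real^'n \<Rightarrow> real^'n^'n) \<Rightarrow> (real^'n \<Rightarrow> real^'n^'n) \<Rightarrow> real"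
  where "cell_dof v tau q = (LINT x|lebesgue_on (cell v). tau x \<bullet> q x)"

definition dofs_match ::
    "(nat \<Rightarrow> real^'n) \<Rightarrow> (nat set \<Rightarrow> real^'n) \<Rightarrow> nat \<Rightarrow> (nat set \<Rightarrow> (real^'n \<Rightarrow> real^'n) \<Rightarrow> real) \<Rightarrow>
     ((real^'n \<Rightarrow> real^'n^'n) \<Rightarrow> real) \<Rightarrow> (real^'n \<Rightarrow> real^'n^'n) \<Rightarrow> bool"
  where "dofs_match v n k LF LI tau \<longleftrightarrow>
    (\<forall>F \<in> subsimplices CARD('n) (CARD('n) - 1).
       \<forall>q \<in> vec_polys_on k (face v F). face_dof v n F tau q = LF F q) \<and>
    (\<forall>q \<in> sym_polys_on (k - 1) (cell v). cell_dof v tau q = LI q)"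

text \<open>
  Unisolvence: every choice of values of the degrees of freedom (a linear functional on each space of
  test functions) is attained by exactly one shape function. Quantifying over functionals which are
  linear on all functions is no restriction, as linear functionals extend from subspaces.
\<close>

definition uniquely_determined ::
    "(nat \<Rightarrow> real^'n) \<Rightarrow> (nat set \<Rightarrow> real^'n) \<Rightarrow> nat \<Rightarrow> (real^'n \<Rightarrow> real^'n^'n) set \<Rightarrow> bool"
  where "uniquely_determined v n k S \<longleftrightarrow>
    (\<forall>LF LI. (\<forall>F \<in> subsimplices CARD('n) (CARD('n) - 1). linear (LF F)) \<and> linear LI \<longrightarrow>
      (\<exists>tau \<in> S. dofs_match v n k LF LI tau \<and>
        (\<forall>tau' \<in> S. dofs_match v n k LF LI tau' \<longrightarrow>
          (AE x in lebesgue_on (cell v). tau' x = tau x))))"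

end

theory Submission
  imports Defs
begin

text \<open>
  Everything is reduced to the normal traces on the facets. On the facet opposite to vertex \<open>m\<close> the
  trace of a nodal field is a polynomial whose Bernstein coefficient at a multi-index with support
  \<open>f\<close> depends only on the coefficients of the field at the same multi-index. For fixed \<open>f\<close> these
  traces on all facets containing \<open>f\<close> are in bijection with the coefficients in
  \<open>\<N>\<^sup>f(\<S>) \<oplus> span {\<phi>\<^sup>f\<^sub>i\<^sub>j}\<close>: testing with the gradients of the barycentric coordinates splits
  the trace into a symmetric part, coming from \<open>\<N>\<^sup>f(\<S>)\<close>, and an antisymmetric part, coming from the
  \<open>\<phi>\<^sup>f\<^sub>i\<^sub>j\<close>. The remaining fields have vanishing normal trace; they are the combinations of
  \<open>\<lambda>\<^sub>i \<lambda>\<^sub>j p t\<^sub>i\<^sub>j \<otimes> t\<^sub>i\<^sub>j\<close>, on which the interior degrees of freedom induce a definite form.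
\<close>

section \<open>Linear algebra of function spaces\<close>

text \<open>Why the \<phi> fields are there: for a continuous symmetric tensor, grad l . (\<tau>
  grad m) = grad m . (\<tau> grad l) where the facets l and m meet, so
  \<open>\<N>\<^sup>f(\<S>)\<close> alone cannot reach independent traces. With c =
  \<open>card (N - f)\<close>, normal tensors supply c(c+1)/2 + (d-c)c parameters and antisymmetric
  matrices c(c-1)/2, together cd: one vector for each of the c facets containing f. This balance is
  shown by explicit inversion at each multi-index, and prescribed moments are met by Riesz
  representation, so no dimension of a polynomial space is computed. The obstacle is that
  \<open>H0_div\<close> is a weak notion while pointwise traces are needed. Integration by parts
  comes only from translation invariance along an edge, for functions vanishing on the two facets
  opposite to its end points. For the converse, exp (- n \<lambda>_m) acts as a boundary layer at
  facet m, and a radial field from v_m compares layer integrals with volume integrals, so that no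
  surface integral enters Green's formula.\<close>

lemma scaleR_fun_apply [simp]: "(c *\<^sub>R f) x = c *\<^sub>R f x"
  by (simp add: scaleR_fun_def)

lemma sum_fun_apply: "(\<Sum>i\<in>I. f i) x = (\<Sum>i\<in>I. f i x)"
  for f :: "'i \<Rightarrow> 'a \<Rightarrow> 'b::comm_monoid_add"
  by (induct I rule: infinite_finite_induct) auto

text \<open>Preimages of \<open>S\<close> under the linear maps in either slot are subspaces, so two
  span inductions reduce the claim to generators. Products of polynomials reduce in this way to
  products of monomials.\<close>

lemma span_bilinear:
  fixes h :: "'a::real_vector \<Rightarrow> 'b::real_vector \<Rightarrow> 'c::real_vector"
  assumes S: "subspace S"
    and h: "\<And>x. linear (h x)" "\<And>y. linear (\<lambda>x. h x y)"
    and PQ: "\<And>x y. x \<in> P \<Longrightarrow> y \<in> Q \<Longrightarrow> h x y \<in> S"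
    and x: "x \<in> span P" and y: "y \<in> span Q"
  shows "h x y \<in> S"
proof -
  have vim: "subspace {z. g z \<in> S}" if "linear g" for g :: "'d::real_vector \<Rightarrow> 'c"
    using S that unfolding subspace_def
    by (auto simp: linear_add linear_scale linear_0)
  have "h x y \<in> S" if "x \<in> P" for x
    using y vim[OF h(1)] by (rule span_induct) (rule PQ[OF that])
  then show ?thesis
    using x vim[OF h(2)] by (rule span_induct[rotated 2])
qed

text \<open>Coefficients are attached to indices, not to image points, so \<open>b\<close> may take
  a value twice. Monomials can therefore be used before their independence is known.\<close>

lemma span_image_finite:
  fixes b :: "'i \<Rightarrow> 'a::real_vector"
  assumes "finite I"
  shows "x \<in> span (b ` I) \<longleftrightarrow> (\<exists>c. x = (\<Sum>i\<in>I. c i *\<^sub>R b i))"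
proof
  let ?S = "{\<Sum>i\<in>I. c i *\<^sub>R b i | c. True}"
  have S: "subspace ?S"
  proof (rule subspaceI)
    show "0 \<in> ?S" by (force intro: exI[of _ "\<lambda>_. 0"])
  next
    fix x y assume "x \<in> ?S" "y \<in> ?S"
    then obtain c e where "x = (\<Sum>i\<in>I. c i *\<^sub>R b i)" "y = (\<Sum>i\<in>I. e i *\<^sub>R b i)" by blast
    then have "x + y = (\<Sum>i\<in>I. (c i + e i) *\<^sub>R b i)"
      by (simp add: scaleR_add_left sum.distrib)
    then show "x + y \<in> ?S" by (auto intro!: exI[of _ "\<lambda>i. c i + e i"])
  next
    fix r x assume "x \<in> ?S"
    then obtain c where "x = (\<Sum>i\<in>I. c i *\<^sub>R b i)" by blast
    then have "r *\<^sub>R x = (\<Sum>i\<in>I. (r * c i) *\<^sub>R b i)"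
      by (simp add: scaleR_sum_right)
    then show "r *\<^sub>R x \<in> ?S" by (auto intro!: exI[of _ "\<lambda>i. r * c i"])
  qed
  have "b i \<in> ?S" if "i \<in> I" for i
  proof -
    have "b i = (\<Sum>j\<in>I. (if j = i then 1 else 0) *\<^sub>R b j)"
      using assms that by (subst sum.remove[of _ i]) (auto intro!: sum.neutral)
    then show ?thesis by (intro CollectI exI conjI TrueI)
  qed
  then have "span (b ` I) \<subseteq> ?S"
    by (intro span_minimal[OF _ S]) blast
  then show "x \<in> span (b ` I) \<Longrightarrow> \<exists>c. x = (\<Sum>i\<in>I. c i *\<^sub>R b i)" by blast
next
  assume "\<exists>c. x = (\<Sum>i\<in>I. c i *\<^sub>R b i)"
  then show "x \<in> span (b ` I)"
    by (auto intro!: span_sum span_scale intro: span_base)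
qed

text \<open>Gram-Schmidt by induction over a spanning set that may be dependent. Bilinearity and
  definiteness are demanded only on \<open>V\<close>, because the forms are integrals and are
  additive only where the integrands are integrable.\<close>

lemma riesz_finite_span:
  fixes B :: "'a::real_vector \<Rightarrow> 'a \<Rightarrow> real" and L :: "'a \<Rightarrow> real"
  assumes V: "subspace V" and fin: "finite S" and sub: "S \<subseteq> V"
    and comm: "\<And>x y. x \<in> V \<Longrightarrow> y \<in> V \<Longrightarrow> B x y = B y x"
    and add: "\<And>x y z. x \<in> V \<Longrightarrow> y \<in> V \<Longrightarrow> z \<in> V \<Longrightarrow> B (x + y) z = B x z + B y z"
    and scale: "\<And>c x z. x \<in> V \<Longrightarrow> z \<in> V \<Longrightarrow> B (c *\<^sub>R x) z = c * B x z"
    and definite: "\<And>x. x \<in> V \<Longrightarrow> B x x = 0 \<Longrightarrow> x = 0"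
    and Ladd: "\<And>x y. x \<in> V \<Longrightarrow> y \<in> V \<Longrightarrow> L (x + y) = L x + L y"
    and Lscale: "\<And>c x. x \<in> V \<Longrightarrow> L (c *\<^sub>R x) = c * L x"
  shows "\<exists>r\<in>span S. \<forall>x\<in>span S. B r x = L x"
  using fin sub Ladd Lscale
proof (induct S arbitrary: L rule: finite_induct)
  case empty
  have "L 0 = 0" "B 0 0 = 0"
    using empty(3)[of 0 0] scale[of 0 0 0] subspace_0[OF V] by auto
  then show ?case by auto
next
  case (insert a S)
  have a: "a \<in> V" and SV: "S \<subseteq> V" using insert by auto
  have spV: "span S \<subseteq> V" using SV V by (simp add: span_minimal)
  have add2: "B z (x + y) = B z x + B z y" if "x \<in> V" "y \<in> V" "z \<in> V" for x y z
    using that add comm subspace_add[OF V] by metis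
  have scale2: "B z (c *\<^sub>R x) = c * B z x" if "x \<in> V" "z \<in> V" for c x z
    using that scale comm subspace_scale[OF V] by metis
  \<comment> \<open>The induction hypothesis for the functional \<open>B a\<close> yields the
    orthogonal projection \<open>p\<close> of the new generator; \<open>s = a - p\<close> is then
    orthogonal to the old span.\<close>
  obtain p where p: "p \<in> span S" "\<And>x. x \<in> span S \<Longrightarrow> B p x = B a x"
    using insert(3)[OF SV, of "B a"] a add2 scale2 by blast
  obtain r where r: "r \<in> span S" "\<And>x. x \<in> span S \<Longrightarrow> B r x = L x"
    using insert(3)[OF SV, of L] insert.prems by blast
  define s where "s = a - p"
  have pV: "p \<in> V" and rV: "r \<in> V" using p r spV by auto
  have sV: "s \<in> V" unfolding s_def using a pV V by (simp add: subspace_diff)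
  show ?case
  proof (cases "s = 0")
    case True
    then have "a \<in> span S" using p s_def by simp
    then have "span (insert a S) = span S" by (rule span_redundant)
    then show ?thesis using r by auto
  next
    case False
    then have nz: "B s s \<noteq> 0" using definite sV by blast
    have orth: "B s x = 0" if "x \<in> span S" for x
    proof -
      have xV: "x \<in> V" using that spV by auto
      have "B a x = B (s + p) x" by (simp add: s_def)
      also have "\<dots> = B s x + B p x" using add sV pV xV by blast
      finally show ?thesis using p(2)[OF that] by simp
    qed
    \<comment> \<open>This coefficient makes the value on \<open>s\<close> correct; on the old span
      the correction is invisible by orthogonality.\<close>
    define c where "c = L s / B s s"
    have s_in: "s \<in> span (insert a S)"
      unfolding s_def using p(1) by (meson insertI1 span_base span_diff span_mono subset_insertI subsetD)
    have r_in: "r + c *\<^sub>R s \<in> span (insert a S)"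
      using s_in r(1) by (meson span_add span_scale span_mono subset_insertI subsetD)
    have "B (r + c *\<^sub>R s) y = L y" if y: "y \<in> span (insert a S)" for y
    proof -
      obtain k where k: "y - k *\<^sub>R a \<in> span S" using y span_breakdown_eq by blast
      define x where "x = (y - k *\<^sub>R a) + k *\<^sub>R p"
      have x: "x \<in> span S" unfolding x_def using k p(1) by (intro span_add span_scale)
      then have xV: "x \<in> V" using spV by auto
      have yx: "y = x + k *\<^sub>R s" by (simp add: x_def s_def algebra_simps)
      have ksV: "k *\<^sub>R s \<in> V" and csV: "c *\<^sub>R s \<in> V" using sV V by (auto simp: subspace_scale)
      have yV: "y \<in> V" using yx xV ksV V by (simp add: subspace_add)
      have "B (r + c *\<^sub>R s) y = B r y + c * B s y"
        using add[OF rV csV yV] scale[OF sV yV] by simp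
      also have "B r y = B r x + k * B r s"
        using add2[OF xV ksV rV] scale2[OF sV rV] yx by simp
      also have "B r s = 0" using comm[OF rV sV] orth[OF r(1)] by simp
      also have "B s y = B s x + k * B s s"
        using add2[OF xV ksV sV] scale2[OF sV sV] yx by simp
      also have "B s x = 0" by (rule orth[OF x])
      also have "B r x = L x" by (rule r(2)[OF x])
      finally have "B (r + c *\<^sub>R s) y = L x + k * L s" using nz by (simp add: c_def)
      also have "\<dots> = L y"
        using insert.prems(2)[OF xV ksV] insert.prems(3)[OF sV] yx by simp
      finally show ?thesis .
    qed
    then show ?thesis using r_in by blast
  qed
qed


section \<open>Homogeneous polynomials in a family of functions\<close>

definition mon :: "(nat \<Rightarrow> 'a \<Rightarrow> real) \<Rightarrow> nat set \<Rightarrow> (nat \<Rightarrow> nat) \<Rightarrow> 'a \<Rightarrow> real"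
  where "mon mu f a x = (\<Prod>i\<in>f. mu i x ^ a i)"

text \<open>Exponents vanish outside \<open>f\<close>, so that the set is finite for finite
  \<open>f\<close> although exponents are functions on all of \<open>nat\<close>.\<close>

definition midx :: "nat set \<Rightarrow> nat \<Rightarrow> (nat \<Rightarrow> nat) set"
  where "midx f r = {a. (\<forall>i. i \<notin> f \<longrightarrow> a i = 0) \<and> sum a f = r}"

lemma finite_midx [simp]: "finite f \<Longrightarrow> finite (midx f r)"
proof -
  assume f: "finite f"
  have "midx f r \<subseteq> {a. \<forall>i. (i \<in> f \<longrightarrow> a i \<in> {..r}) \<and> (i \<notin> f \<longrightarrow> a i = 0)}"
    unfolding midx_def using f by (auto intro: member_le_sum)
  then show ?thesis
    using finite_set_of_finite_funs[OF f, of "{..r}" 0] by (rule finite_subset) simp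
qed

text \<open>\<open>hom_polys\<close> leaves exponents outside \<open>f\<close> free; cutting them to
  zero gives the same functions.\<close>

lemma hom_polys_eq_span: "hom_polys mu f (int r) = span (mon mu f ` midx f r)"
proof -
  have "(\<exists>a. p = (\<lambda>x. \<Prod>i\<in>f. mu i x ^ a i) \<and> int (sum a f) = int r) \<longleftrightarrow> p \<in> mon mu f ` midx f r" for p
  proof
    assume "\<exists>a. p = (\<lambda>x. \<Prod>i\<in>f. mu i x ^ a i) \<and> int (sum a f) = int r"
    then obtain a where a: "p = (\<lambda>x. \<Prod>i\<in>f. mu i x ^ a i)" "sum a f = r"
      by (metis of_nat_eq_iff)
    let ?a = "\<lambda>i. if i \<in> f then a i else 0"
    have "p = mon mu f ?a" unfolding a mon_def by (auto intro!: ext prod.cong)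
    moreover have "?a \<in> midx f r" using a by (auto simp: midx_def intro!: sum.cong)
    ultimately show "p \<in> mon mu f ` midx f r" by blast
  next
    assume "p \<in> mon mu f ` midx f r"
    then show "\<exists>a. p = (\<lambda>x. \<Prod>i\<in>f. mu i x ^ a i) \<and> int (sum a f) = int r"
      by (auto simp: midx_def mon_def fun_eq_iff)
  qed
  then show ?thesis unfolding hom_polys_def
    by (intro arg_cong[of _ _ span] set_eqI) (simp only: mem_Collect_eq)
qed

lemma hom_polys_iff:
  assumes "finite f"
  shows "p \<in> hom_polys mu f (int r) \<longleftrightarrow> (\<exists>c. p = (\<lambda>x. \<Sum>a\<in>midx f r. c a * mon mu f a x))"
  unfolding hom_polys_eq_span span_image_finite[OF finite_midx[OF assms]]
  by (simp add: fun_eq_iff sum_fun_apply)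

lemma hom_polys_neg: "r < 0 \<Longrightarrow> hom_polys mu f r = {0}"
proof -
  assume "r < 0"
  then have "int (sum a f) \<noteq> r" for a by linarith
  then have "{\<lambda>x. \<Prod>i\<in>f. mu i x ^ a i | a :: nat \<Rightarrow> nat. int (sum a f) = r} = {}" by blast
  then show ?thesis unfolding hom_polys_def by simp
qed

lemma subspace_hom_polys: "subspace (hom_polys mu f r)"
  by (simp add: hom_polys_def)

lemma linear_fun_mult: "linear (\<lambda>p x. p x * (q x :: real))" "linear (\<lambda>p x. q x * (p x :: real))"
  by (auto intro!: linearI simp: algebra_simps)

lemma hom_polys_mult:
  assumes "p \<in> hom_polys mu f r" and "q \<in> hom_polys mu f s"
  shows "(\<lambda>x. p x * q x) \<in> hom_polys mu f (r + s)"
  using subspace_hom_polys linear_fun_mult(2) linear_fun_mult(1) _ assms[unfolded hom_polys_def]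
proof (rule span_bilinear)
  fix p q
  assume "p \<in> {\<lambda>x. \<Prod>i\<in>f. mu i x ^ a i | a :: nat \<Rightarrow> nat. int (sum a f) = r}"
    "q \<in> {\<lambda>x. \<Prod>i\<in>f. mu i x ^ a i | a :: nat \<Rightarrow> nat. int (sum a f) = s}"
  then obtain a b :: "nat \<Rightarrow> nat" where p: "p = (\<lambda>x. \<Prod>i\<in>f. mu i x ^ a i)" "int (sum a f) = r"
    and q: "q = (\<lambda>x. \<Prod>i\<in>f. mu i x ^ b i)" "int (sum b f) = s"
    by blast
  have "(\<lambda>x. p x * q x) = (\<lambda>x. \<Prod>i\<in>f. mu i x ^ (a i + b i))"
    unfolding p q by (simp add: prod.distrib power_add)
  moreover have "int (sum (\<lambda>i. a i + b i) f) = r + s" using p q by (simp add: sum.distrib)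
  ultimately show "(\<lambda>x. p x * q x) \<in> hom_polys mu f (r + s)"
    unfolding hom_polys_def by (intro span_base CollectI exI[of _ "\<lambda>i. a i + b i"]) simp
qed

lemma hom_polys_gen: "finite f \<Longrightarrow> i \<in> f \<Longrightarrow> mu i \<in> hom_polys mu f 1"
  unfolding hom_polys_def
proof (intro span_base CollectI exI conjI)
  assume f: "finite f" "i \<in> f"
  let ?a = "\<lambda>j. if j = i then 1 else 0 :: nat"
  show "int (sum ?a f) = 1" using f by simp
  show "mu i = (\<lambda>x. \<Prod>j\<in>f. mu j x ^ ?a j)"
    using f by (auto simp: fun_eq_iff prod.remove[of f i] intro!: prod.neutral)
qed

lemma hom_polys_one: "(\<lambda>x. 1) \<in> hom_polys mu f 0"
  unfolding hom_polys_def by (intro span_base CollectI exI[of _ "\<lambda>_. 0"]) auto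

lemma hom_power: "p \<in> hom_polys mu f 1 \<Longrightarrow> (\<lambda>x. p x ^ n) \<in> hom_polys mu f (int n)"
proof (induct n)
  case 0
  show ?case using hom_polys_one by simp
next
  case (Suc n)
  then show ?case using hom_polys_mult[of p mu f 1 "\<lambda>x. p x ^ n" "int n"] by simp
qed

lemma monomials_independent:
  fixes c :: "(nat \<Rightarrow> nat) \<Rightarrow> real"
  assumes "finite f" and "finite A"
    and "\<And>a b. a \<in> A \<Longrightarrow> b \<in> A \<Longrightarrow> (\<And>i. i \<in> f \<Longrightarrow> a i = b i) \<Longrightarrow> a = b"
    and "\<And>y. (\<And>i. i \<in> f \<Longrightarrow> 0 < y i) \<Longrightarrow> (\<Sum>a\<in>A. c a * (\<Prod>i\<in>f. y i ^ a i)) = 0"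
    and "a \<in> A"
  shows "c a = 0"
  using assms
proof (induct f arbitrary: A rule: finite_induct)
  case empty
  have "A = {a}" using empty by auto
  then show ?case using empty(3)[of "\<lambda>_. 0"] by simp
next
  case (insert m f)
  define An where "An = (\<lambda>n. {b\<in>A. b m = n})"
  define K where "K = Max ((\<lambda>b. b m) ` A)"
  have K: "b m \<le> K" if "b \<in> A" for b unfolding K_def using insert that by auto
  have "(\<Sum>b\<in>An (a m). c b * (\<Prod>i\<in>f. y i ^ b i)) = 0" if y: "\<And>i. i \<in> f \<Longrightarrow> 0 < y i" for y
  proof (rule ccontr)
    \<comment> \<open>\<open>e n\<close> is the coefficient of t^n once every variable except
      \<open>m\<close> is frozen. If one of them is nonzero there are finitely many roots, but every
      t > 0 is a root.\<close>
    define e where "e = (\<lambda>n. \<Sum>b\<in>An n. c b * (\<Prod>i\<in>f. y i ^ b i))"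
    assume "\<not> ?thesis"
    then have "e (a m) \<noteq> 0" by (simp add: e_def)
    then have fin: "finite {t. (\<Sum>n\<le>K. e n * t ^ n) = 0}"
      using polyfun_rootbound_finite K[OF insert(7)] by blast
    have "(\<Sum>n\<le>K. e n * t ^ n) = 0" if t: "0 < t" for t
    proof -
      have eq: "(\<Prod>i\<in>f. (y(m := t)) i ^ b i) = (\<Prod>i\<in>f. y i ^ b i)" for b :: "nat \<Rightarrow> nat"
        using insert(2) by (intro prod.cong) auto
      have "0 = (\<Sum>b\<in>A. c b * (\<Prod>i\<in>insert m f. (y(m := t)) i ^ b i))"
        using y t by (intro insert(6)[symmetric]) auto
      also have "\<dots> = (\<Sum>b\<in>A. t ^ b m * (c b * (\<Prod>i\<in>f. y i ^ b i)))"
        using insert(1,2) by (intro sum.cong refl) (simp add: eq del: fun_upd_apply, simp)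
      also have "\<dots> = (\<Sum>n\<le>K. \<Sum>b\<in>An n. t ^ b m * (c b * (\<Prod>i\<in>f. y i ^ b i)))"
        unfolding An_def using insert.prems(1) K
        by (intro sum.group[symmetric]) (simp_all add: image_subset_iff)
      also have "\<dots> = (\<Sum>n\<le>K. e n * t ^ n)"
        unfolding e_def An_def
        by (intro sum.cong refl) (auto simp: sum_distrib_left mult_ac intro!: sum.cong)
      finally show ?thesis by simp
    qed
    then have "{0<..} \<subseteq> {t. (\<Sum>n\<le>K. e n * t ^ n) = 0}" by auto
    then have "finite {0 :: real<..}" using fin finite_subset by blast
    then show False using infinite_Ioi[of "0::real"] by simp
  qed
  then show ?case
  proof (intro insert(3)[of "An (a m)"])
    show "b = b'" if "b \<in> An (a m)" "b' \<in> An (a m)" "\<And>i. i \<in> f \<Longrightarrow> b i = b' i" for b b'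
      using that by (intro insert(5)) (auto simp: An_def)
  qed (use insert in \<open>auto simp: An_def\<close>)
qed

section \<open>Barycentric coordinates\<close>

text \<open>Weights are indexed by \<open>I\<close> and not by points, which suits the vertex map
  \<open>v(m := ctr)\<close> of a subcell, whose injectivity is never established.\<close>

lemma convex_hull_image_finite:
  fixes v :: "'i \<Rightarrow> 'a::real_vector"
  assumes "finite I"
  shows "convex hull (v ` I) = {\<Sum>i\<in>I. u i *\<^sub>R v i | u. (\<forall>i\<in>I. 0 \<le> u i) \<and> sum u I = 1}"
    (is "_ = ?C")
proof
  have "convex ?C"
  proof (rule convexI)
    fix x y and s t :: real
    assume "x \<in> ?C" "y \<in> ?C" and st: "0 \<le> s" "0 \<le> t" "s + t = 1"
    then obtain u w where u: "x = (\<Sum>i\<in>I. u i *\<^sub>R v i)" "\<forall>i\<in>I. 0 \<le> u i" "sum u I = 1"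
      and w: "y = (\<Sum>i\<in>I. w i *\<^sub>R v i)" "\<forall>i\<in>I. 0 \<le> w i" "sum w I = 1"
      by blast
    have "s *\<^sub>R x + t *\<^sub>R y = (\<Sum>i\<in>I. (s * u i + t * w i) *\<^sub>R v i)"
      unfolding u w by (simp add: scaleR_sum_right scaleR_add_left sum.distrib)
    moreover have "\<forall>i\<in>I. 0 \<le> s * u i + t * w i" using u w st by auto
    moreover have "(\<Sum>i\<in>I. s * u i + t * w i) = 1"
      using u w st by (simp add: sum.distrib flip: sum_distrib_left)
    ultimately show "s *\<^sub>R x + t *\<^sub>R y \<in> ?C"
      by (intro CollectI exI[of _ "\<lambda>i. s * u i + t * w i"]) simp
  qed
  moreover have "v i \<in> ?C" if "i \<in> I" for i
  proof -
    let ?u = "\<lambda>j. if j = i then 1 else 0 :: real"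
    have "v i = (\<Sum>j\<in>I. ?u j *\<^sub>R v j)"
      using assms that by (subst sum.remove[of _ i]) (auto intro!: sum.neutral)
    moreover have "sum ?u I = 1" using assms that by simp
    ultimately show ?thesis by (intro CollectI exI[of _ ?u]) auto
  qed
  ultimately show "convex hull (v ` I) \<subseteq> ?C"
    by (intro hull_minimal) auto
  show "?C \<subseteq> convex hull (v ` I)"
    using assms by (auto intro!: convex_sum[OF _ convex_convex_hull] intro: hull_inc)
qed

lemma continuous_on_Min_image:
  fixes f :: "'i \<Rightarrow> 'a::topological_space \<Rightarrow> real"
  assumes "finite I" and "I \<noteq> {}" and "\<And>i. i \<in> I \<Longrightarrow> continuous_on S (f i)"
  shows "continuous_on S (\<lambda>x. Min ((\<lambda>i. f i x) ` I))"
  using assms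
proof (induct I rule: finite_ne_induct)
  case (insert i I)
  have "continuous_on S (\<lambda>x. min (f i x) (Min ((\<lambda>i. f i x) ` I)))"
    using insert by (intro continuous_on_min) auto
  then show ?case using insert by simp
qed simp

locale simplex =
  fixes v :: "nat \<Rightarrow> real^'n" and N :: "nat set"
  assumes simplex: "is_simplex v" and N_def: "N = {0..CARD('n)}"
begin

lemma finite_N [simp]: "finite N" and card_N [simp]: "card N = Suc CARD('n)"
  and N_nonempty [simp]: "N \<noteq> {}"
  by (auto simp: N_def)

lemma obtain_other:
  obtains j where "j \<in> N" "j \<noteq> i"
  by (cases "i = 0") (auto simp: N_def intro: that[of 0] that[of 1])

lemmas is_simplex_N = is_simplex_def[of v, folded N_def]
  and bary_N = bary_def[of v, folded N_def]
  and barycenter_N = barycenter_def[of v, folded N_def]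
  and cell_N = cell_def[where 'n='n, folded N_def]
  and baryR_N = baryR_def[of v, folded N_def]

abbreviation ctr :: "real^'n" where "ctr \<equiv> barycenter v"

text \<open>The d + 1 affinely independent vertices have an affine hull of full dimension, which
  gives existence. The difference of two coordinate vectors is an affine dependence, which gives
  uniqueness.\<close>

lemma bary_ex1:
  "\<exists>!u. (\<Sum>j\<in>N. u j) = 1 \<and> (\<Sum>j\<in>N. u j *\<^sub>R v j) = x \<and> (\<forall>j. j \<notin> N \<longrightarrow> u j = 0)"
proof -
  let ?S = "v ` N"
  have inj: "inj_on v N" and ind: "\<not> affine_dependent ?S"
    using simplex by (auto simp: is_simplex_N)
  have "card ?S = CARD('n) + 1" using card_image[OF inj] by simp
  then have "aff_dim ?S = DIM(real^'n)"
    using aff_dim_affine_independent[OF ind] by simp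
  then have "x \<in> affine hull ?S" using aff_dim_eq_full by blast
  then obtain w where w: "sum w ?S = 1" "(\<Sum>p\<in>?S. w p *\<^sub>R p) = x"
    by (auto simp: affine_hull_finite)
  show ?thesis
  proof (rule ex_ex1I)
    let ?u = "\<lambda>j. if j \<in> N then w (v j) else 0"
    show "\<exists>u. (\<Sum>j\<in>N. u j) = 1 \<and> (\<Sum>j\<in>N. u j *\<^sub>R v j) = x \<and> (\<forall>j. j \<notin> N \<longrightarrow> u j = 0)"
      using w by (intro exI[of _ ?u]) (simp add: sum.reindex[OF inj])
  next
    fix u u' :: "nat \<Rightarrow> real"
    assume u: "(\<Sum>j\<in>N. u j) = 1 \<and> (\<Sum>j\<in>N. u j *\<^sub>R v j) = x \<and> (\<forall>j. j \<notin> N \<longrightarrow> u j = 0)"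
      and u': "(\<Sum>j\<in>N. u' j) = 1 \<and> (\<Sum>j\<in>N. u' j *\<^sub>R v j) = x \<and> (\<forall>j. j \<notin> N \<longrightarrow> u' j = 0)"
    define W where "W p = (let j = inv_into N v p in u j - u' j)" for p
    have W: "W (v j) = u j - u' j" if "j \<in> N" for j
      using inv_into_f_f[OF inj that] by (simp add: W_def)
    have "sum W ?S = 0" "(\<Sum>p\<in>?S. W p *\<^sub>R p) = 0"
      using u u' by (simp_all add: sum.reindex[OF inj] W sum_subtractf scaleR_diff_left)
    then have "\<forall>p\<in>?S. W p = 0"
      using ind by (subst (asm) affine_dependent_explicit_finite) auto
    then have "u j = u' j" if "j \<in> N" for j using that W by fastforce
    then show "u = u'" using u u' by (metis ext)
  qed
qed

lemma bary_sum: "(\<Sum>i\<in>N. bary v i x) = 1"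
  and bary_repr: "(\<Sum>i\<in>N. bary v i x *\<^sub>R v i) = x"
  and bary_outside: "i \<notin> N \<Longrightarrow> bary v i x = 0"
  using theI'[OF bary_ex1, of x] unfolding bary_N by auto

lemma bary_unique:
  assumes "(\<Sum>i\<in>N. u i) = 1" and "(\<Sum>i\<in>N. u i *\<^sub>R v i) = x" and "i \<in> N"
  shows "bary v i x = u i"
proof -
  let ?u = "\<lambda>j. if j \<in> N then u j else 0"
  have "(THE u. (\<Sum>j\<in>N. u j) = 1 \<and> (\<Sum>j\<in>N. u j *\<^sub>R v j) = x \<and> (\<forall>j. j \<notin> N \<longrightarrow> u j = 0)) = ?u"
    using bary_ex1 by (rule the1_equality) (use assms in simp)
  then show ?thesis unfolding bary_N using assms(3) by simp
qed

text \<open>The gradient, read off from the increments along the coordinate axes; that these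
  increments are linear is the content of \<open>bary_affine\<close>.\<close>

definition grad :: "nat \<Rightarrow> real^'n"
  where "grad i = (\<Sum>b\<in>Basis. (bary v i b - bary v i 0) *\<^sub>R b)"

text \<open>Affine combinations of coordinate vectors are coordinate vectors of the combined points.
  Uniqueness therefore makes the increments from the origin additive and homogeneous.\<close>

lemma bary_affine: "bary v i x = bary v i 0 + grad i \<bullet> x"
proof (cases "i \<in> N")
  case True
  let ?f = "\<lambda>h. bary v i h - bary v i 0"
  have "linear ?f"
  proof (rule linearI)
    fix x y
    have "bary v i (x + y) = bary v i x + bary v i y - bary v i 0"
      using True by (intro bary_unique)
        (simp_all add: sum_subtractf sum.distrib bary_sum bary_repr algebra_simps)
    then show "?f (x + y) = ?f x + ?f y" by simp
  next
    fix c x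
    have "bary v i (c *\<^sub>R x) = c * bary v i x + (1 - c) * bary v i 0"
    proof (rule bary_unique[OF _ _ True])
      show "(\<Sum>i\<in>N. c * bary v i x + (1 - c) * bary v i 0) = 1"
        by (simp add: sum.distrib bary_sum flip: sum_distrib_left)
      have "(\<Sum>i\<in>N. (c * bary v i x + (1 - c) * bary v i 0) *\<^sub>R v i)
        = c *\<^sub>R (\<Sum>i\<in>N. bary v i x *\<^sub>R v i) + (1 - c) *\<^sub>R (\<Sum>i\<in>N. bary v i 0 *\<^sub>R v i)"
        by (simp add: scaleR_add_left sum.distrib scaleR_sum_right)
      then show "(\<Sum>i\<in>N. (c * bary v i x + (1 - c) * bary v i 0) *\<^sub>R v i) = c *\<^sub>R x"
        by (simp add: bary_repr)
    qed
    then show "?f (c *\<^sub>R x) = c *\<^sub>R ?f x" by (simp add: algebra_simps)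
  qed
  then have "?f (\<Sum>b\<in>Basis. (x \<bullet> b) *\<^sub>R b) = (\<Sum>b\<in>Basis. (x \<bullet> b) * ?f b)"
    by (simp add: linear_sum[OF \<open>linear ?f\<close>] linear_scale[OF \<open>linear ?f\<close>] del: euclidean_representation)
  then have "?f x = (\<Sum>b\<in>Basis. (x \<bullet> b) * ?f b)"
    unfolding euclidean_representation .
  then show ?thesis
    by (simp add: grad_def inner_sum_right inner_commute algebra_simps)
next
  case False
  then show ?thesis by (simp add: bary_outside grad_def)
qed

lemma grad_diff: "grad i \<bullet> (x - y) = bary v i x - bary v i y"
  using bary_affine[of i x] bary_affine[of i y] by (simp add: inner_diff_right)

lemma grad_inner: "grad i \<bullet> x = bary v i x - bary v i 0"
  using bary_affine[of i x] by simp

lemma bary_vertex: "j \<in> N \<Longrightarrow> bary v i (v j) = (if i = j then 1 else 0)"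
proof (cases "i \<in> N")
  assume j: "j \<in> N"
  case True
  let ?u = "\<lambda>i. if i = j then 1 else 0 :: real"
  have "(\<Sum>i\<in>N. ?u i *\<^sub>R v i) = v j"
    using j by (subst sum.remove[of _ j]) (auto intro!: sum.neutral)
  then show ?thesis using j by (subst bary_unique[of ?u]) (simp_all add: True)
next
  assume "j \<in> N"
  case False
  then show ?thesis using \<open>j \<in> N\<close> by (auto simp: bary_outside)
qed

lemma bary_center: "i \<in> N \<Longrightarrow> bary v i ctr = 1 / (real CARD('n) + 1)"
  by (rule bary_unique[of "\<lambda>_. 1 / (real CARD('n) + 1)"])
    (simp_all add: barycenter_N scaleR_sum_right add.commute del: of_nat_Suc)

lemma grad_edge: "j \<in> N \<Longrightarrow> l \<in> N \<Longrightarrow>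
    grad i \<bullet> (v j - v l) = (if i = j then 1 else 0) - (if i = l then 1 else 0)"
  by (simp add: grad_diff bary_vertex)

lemma grad_sum: "(\<Sum>i\<in>N. grad i) = 0"
proof -
  have "(\<Sum>i\<in>N. grad i) \<bullet> x = 0" for x
    by (simp add: inner_sum_left grad_inner sum_subtractf bary_sum)
  then show ?thesis by (metis inner_eq_zero_iff)
qed

lemma grad_repr: "(\<Sum>i\<in>N. (grad i \<bullet> h) *\<^sub>R v i) = h"
  by (simp add: grad_inner scaleR_diff_left sum_subtractf bary_repr)

text \<open>Transpose of \<open>grad_repr\<close>: vertices and gradients form a pair of dual
  frames.\<close>

lemma grad_dual: "(\<Sum>i\<in>N. (v i \<bullet> h) *\<^sub>R grad i) = h"
proof -
  have "(\<Sum>i\<in>N. (v i \<bullet> h) *\<^sub>R grad i) \<bullet> y = h \<bullet> y" for y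
  proof -
    have "h \<bullet> y = h \<bullet> (\<Sum>i\<in>N. (grad i \<bullet> y) *\<^sub>R v i)" by (simp add: grad_repr)
    also have "\<dots> = (\<Sum>i\<in>N. (v i \<bullet> h) *\<^sub>R grad i) \<bullet> y"
      by (simp add: inner_sum_left inner_sum_right inner_commute mult.commute)
    finally show ?thesis by simp
  qed
  then show ?thesis by (metis vector_eq_rdot)
qed

lemma grad_nz: "i \<in> N \<Longrightarrow> grad i \<noteq> 0"
proof
  assume i: "i \<in> N" "grad i = 0"
  obtain j where j: "j \<in> N" "j \<noteq> i" by (rule obtain_other)
  have "grad i \<bullet> (v i - v j) = 1" using i j by (subst grad_edge) auto
  then show False using i by simp
qed

lemma continuous_bary [continuous_intros]: "continuous_on S (bary v i)"
proof -
  have "bary v i = (\<lambda>x. bary v i 0 + grad i \<bullet> x)" using bary_affine by blast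
  moreover have "continuous_on S (\<lambda>x. bary v i 0 + grad i \<bullet> x)" by (intro continuous_intros)
  ultimately show ?thesis by metis
qed

lemma has_derivative_bary [derivative_intros]:
  "(bary v i has_derivative (\<lambda>h. grad i \<bullet> h)) (at x within S)"
proof -
  have "bary v i = (\<lambda>x. bary v i 0 + grad i \<bullet> x)" using bary_affine by blast
  moreover have "((\<lambda>x. bary v i 0 + grad i \<bullet> x) has_derivative (\<lambda>h. grad i \<bullet> h)) (at x within S)"
    by (auto intro!: derivative_eq_intros)
  ultimately show ?thesis by metis
qed


section \<open>The cell, its faces and subcells\<close>

lemma face_iff:
  assumes f: "f \<subseteq> N"
  shows "x \<in> face v f \<longleftrightarrow> (\<forall>i\<in>N. 0 \<le> bary v i x) \<and> (\<forall>i\<in>N - f. bary v i x = 0)"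
proof
  have fin: "finite f" using f finite_N by (rule finite_subset)
  note hull = convex_hull_image_finite[OF fin, of v]
  {
    assume "x \<in> face v f"
    then obtain u where u: "x = (\<Sum>i\<in>f. u i *\<^sub>R v i)" "\<forall>i\<in>f. 0 \<le> u i" "sum u f = 1"
      unfolding face_def hull by blast
    let ?u = "\<lambda>i. if i \<in> f then u i else 0"
    have "sum ?u N = 1" using u f by (subst sum.inter_restrict[symmetric]) (auto simp: Int_absorb1)
    moreover have "(\<Sum>i\<in>N. ?u i *\<^sub>R v i) = x"
      unfolding u(1) using f by (intro sum.mono_neutral_cong_right) auto
    ultimately have "bary v i x = ?u i" if "i \<in> N" for i using that bary_unique by blast
    then show "(\<forall>i\<in>N. 0 \<le> bary v i x) \<and> (\<forall>i\<in>N - f. bary v i x = 0)" using u by auto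
  next
    assume r: "(\<forall>i\<in>N. 0 \<le> bary v i x) \<and> (\<forall>i\<in>N - f. bary v i x = 0)"
    have "(\<Sum>i\<in>f. bary v i x *\<^sub>R v i) = (\<Sum>i\<in>N. bary v i x *\<^sub>R v i)"
      "(\<Sum>i\<in>f. bary v i x) = (\<Sum>i\<in>N. bary v i x)"
      using r f by (auto intro!: sum.mono_neutral_left)
    then show "x \<in> face v f"
      unfolding face_def hull using r f bary_repr[of x] bary_sum[of x]
      by (intro CollectI exI[of _ "\<lambda>i. bary v i x"]) auto
  }
qed

lemma cell_iff: "x \<in> cell v \<longleftrightarrow> (\<forall>i\<in>N. 0 \<le> bary v i x)"
  unfolding cell_N by (subst face_iff) auto

text \<open>The weight carried by the centre is shared equally among the d + 1 vertices of the large
  simplex.\<close>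

lemma subcell_hull:
  assumes "m \<in> N"
  shows "(\<Sum>i\<in>N. u i *\<^sub>R (v(m := ctr)) i)
    = (\<Sum>i\<in>N. ((if i = m then 0 else u i) + u m / (real CARD('n) + 1)) *\<^sub>R v i)"
proof -
  have "(\<Sum>i\<in>N. u i *\<^sub>R (v(m := ctr)) i) = u m *\<^sub>R ctr + (\<Sum>i\<in>N - {m}. u i *\<^sub>R v i)"
    using assms by (subst sum.remove[of _ m]) auto
  also have "(\<Sum>i\<in>N - {m}. u i *\<^sub>R v i) = (\<Sum>i\<in>N. (if i = m then 0 else u i) *\<^sub>R v i)"
    using assms by (intro sum.mono_neutral_cong_left) auto
  also have "u m *\<^sub>R ctr = (\<Sum>i\<in>N. (u m / (real CARD('n) + 1)) *\<^sub>R v i)"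
    by (simp add: barycenter_N scaleR_sum_right)
  finally show ?thesis by (simp add: scaleR_add_left sum.distrib)
qed

text \<open>The summands are the barycentric coordinates of subcell m, obtained by solving
  \<open>subcell_hull\<close> for the weights: the centre gets (d + 1) \<lambda>_m and every other
  vertex \<lambda>_i - \<lambda>_m.\<close>

lemma sum_bary_shift:
  assumes "m \<in> N"
  shows "(\<Sum>i\<in>N. if i = m then (real CARD('n) + 1) * bary v m x else bary v i x - bary v m x) = 1"
proof -
  have "(\<Sum>i\<in>N. if i = m then (real CARD('n) + 1) * bary v m x else bary v i x - bary v m x)
    = (\<Sum>i\<in>N. bary v i x - bary v m x + (if i = m then (real CARD('n) + 1) * bary v m x else 0))"
    by (intro sum.cong) auto
  also have "\<dots> = 1"
    using assms by (simp add: sum.distrib sum_subtractf bary_sum algebra_simps)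
  finally show ?thesis .
qed

lemma bary_shift_repr:
  assumes "m \<in> N"
  shows "(\<Sum>i\<in>N. (if i = m then (real CARD('n) + 1) * bary v m x else bary v i x - bary v m x)
      *\<^sub>R (v(m := ctr)) i) = x"
proof -
  have "(\<Sum>i\<in>N. (if i = m then (real CARD('n) + 1) * bary v m x else bary v i x - bary v m x)
      *\<^sub>R (v(m := ctr)) i) = (\<Sum>i\<in>N. bary v i x *\<^sub>R v i)"
    unfolding subcell_hull[OF assms]
    by (intro sum.cong refl) (simp add: field_simps del: of_nat_Suc)
  then show ?thesis by (simp add: bary_repr)
qed

text \<open>Membership means that the weights of \<open>sum_bary_shift\<close> are nonnegative, so
  subcell m is the region where \<lambda>_m is minimal.\<close>

lemma subcell_iff:
  assumes m: "m \<in> N"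
  shows "x \<in> subcell v m \<longleftrightarrow> x \<in> cell v \<and> (\<forall>i\<in>N. bary v m x \<le> bary v i x)"
proof
  note hull = convex_hull_image_finite[OF finite_N, of "v(m := ctr)"]
  {
    assume "x \<in> subcell v m"
    then obtain u where u: "x = (\<Sum>i\<in>N. u i *\<^sub>R (v(m := ctr)) i)" "\<forall>i\<in>N. 0 \<le> u i" "sum u N = 1"
      unfolding subcell_def cell_N face_def hull by blast
    let ?u = "\<lambda>i. (if i = m then 0 else u i) + u m / (real CARD('n) + 1)"
    have "sum ?u N = (\<Sum>i\<in>N. if i = m then 0 else u i) + u m"
      by (simp add: sum.distrib add_divide_distrib[symmetric] del: of_nat_Suc) (simp add: field_simps)
    also have "(\<Sum>i\<in>N. if i = m then 0 else u i) = sum u (N - {m})"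
      using m by (intro sum.mono_neutral_cong_right) auto
    also have "sum u (N - {m}) + u m = 1" using u m by (simp add: sum.remove[of N m])
    finally have "bary v i x = ?u i" if "i \<in> N" for i
      using u(1) that unfolding subcell_hull[OF m] by (intro bary_unique) auto
    then show "x \<in> cell v \<and> (\<forall>i\<in>N. bary v m x \<le> bary v i x)"
      unfolding cell_iff using u(2) m by auto
  next
    assume r: "x \<in> cell v \<and> (\<forall>i\<in>N. bary v m x \<le> bary v i x)"
    then show "x \<in> subcell v m"
      unfolding subcell_def cell_N face_def hull
      using bary_shift_repr[OF m, of x] sum_bary_shift[OF m, of x] m
      by (intro CollectI exI[of _ "\<lambda>i. if i = m then (real CARD('n) + 1) * bary v m x
         else bary v i x - bary v m x"] conjI) (auto simp: cell_N[symmetric] face_def[symmetric] cell_iff)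
  }
qed

lemma in_some_subcell:
  assumes "x \<in> cell v"
  obtains m where "m \<in> N" "x \<in> subcell v m"
proof -
  let ?B = "(\<lambda>i. bary v i x) ` N"
  have "Min ?B \<in> ?B" by (intro Min_in) auto
  then obtain m where m: "m \<in> N" "Min ?B = bary v m x" by (simp only: image_iff) blast
  have "bary v m x \<le> bary v i x" if "i \<in> N" for i
    unfolding m(2)[symmetric] using that by (intro Min_le) simp_all
  then show ?thesis using that m(1) assms subcell_iff by blast
qed

text \<open>An affine function is the combination of its vertex values with the subcell coordinates
  as weights. The centre and all vertices except i carry the value 0, so only the weight of i
  survives; for i = m both sides are 0.\<close>

lemma subcell_affine_eq:
  assumes m: "m \<in> N" and i: "i \<in> N" and g: "\<And>x. x \<in> subcell v m \<Longrightarrow> g x = a \<bullet> x + b"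
    and vert: "\<And>j. j \<in> N \<Longrightarrow> g (v j) = (if j = i then 1 else 0)" and c: "g ctr = 0"
    and x: "x \<in> subcell v m"
  shows "g x = bary v i x - bary v m x"
proof -
  let ?w = "\<lambda>i. if i = m then (real CARD('n) + 1) * bary v m x else bary v i x - bary v m x"
  have sub: "(v(m := ctr)) j \<in> subcell v m" if "j \<in> N" for j
    unfolding subcell_def cell_N face_def using that by (intro hull_inc imageI)
  have "g x = a \<bullet> (\<Sum>j\<in>N. ?w j *\<^sub>R (v(m := ctr)) j) + b * (\<Sum>j\<in>N. ?w j)"
    using g[OF x] bary_shift_repr[OF m, of x] sum_bary_shift[OF m, of x] by simp
  also have "\<dots> = (\<Sum>j\<in>N. ?w j * (a \<bullet> (v(m := ctr)) j + b))"
    by (simp only: inner_sum_right sum_distrib_left inner_scaleR_right flip: sum.distrib)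
      (simp add: algebra_simps)
  also have "\<dots> = (\<Sum>j\<in>N. ?w j * g ((v(m := ctr)) j))"
    using g[OF sub] by (intro sum.cong refl) simp
  also have "\<dots> = (\<Sum>j\<in>N. if j = i then bary v i x - bary v m x else 0)"
    by (intro sum.cong refl) (auto simp: c vert)
  finally show ?thesis using i by simp
qed

lemma vertex_in_cell: "j \<in> N \<Longrightarrow> v j \<in> cell v"
  by (auto simp: cell_iff bary_vertex)

lemma center_in_cell: "ctr \<in> cell v"
  by (auto simp: cell_iff bary_center)

text \<open>The minimum of all \<lambda>_m is piecewise linear, vanishes at the vertices and equals
  1/(d + 1) at the centre. Subtracting it from \<lambda>_i cancels the value at the centre and keeps
  the vertex values; uniqueness is \<open>subcell_affine_eq\<close>.\<close>

lemma baryR_eq: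
  assumes i: "i \<in> N"
  shows "baryR v i = (\<lambda>x. if x \<in> cell v then bary v i x - Min ((\<lambda>m. bary v m x) ` N) else 0)"
  unfolding baryR_N
proof (rule the_equality)
  let ?r = "\<lambda>x. if x \<in> cell v then bary v i x - Min ((\<lambda>m. bary v m x) ` N) else 0"
  have r_sub: "?r x = bary v i x - bary v m x" if "m \<in> N" "x \<in> subcell v m" for m x
  proof -
    have "Min ((\<lambda>m. bary v m x) ` N) = bary v m x"
      using that by (intro Min_eqI) (auto simp: subcell_iff)
    then show ?thesis using that by (simp add: subcell_iff)
  qed
  have "continuous_on (cell v) (\<lambda>x. bary v i x - Min ((\<lambda>m. bary v m x) ` N))"
    by (intro continuous_intros continuous_on_Min_image) auto
  then have "continuous_on (cell v) ?r" by (rule continuous_on_eq) simp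
  moreover have "\<exists>a b. \<forall>x\<in>subcell v m. ?r x = a \<bullet> x + b" if m: "m \<in> N" for m
  proof (intro exI ballI)
    fix x assume "x \<in> subcell v m"
    then show "?r x = (grad i - grad m) \<bullet> x + (bary v i 0 - bary v m 0)"
      unfolding r_sub[OF m \<open>x \<in> subcell v m\<close>] by (simp add: inner_diff_left grad_inner)
  qed
  moreover have "?r (v j) = (if j = i then 1 else 0)" if j: "j \<in> N" for j
  proof -
    obtain m where m: "m \<in> N" "m \<noteq> j" by (rule obtain_other)
    have "v j \<in> subcell v m"
      using m j vertex_in_cell[OF j] by (auto simp: subcell_iff bary_vertex)
    then show ?thesis using r_sub[OF m(1)] j m by (auto simp: bary_vertex)
  qed
  moreover have "?r ctr = 0"
  proof -
    have "ctr \<in> subcell v i" using i center_in_cell by (auto simp: subcell_iff bary_center)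
    then show ?thesis using r_sub[OF i] by simp
  qed
  ultimately show "continuous_on (cell v) ?r \<and> (\<forall>m\<in>N. \<exists>a b. \<forall>x\<in>subcell v m. ?r x = a \<bullet> x + b) \<and>
      (\<forall>j\<in>N. ?r (v j) = (if j = i then 1 else 0)) \<and> ?r ctr = 0 \<and> (\<forall>x. x \<notin> cell v \<longrightarrow> ?r x = 0)"
    by simp
  fix g
  assume g: "continuous_on (cell v) g \<and> (\<forall>m\<in>N. \<exists>a b. \<forall>x\<in>subcell v m. g x = a \<bullet> x + b) \<and>
      (\<forall>j\<in>N. g (v j) = (if j = i then 1 else 0)) \<and> g ctr = 0 \<and> (\<forall>x. x \<notin> cell v \<longrightarrow> g x = 0)"
  show "g = ?r"
  proof
    fix x
    show "g x = ?r x"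
    proof (cases "x \<in> cell v")
      case True
      then obtain m where m: "m \<in> N" "x \<in> subcell v m" by (rule in_some_subcell)
      then obtain a b where ab: "\<forall>x\<in>subcell v m. g x = a \<bullet> x + b" using g by blast
      then have "g x = bary v i x - bary v m x"
        using m g by (intro subcell_affine_eq[OF m(1) i, of g a b]) auto
      then show ?thesis using r_sub[OF m] by simp
    qed (use g in auto)
  qed
qed

lemma baryR_subcell:
  assumes "i \<in> N" "m \<in> N" "x \<in> subcell v m"
  shows "baryR v i x = bary v i x - bary v m x"
proof -
  have "Min ((\<lambda>m. bary v m x) ` N) = bary v m x"
    using assms by (intro Min_eqI) (auto simp: subcell_iff)
  then show ?thesis using assms by (simp add: baryR_eq subcell_iff)
qed

lemma compact_cell: "compact (cell v)"
  and compact_face: "f \<subseteq> N \<Longrightarrow> compact (face v f)"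
  and compact_subcell: "compact (subcell v m)"
  using finite_subset[OF _ finite_N, of f] unfolding cell_N face_def subcell_def
  by (simp_all add: finite_imp_compact_convex_hull)

section \<open>Open cells, described by strict inequalities\<close>

definition icell :: "(real^'n) set" where "icell = {x. \<forall>i\<in>N. 0 < bary v i x}"

definition isubcell :: "nat \<Rightarrow> (real^'n) set"
  where "isubcell m = {x. \<forall>i\<in>N. 0 < bary v i x \<and> (i \<noteq> m \<longrightarrow> bary v m x < bary v i x)}"

lemma open_icell: "open icell"
proof -
  have "icell = (\<Inter>i\<in>N. {x. 0 < bary v i x})" by (auto simp: icell_def)
  moreover have "open {x. 0 < bary v i x}" for i
    by (intro open_Collect_less continuous_on_const continuous_bary)
  ultimately show ?thesis by (simp add: open_INT)
qed

lemma open_isubcell: "open (isubcell m)"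
proof -
  have "isubcell m = icell \<inter> (\<Inter>i\<in>N - {m}. {x. bary v m x < bary v i x})"
    by (auto simp: isubcell_def icell_def)
  moreover have "open {x. bary v m x < bary v i x}" for i
    by (intro open_Collect_less continuous_bary)
  ultimately show ?thesis by (simp add: open_INT open_icell open_Int)
qed

lemma icell_subset: "icell \<subseteq> cell v"
  by (auto simp: icell_def cell_iff less_imp_le)

lemma isubcell_subset: "isubcell m \<subseteq> icell"
  by (auto simp: isubcell_def icell_def)

lemma isubcell_in_subcell:
  assumes "x \<in> isubcell m" "m \<in> N" "j \<in> N"
  shows "x \<in> subcell v j \<longleftrightarrow> j = m"
proof -
  have x: "x \<in> cell v" using assms isubcell_subset icell_subset by blast
  show ?thesis
  proof
    assume "x \<in> subcell v j"
    then have "bary v j x \<le> bary v m x" using assms subcell_iff by auto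
    then show "j = m" using assms by (auto simp: isubcell_def)
  next
    assume "j = m"
    moreover have "\<forall>i\<in>N. bary v m x \<le> bary v i x"
      using assms unfolding isubcell_def by (metis (mono_tags, lifting) mem_Collect_eq order.refl order_less_imp_le)
    ultimately show "x \<in> subcell v j" using assms x subcell_iff by blast
  qed
qed

lemma negligible_bary_zero: "i \<in> N \<Longrightarrow> negligible {x. bary v i x = 0}"
proof -
  assume "i \<in> N"
  then have "negligible {x. grad i \<bullet> x = - bary v i 0}"
    using grad_nz negligible_hyperplane by blast
  moreover have "{x. grad i \<bullet> x = - bary v i 0} = {x. bary v i x = 0}"
    by (auto simp: grad_inner)
  ultimately show ?thesis by simp
qed

lemma negligible_cell_diff: "negligible (cell v - icell)"
proof -
  have "negligible (\<Union>((\<lambda>i. {x. bary v i x = 0}) ` N))"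
  proof (rule negligible_Union)
    show "finite ((\<lambda>i. {x. bary v i x = 0}) ` N)" by (rule finite_imageI) simp
    show "negligible T" if "T \<in> (\<lambda>i. {x. bary v i x = 0}) ` N" for T
      using that negligible_bary_zero by blast
  qed
  moreover have "cell v - icell \<subseteq> \<Union>((\<lambda>i. {x. bary v i x = 0}) ` N)"
  proof
    fix x assume "x \<in> cell v - icell"
    then have ge: "\<forall>i\<in>N. 0 \<le> bary v i x" and "\<not> (\<forall>i\<in>N. 0 < bary v i x)"
      by (simp_all add: icell_def cell_iff)
    then obtain i where i: "i \<in> N" "\<not> 0 < bary v i x" by meson
    then have "bary v i x = 0" using ge by fastforce
    then show "x \<in> \<Union>((\<lambda>i. {x. bary v i x = 0}) ` N)" using i(1) by simp metis
  qed
  ultimately show ?thesis by (rule negligible_subset)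
qed

end

section \<open>Polynomials in barycentric coordinates\<close>

lemma subspace_polys: "subspace (polys r)"
  by (simp add: polys_def)

lemma polys_mult:
  assumes "p \<in> polys r" and "q \<in> polys s"
  shows "(\<lambda>x. p x * q x) \<in> polys (r + s)"
  using subspace_polys linear_fun_mult(2) linear_fun_mult(1) _ assms[unfolded polys_def]
proof (rule span_bilinear)
  fix p q :: "real^'n \<Rightarrow> real"
  assume "p \<in> {\<lambda>x. \<Prod>i\<in>UNIV. (x $ i) ^ a i | a :: 'n \<Rightarrow> nat. sum a UNIV \<le> r}"
    "q \<in> {\<lambda>x. \<Prod>i\<in>UNIV. (x $ i) ^ a i | a :: 'n \<Rightarrow> nat. sum a UNIV \<le> s}"
  then obtain a b :: "'n \<Rightarrow> nat"
    where p: "p = (\<lambda>x. \<Prod>i\<in>UNIV. (x $ i) ^ a i)" "sum a UNIV \<le> r"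
      and q: "q = (\<lambda>x. \<Prod>i\<in>UNIV. (x $ i) ^ b i)" "sum b UNIV \<le> s"
    by blast
  have "(\<lambda>x. p x * q x) = (\<lambda>x. \<Prod>i\<in>UNIV. (x $ i) ^ (a i + b i))"
    unfolding p q by (simp add: prod.distrib power_add)
  moreover have "sum (\<lambda>i. a i + b i) UNIV \<le> r + s" using p q by (simp add: sum.distrib)
  ultimately show "(\<lambda>x. p x * q x) \<in> polys (r + s)"
    unfolding polys_def by (intro span_base CollectI exI[of _ "\<lambda>i. a i + b i"]) simp
qed

lemma polys_one: "(\<lambda>x. 1) \<in> polys r"
  unfolding polys_def by (intro span_base CollectI exI[of _ "\<lambda>_. 0"]) simp

lemma polys_scale: "p \<in> polys r \<Longrightarrow> (\<lambda>x. c * p x) \<in> polys r"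
  using subspace_scale[OF subspace_polys, of p r c] by (simp add: scaleR_fun_def)

lemma polys_add: "p \<in> polys r \<Longrightarrow> q \<in> polys r \<Longrightarrow> (\<lambda>x. p x + q x) \<in> polys r"
  using subspace_add[OF subspace_polys, of p r q] by (simp add: plus_fun_def)

lemma polys_const: "(\<lambda>x. c) \<in> polys r"
  using polys_scale[OF polys_one, of c r] by simp

lemma polys_sum: "(\<And>i. i \<in> I \<Longrightarrow> p i \<in> polys r) \<Longrightarrow> (\<lambda>x. \<Sum>i\<in>I. p i x) \<in> polys r"
  by (induct I rule: infinite_finite_induct) (simp_all add: polys_const polys_add)

lemma polys_coord: "(\<lambda>x. x $ i) \<in> polys 1"
  for i :: "'n::finite"
proof -
  let ?a = "\<lambda>j::'n. if j = i then 1 else 0 :: nat"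
  have "(\<Prod>j\<in>UNIV. (x $ j) ^ ?a j) = (\<Prod>j\<in>UNIV. if j = i then x $ i else 1)" for x :: "real^'n"
    by (rule prod.cong) auto
  then have "(\<lambda>x. x $ i) = (\<lambda>x::real^'n. \<Prod>j\<in>UNIV. (x $ j) ^ ?a j)" by simp
  moreover have "sum ?a UNIV \<le> 1" by simp
  ultimately show ?thesis unfolding polys_def by (intro span_base CollectI exI[of _ ?a]) blast
qed

lemma polys_affine: "(\<lambda>x. a \<bullet> x + b) \<in> polys 1"
  unfolding inner_vec_def inner_real_def
  by (intro polys_add polys_sum polys_scale polys_coord polys_const)

lemma polys_power: "p \<in> polys 1 \<Longrightarrow> (\<lambda>x. p x ^ n) \<in> polys n"
proof (induct n)
  case (Suc n)
  then show ?case using polys_mult[of p 1 "\<lambda>x. p x ^ n" n] by simp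
qed (simp add: polys_const)

lemma mon_in_polys:
  assumes "finite f" and "\<And>i. i \<in> f \<Longrightarrow> mu i \<in> polys 1"
  shows "mon mu f a \<in> polys (sum a f)"
  using assms
proof (induct f rule: finite_induct)
  case empty
  then show ?case by (simp add: mon_def polys_const)
next
  case (insert i f)
  then have "(\<lambda>x. mu i x ^ a i * mon mu f a x) \<in> polys (a i + sum a f)"
    by (intro polys_mult polys_power) auto
  then show ?case using insert by (simp add: mon_def)
qed

context simplex
begin

lemma bary_in_polys: "bary v i \<in> polys 1"
  using polys_affine[of "grad i" "bary v i 0"] by (simp add: grad_inner)

lemma bary_in_hom: "i \<in> N \<Longrightarrow> bary v i \<in> hom_polys (bary v) N 1"
  by (rule hom_polys_gen) simp

lemma coord_in_hom: "(\<lambda>x. x $ i) \<in> hom_polys (bary v) N 1"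
proof -
  have eq: "x $ i = (\<Sum>j\<in>N. (v j $ i) *\<^sub>R bary v j x)" for x
  proof -
    have "x $ i = (\<Sum>j\<in>N. bary v j x *\<^sub>R v j) $ i" by (simp only: bary_repr)
    then show ?thesis by (simp add: mult.commute)
  qed
  have "(\<lambda>x. x $ i) = (\<Sum>j\<in>N. (v j $ i) *\<^sub>R bary v j)"
    by (rule ext) (simp only: sum_fun_apply scaleR_fun_apply eq[symmetric])
  also have "\<dots> \<in> hom_polys (bary v) N 1"
    by (intro subspace_sum subspace_scale subspace_hom_polys bary_in_hom)
  finally show ?thesis .
qed

lemma one_in_hom: "(\<lambda>x. 1) \<in> hom_polys (bary v) N (int r)"
proof (induct r)
  case 0
  show ?case using hom_polys_one by simp
next
  case (Suc r)
  have "(\<lambda>x. 1) = (\<Sum>j\<in>N. bary v j)"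
    by (intro ext) (simp add: sum_fun_apply bary_sum)
  also have "\<dots> \<in> hom_polys (bary v) N 1"
    by (intro subspace_sum subspace_hom_polys bary_in_hom)
  finally have "(\<lambda>x. 1) \<in> hom_polys (bary v) N 1" .
  from hom_polys_mult[OF this Suc] show ?case by simp
qed

lemma coords_in_hom:
  "finite I \<Longrightarrow> (\<lambda>x. \<Prod>i\<in>I. (x $ i) ^ a i) \<in> hom_polys (bary v) N (int (sum a I))"
proof (induct I rule: finite_induct)
  case empty
  show ?case using hom_polys_one by simp
next
  case (insert i I)
  then show ?case using hom_polys_mult[OF hom_power[OF coord_in_hom[of i], of "a i"] insert(3)] by simp
qed

text \<open>Monomials of too low degree are homogenised by powers of 1, the sum of all \<lambda>_i;
  conversely each \<lambda>_i is affine.\<close>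

lemma polys_eq_hom: "polys r = hom_polys (bary v) N (int r)"
proof
  show "polys r \<subseteq> hom_polys (bary v) N (int r)"
    unfolding polys_def
  proof (rule span_minimal[OF _ subspace_hom_polys], rule subsetI)
    fix p :: "real^'n \<Rightarrow> real"
    assume "p \<in> {\<lambda>x. \<Prod>i\<in>UNIV. (x $ i) ^ a i | a :: 'n \<Rightarrow> nat. sum a UNIV \<le> r}"
    then obtain a :: "'n \<Rightarrow> nat" where p: "p = (\<lambda>x. \<Prod>i\<in>UNIV. (x $ i) ^ a i)" "sum a UNIV \<le> r"
      by blast
    have "(\<lambda>x. p x * 1) \<in> hom_polys (bary v) N (int (sum a UNIV) + int (r - sum a UNIV))"
      unfolding p by (rule hom_polys_mult[OF coords_in_hom[OF finite] one_in_hom])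
    moreover have "int (sum a UNIV) + int (r - sum a UNIV) = int r" using p(2) by linarith
    ultimately show "p \<in> hom_polys (bary v) N (int r)" by (simp only: mult_1_right)
  qed
  show "hom_polys (bary v) N (int r) \<subseteq> polys r"
    unfolding hom_polys_eq_span
  proof (rule span_minimal[OF _ subspace_polys], rule image_subsetI)
    fix a assume "a \<in> midx N r"
    then have "sum a N = r" by (simp add: midx_def)
    then show "mon (bary v) N a \<in> polys r"
      using mon_in_polys[OF finite_N bary_in_polys, where a=a] by simp
  qed
qed

lemma hom_subset_polys: "f \<subseteq> N \<Longrightarrow> hom_polys (bary v) f (int r) \<subseteq> polys r"
  unfolding hom_polys_eq_span
proof (rule span_minimal[OF _ subspace_polys], rule image_subsetI)
  fix a assume f: "f \<subseteq> N" and "a \<in> midx f r"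
  then have "sum a f = r" by (simp add: midx_def)
  then show "mon (bary v) f a \<in> polys r"
    using mon_in_polys[OF finite_subset[OF f finite_N] bary_in_polys, where a=a] by simp
qed

text \<open>The relative interior of the facet opposite to vertex m. Its points lie in no subcell
  except m, which is why traces are compared here.\<close>

definition rface :: "nat \<Rightarrow> (real^'n) set"
  where "rface m = {x. bary v m x = 0 \<and> (\<forall>i\<in>N - {m}. 0 < bary v i x)}"

text \<open>A positive vector y becomes a point of the open facet after division by its sum s. By
  homogeneity every monomial of degree r changes by the same factor s^r, so vanishing on the facet
  gives vanishing for all positive y.\<close>

lemma face_monomials_independent:
  fixes c :: "(nat \<Rightarrow> nat) \<Rightarrow> 'b::real_inner"
  assumes m: "m \<in> N"
    and 0: "\<And>x. x \<in> rface m \<Longrightarrow> (\<Sum>a\<in>midx (N - {m}) r. mon (bary v) (N - {m}) a x *\<^sub>R c a) = 0"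
    and a: "a \<in> midx (N - {m}) r"
  shows "c a = 0"
proof -
  let ?F = "N - {m}"
  have fin: "finite ?F" by simp
  obtain j where j: "j \<in> N" "j \<noteq> m" by (rule obtain_other)
  have "c a \<bullet> w = 0" for w
    using fin finite_midx[OF fin] _ _ a
  proof (rule monomials_independent)
    show "a = b" if "a \<in> midx ?F r" "b \<in> midx ?F r" "\<And>i. i \<in> ?F \<Longrightarrow> a i = b i" for a b
    proof
      fix i show "a i = b i" by (cases "i \<in> ?F") (use that in \<open>simp_all add: midx_def\<close>)
    qed
    fix y :: "nat \<Rightarrow> real" assume y: "\<And>i. i \<in> ?F \<Longrightarrow> 0 < y i"
    define s where "s = sum y ?F"
    have s: "0 < s" unfolding s_def using fin j y by (intro sum_pos) auto
    define u where "u = (\<lambda>i. if i = m then 0 else y i / s)"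
    define x where "x = (\<Sum>i\<in>N. u i *\<^sub>R v i)"
    have "sum u N = sum u ?F" by (rule sum.mono_neutral_right) (auto simp: u_def)
    also have "\<dots> = (\<Sum>i\<in>?F. y i / s)" by (rule sum.cong) (auto simp: u_def)
    also have "\<dots> = 1" using s by (simp add: s_def flip: sum_divide_distrib)
    finally have bu: "bary v i x = u i" if "i \<in> N" for i
      using that by (intro bary_unique) (simp_all add: x_def)
    have "x \<in> rface m" unfolding rface_def using m y s by (simp add: bu u_def)
    have mon: "mon (bary v) ?F b x = (\<Prod>i\<in>?F. y i ^ b i) / s ^ r" if "b \<in> midx ?F r" for b
    proof -
      have "mon (bary v) ?F b x = (\<Prod>i\<in>?F. (y i / s) ^ b i)"
        unfolding mon_def by (intro prod.cong) (auto simp: bu u_def)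
      also have "\<dots> = (\<Prod>i\<in>?F. y i ^ b i) / (\<Prod>i\<in>?F. s ^ b i)"
        by (simp only: power_divide prod_dividef)
      also have "(\<Prod>i\<in>?F. s ^ b i) = s ^ r"
        using that by (simp only: midx_def mem_Collect_eq power_sum[symmetric])
      finally show ?thesis .
    qed
    have "0 = (\<Sum>b\<in>midx ?F r. mon (bary v) ?F b x *\<^sub>R c b) \<bullet> w * s ^ r"
      using 0[OF \<open>x \<in> rface m\<close>] by simp
    also have "\<dots> = (\<Sum>b\<in>midx ?F r. c b \<bullet> w * (\<Prod>i\<in>?F. y i ^ b i))"
      unfolding inner_sum_left sum_distrib_right
      using s by (intro sum.cong refl) (simp add: mon)
    finally show "(\<Sum>b\<in>midx ?F r. c b \<bullet> w * (\<Prod>i\<in>?F. y i ^ b i)) = 0" by simp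
  qed
  then show ?thesis by (metis inner_eq_zero_iff)
qed

section \<open>Divisibility by barycentric coordinates\<close>

lemma mon_remove:
  assumes "finite f" and "a m = 0"
  shows "mon mu f a = mon mu (f - {m}) a"
proof (cases "m \<in> f")
  case True
  then show ?thesis using assms by (intro ext) (simp add: mon_def prod.remove[of f m])
qed simp

lemma midx_remove: "finite f \<Longrightarrow> {a \<in> midx f r. a m = 0} = midx (f - {m}) r"
proof (cases "m \<in> f")
  assume f: "finite f"
  case True
  have "sum a f = a m + sum a (f - {m})" for a :: "nat \<Rightarrow> nat" using f True by (rule sum.remove)
  then show ?thesis by (auto simp: midx_def)
next
  case False
  then show ?thesis by (auto simp: midx_def)
qed

text \<open>The monomials without \<lambda>_m form q; every other one has a factor \<lambda>_m to
  spare. The polynomial q extends the facet values of p to a function homogeneous about v_m, as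
  Euler's identity requires later.\<close>

lemma poly_split_face:
  assumes m: "m \<in> N" and p: "p \<in> polys (Suc r)"
  obtains q s where "q \<in> hom_polys (bary v) (N - {m}) (int (Suc r))" "s \<in> polys r"
    "\<And>x. p x = q x + bary v m x * s x"
proof -
  obtain c where c: "p = (\<lambda>x. \<Sum>a\<in>midx N (Suc r). c a * mon (bary v) N a x)"
    using p unfolding polys_eq_hom hom_polys_iff[OF finite_N] by blast
  define q where "q = (\<lambda>x. \<Sum>a\<in>midx (N - {m}) (Suc r). c a * mon (bary v) (N - {m}) a x)"
  define B where "B = {a \<in> midx N (Suc r). a m \<noteq> 0}"
  define s where "s = (\<lambda>x. \<Sum>a\<in>B. c a * mon (bary v) N (a(m := a m - 1)) x)"
  have "q \<in> hom_polys (bary v) (N - {m}) (int (Suc r))"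
    unfolding q_def by (subst hom_polys_iff) auto
  moreover have "s \<in> polys r"
    unfolding s_def
  proof (intro polys_sum polys_scale)
    fix a assume "a \<in> B"
    then have a: "sum a N = Suc r" "a m \<noteq> 0" by (simp_all add: B_def midx_def)
    have eq: "sum (a(m := a m - 1)) (N - {m}) = sum a (N - {m})"
      by (rule sum.cong) auto
    have "sum (a(m := a m - 1)) N = (a m - 1) + sum a (N - {m})"
      by (subst sum.remove[OF finite_N m]) (simp only: eq fun_upd_same)
    also have "\<dots> = r" using a sum.remove[OF finite_N m, of a] by simp
    finally show "mon (bary v) N (a(m := a m - 1)) \<in> polys r"
      using mon_in_polys[OF finite_N bary_in_polys, where a="a(m := a m - 1)"] by simp
  qed
  moreover have "p x = q x + bary v m x * s x" for x
  proof -
    have fB: "finite B" and sub: "midx (N - {m}) (Suc r) \<union> B = midx N (Suc r)"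
      and dis: "midx (N - {m}) (Suc r) \<inter> B = {}"
      unfolding B_def midx_remove[OF finite_N, symmetric] by auto
    have "p x = (\<Sum>a\<in>midx (N - {m}) (Suc r). c a * mon (bary v) N a x)
        + (\<Sum>a\<in>B. c a * mon (bary v) N a x)"
      unfolding c sub[symmetric] by (rule sum.union_disjoint) (simp_all add: fB dis)
    also have "(\<Sum>a\<in>midx (N - {m}) (Suc r). c a * mon (bary v) N a x) = q x"
      unfolding q_def
    proof (rule sum.cong[OF refl])
      fix a assume "a \<in> midx (N - {m}) (Suc r)"
      then have "a m = 0" by (simp add: midx_def)
      then show "c a * mon (bary v) N a x = c a * mon (bary v) (N - {m}) a x"
        by (subst mon_remove[of N a m]) simp_all
    qed
    also have "(\<Sum>a\<in>B. c a * mon (bary v) N a x) = bary v m x * s x"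
      unfolding s_def sum_distrib_left
    proof (rule sum.cong[OF refl])
      fix a assume "a \<in> B"
      then have a: "a m = Suc (a m - 1)" by (simp add: B_def)
      have eq: "(\<Prod>i\<in>N - {m}. bary v i x ^ (a(m := a m - 1)) i) = (\<Prod>i\<in>N - {m}. bary v i x ^ a i)"
        by (rule prod.cong) auto
      have rem: "mon (bary v) N b x = bary v m x ^ b m * (\<Prod>i\<in>N - {m}. bary v i x ^ b i)" for b
        unfolding mon_def by (rule prod.remove[OF finite_N m])
      have "mon (bary v) N a x = bary v m x ^ a m * (\<Prod>i\<in>N - {m}. bary v i x ^ a i)"
        by (rule rem)
      also have "bary v m x ^ a m = bary v m x * bary v m x ^ (a m - 1)"
        by (subst a) (simp only: power_Suc)
      also have "\<dots> * (\<Prod>i\<in>N - {m}. bary v i x ^ a i) = bary v m x * mon (bary v) N (a(m := a m - 1)) x"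
        unfolding rem eq by (simp only: fun_upd_same mult.assoc)
      finally show "c a * mon (bary v) N a x = bary v m x * (c a * mon (bary v) N (a(m := a m - 1)) x)"
        by simp
    qed
    finally show ?thesis .
  qed
  ultimately show ?thesis by (rule that)
qed

text \<open>On the facet p equals its part q from \<open>poly_split_face\<close>, whose coefficients
  vanish by independence of the facet monomials.\<close>

lemma poly_vanish_face:
  assumes m: "m \<in> N" and p: "p \<in> polys (Suc r)" and 0: "\<And>x. x \<in> rface m \<Longrightarrow> p x = 0"
  obtains s where "s \<in> polys r" "\<And>x. p x = bary v m x * s x"
proof -
  obtain q s where q: "q \<in> hom_polys (bary v) (N - {m}) (int (Suc r))" and s: "s \<in> polys r"
    and eq: "\<And>x. p x = q x + bary v m x * s x"
    using poly_split_face[OF m p] by metis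
  have fin: "finite (N - {m})" by simp
  obtain c where c: "q = (\<lambda>x. \<Sum>a\<in>midx (N - {m}) (Suc r). c a * mon (bary v) (N - {m}) a x)"
    using q unfolding hom_polys_iff[OF fin] by blast
  have "c a = 0" if "a \<in> midx (N - {m}) (Suc r)" for a
    using m _ that
  proof (rule face_monomials_independent)
    fix x assume x: "x \<in> rface m"
    then have "q x = 0" using eq[of x] 0[of x] by (simp add: rface_def)
    then show "(\<Sum>a\<in>midx (N - {m}) (Suc r). mon (bary v) (N - {m}) a x *\<^sub>R c a) = 0"
      unfolding c by (simp add: mult.commute)
  qed
  then have "q x = 0" for x unfolding c by simp
  then show ?thesis using that[OF s] eq by simp
qed

lemma poly_vanish_two_faces:
  assumes i: "i \<in> N" and j: "j \<in> N" and ij: "i \<noteq> j" and p: "p \<in> polys (Suc (Suc r))"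
    and 0: "\<And>x. x \<in> rface i \<Longrightarrow> p x = 0" "\<And>x. x \<in> rface j \<Longrightarrow> p x = 0"
  obtains s where "s \<in> polys r" "\<And>x. p x = bary v i x * bary v j x * s x"
proof -
  obtain s where s: "s \<in> polys (Suc r)" "\<And>x. p x = bary v i x * s x"
    using poly_vanish_face[OF i p 0(1)] by blast
  have "s x = 0" if x: "x \<in> rface j" for x
  proof -
    have "0 < bary v i x" using x i ij by (simp add: rface_def)
    moreover have "bary v i x * s x = 0" using 0(2)[OF x] s(2)[of x] by simp
    ultimately show ?thesis by simp
  qed
  from poly_vanish_face[OF j s(1) this]
  obtain t where "t \<in> polys r" "\<And>x. s x = bary v j x * t x" by blast
  then show ?thesis using that[of t] s(2) by (simp add: mult.assoc)
qed

end

section \<open>Symmetric tensors\<close>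

lemma tensor_mult [simp]: "(a \<otimes>\<^sub>t b) *v x = (b \<bullet> x) *\<^sub>R a"
  by (simp add: vec_eq_iff tensor_def matrix_vector_mult_def inner_vec_def sum_distrib_left mult_ac)

lemma transpose_tensor: "transpose (a \<otimes>\<^sub>t b) = b \<otimes>\<^sub>t a"
  by (simp add: vec_eq_iff tensor_def transpose_def mult.commute)

lemma transpose_add: "transpose (A + B) = transpose A + transpose B"
  by (simp add: vec_eq_iff transpose_def)

lemma transpose_scaleR: "transpose (c *\<^sub>R A) = c *\<^sub>R transpose A"
  by (simp add: vec_eq_iff transpose_def)

lemma transpose_sum: "transpose (\<Sum>i\<in>I. f i) = (\<Sum>i\<in>I. transpose (f i))"
  by (simp add: vec_eq_iff transpose_def)

lemma mult_vec_add: "(A + B) *v x = A *v x + B *v x" for A :: "real^'n^'m"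
  by (simp add: matrix_vector_mult_add_rdistrib)

lemma mult_vec_scaleR: "(c *\<^sub>R A) *v x = c *\<^sub>R (A *v x)" for A :: "real^'n^'m"
  by (simp add: scaleR_matrix_vector_assoc)

lemma mult_vec_sum: "(\<Sum>i\<in>I. f i) *v x = (\<Sum>i\<in>I. f i *v x)" for f :: "'i \<Rightarrow> real^'n^'m"
  by (induct I rule: infinite_finite_induct) (simp_all add: mult_vec_add)

lemma mult_vec_sum_right: "A *v (\<Sum>i\<in>I. f i) = (\<Sum>i\<in>I. A *v f i)" for A :: "real^'n^'m"
  by (rule linear_sum) (rule matrix_vector_mul_linear)

lemma mult_vec_scaleR_right: "A *v (c *\<^sub>R x) = c *\<^sub>R (A *v x)" for A :: "real^'n^'m"
  by (rule linear_scale) (rule matrix_vector_mul_linear)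

lemma symm_tensor_mult:
  "symm (a \<otimes>\<^sub>t b) *v x = (1/2) *\<^sub>R ((b \<bullet> x) *\<^sub>R a + (a \<bullet> x) *\<^sub>R b)"
  by (simp only: symm_def transpose_tensor mult_vec_scaleR mult_vec_add tensor_mult)

lemma transpose_symm: "transpose (symm A) = symm A"
  by (simp add: symm_def transpose_add transpose_scaleR add.commute)

lemma tensor_add_left: "(a + b) \<otimes>\<^sub>t c = a \<otimes>\<^sub>t c + b \<otimes>\<^sub>t c"
  by (simp add: vec_eq_iff tensor_def algebra_simps)

lemma tensor_scaleR_right: "a \<otimes>\<^sub>t (r *\<^sub>R b) = r *\<^sub>R (a \<otimes>\<^sub>t b)"
  by (simp add: vec_eq_iff tensor_def)

lemma tensor_add_right: "a \<otimes>\<^sub>t (b + c) = a \<otimes>\<^sub>t b + a \<otimes>\<^sub>t c"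
  by (simp add: vec_eq_iff tensor_def algebra_simps)

lemma symm_add: "symm (A + B) = symm A + symm B"
  by (simp add: symm_def transpose_add algebra_simps)

lemma symm_scaleR: "symm (c *\<^sub>R A) = c *\<^sub>R symm A"
  by (simp add: symm_def transpose_scaleR scaleR_add_right)

lemma transpose_inner_swap:
  fixes A :: "real^'n^'n"
  assumes "transpose A = A"
  shows "x \<bullet> (A *v y) = y \<bullet> (A *v x)"
  by (metis assms dot_lmul_matrix inner_commute transpose_matrix_vector)

lemma inner_tensor: "A \<bullet> (a \<otimes>\<^sub>t b) = a \<bullet> (A *v b)" for A :: "real^'n^'n"
  by (simp add: inner_vec_def tensor_def matrix_vector_mult_def sum_distrib_left mult_ac)

lemma inner_symm_tensor:
  fixes A :: "real^'n^'n"
  assumes "transpose A = A"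
  shows "A \<bullet> symm (a \<otimes>\<^sub>t b) = a \<bullet> (A *v b)"
  using transpose_inner_swap[OF assms, of a b]
  by (simp add: symm_def transpose_tensor inner_tensor inner_add_right)

lemma matrix_eqI: "(\<And>x. A *v x = B *v x) \<Longrightarrow> A = B" for A :: "real^'n^'m"
  by (simp add: matrix_eq)

context simplex
begin

lemma tangent_edge: "i \<in> f \<Longrightarrow> j \<in> f \<Longrightarrow> v j - v i \<in> tangent_space v f"
  unfolding tangent_space_def by (intro span_base) blast

lemma subspace_tangent: "subspace (tangent_space v f)"
  by (simp add: tangent_space_def)

lemma normal_tangent: "x \<in> normal_space v f \<Longrightarrow> t \<in> tangent_space v f \<Longrightarrow> t \<bullet> x = 0"
  by (simp add: normal_space_def orthogonal_comp_def orthogonal_def)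

lemma normal_spaceI:
  assumes "\<And>i j. i \<in> f \<Longrightarrow> j \<in> f \<Longrightarrow> (v j - v i) \<bullet> x = 0"
  shows "x \<in> normal_space v f"
proof -
  have "tangent_space v f \<subseteq> {t. t \<bullet> x = 0}"
    unfolding tangent_space_def
  proof (rule span_minimal)
    show "{v j - v i |i j. i \<in> f \<and> j \<in> f} \<subseteq> {t. t \<bullet> x = 0}" using assms by blast
    show "subspace {t. t \<bullet> x = 0}" by (simp add: subspace_def inner_add_left)
  qed
  then show ?thesis
    unfolding normal_space_def orthogonal_comp_def orthogonal_def by blast
qed

lemma grad_normal:
  assumes f: "f \<subseteq> N" and m: "m \<notin> f"
  shows "grad m \<in> normal_space v f"
proof (rule normal_spaceI)
  fix i j assume ij: "i \<in> f" "j \<in> f"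
  then have "grad m \<bullet> (v j - v i) = 0" using f m by (subst grad_edge) auto
  then show "(v j - v i) \<bullet> grad m = 0" by (simp only: inner_commute)
qed

text \<open>This is \<open>grad_dual\<close> with the origin moved to v_p, which is allowed because
  the gradients sum to zero. The terms for m in f vanish since v_m - v_p is tangential; thus the
  gradients of the vertices off f span the normal space.\<close>

lemma normal_repr:
  assumes f: "f \<subseteq> N" and p: "p \<in> f" and x: "x \<in> normal_space v f"
  shows "x = (\<Sum>m\<in>N - f. ((v m - v p) \<bullet> x) *\<^sub>R grad m)"
proof -
  have "x = (\<Sum>m\<in>N. (v m \<bullet> x) *\<^sub>R grad m) - (v p \<bullet> x) *\<^sub>R (\<Sum>m\<in>N. grad m)"
    by (simp add: grad_dual grad_sum)
  also have "\<dots> = (\<Sum>m\<in>N. ((v m - v p) \<bullet> x) *\<^sub>R grad m)"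
    by (simp add: inner_diff_left scaleR_diff_left sum_subtractf scaleR_sum_right)
  also have "\<dots> = (\<Sum>m\<in>N - f. ((v m - v p) \<bullet> x) *\<^sub>R grad m)"
  proof (rule sum.mono_neutral_right)
    show "\<forall>m\<in>N - (N - f). ((v m - v p) \<bullet> x) *\<^sub>R grad m = 0"
      using normal_tangent[OF x tangent_edge[OF p]] by auto
  qed auto
  finally show ?thesis .
qed

lemma tangent_normal_decomp:
  obtains t u where "t \<in> tangent_space v f" "u \<in> normal_space v f" "x = t + u"
proof -
  obtain y z where yz: "y \<in> span (tangent_space v f)"
    "\<And>w. w \<in> span (tangent_space v f) \<Longrightarrow> orthogonal z w" "x = y + z"
    using orthogonal_subspace_decomp_exists[of "tangent_space v f" x] by metis
  have eq: "span (tangent_space v f) = tangent_space v f"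
    using subspace_tangent by (simp add: span_eq_iff)
  have "z \<in> normal_space v f"
    using yz(2) unfolding eq normal_space_def orthogonal_comp_def by (simp add: orthogonal_commute)
  then show ?thesis using that yz(1,3) unfolding eq by blast
qed

lemma subspace_normal_tensors: "subspace (normal_tensors v f)"
  unfolding normal_tensors_def by (rule subspace_sums) simp_all

lemma normal_tensorsI:
  assumes b: "b \<in> normal_space v f"
  shows "symm (a \<otimes>\<^sub>t b) \<in> normal_tensors v f"
proof -
  obtain t u where tu: "t \<in> tangent_space v f" "u \<in> normal_space v f" "a = t + u"
    by (rule tangent_normal_decomp)
  have "symm (a \<otimes>\<^sub>t b) = symm (u \<otimes>\<^sub>t b) + symm (t \<otimes>\<^sub>t b)"
    unfolding tu(3) by (simp add: tensor_add_left symm_add)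
  moreover have "symm (u \<otimes>\<^sub>t b) \<in> span {symm (a \<otimes>\<^sub>t b) |a b. a \<in> normal_space v f \<and> b \<in> normal_space v f}"
    using tu b by (intro span_base) blast
  moreover have "symm (t \<otimes>\<^sub>t b) \<in> span {symm (a \<otimes>\<^sub>t b) |a b. a \<in> tangent_space v f \<and> b \<in> normal_space v f}"
    using tu b by (intro span_base) blast
  ultimately show ?thesis unfolding normal_tensors_def by blast
qed

text \<open>Symmetry and a vanishing tangential block are linear conditions, so it suffices to check
  generators.\<close>

lemma normal_tensorsD:
  assumes "A \<in> normal_tensors v f"
  shows "transpose A = A"
    and "x \<in> tangent_space v f \<Longrightarrow> y \<in> tangent_space v f \<Longrightarrow> x \<bullet> (A *v y) = 0"
proof -
  let ?S = "{A :: real^'n^'n. transpose A = A \<and>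
    (\<forall>x\<in>tangent_space v f. \<forall>y\<in>tangent_space v f. x \<bullet> (A *v y) = 0)}"
  have S: "subspace ?S"
    unfolding subspace_def
    by (auto simp: transpose_add transpose_scaleR mult_vec_add mult_vec_scaleR inner_add_right)
       (simp add: vec_eq_iff transpose_def)
  have gen: "symm (a \<otimes>\<^sub>t b) \<in> ?S" if "b \<in> normal_space v f" for a b
    using normal_tangent[OF that]
    by (simp add: transpose_symm symm_tensor_mult inner_add_right inner_commute[of b])
  obtain B C where A: "A = B + C"
    and B: "B \<in> span {symm (a \<otimes>\<^sub>t b) |a b. a \<in> normal_space v f \<and> b \<in> normal_space v f}"
    and C: "C \<in> span {symm (a \<otimes>\<^sub>t b) |a b. a \<in> tangent_space v f \<and> b \<in> normal_space v f}"
    using assms unfolding normal_tensors_def by blast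
  have "span {symm (a \<otimes>\<^sub>t b) |a b. a \<in> normal_space v f \<and> b \<in> normal_space v f} \<subseteq> ?S"
    "span {symm (a \<otimes>\<^sub>t b) |a b. a \<in> tangent_space v f \<and> b \<in> normal_space v f} \<subseteq> ?S"
    using gen by (intro span_minimal S; blast)+
  then have "A \<in> ?S" unfolding A using B C by (intro subspace_add[OF S]) blast+
  then show "transpose A = A"
    and "x \<in> tangent_space v f \<Longrightarrow> y \<in> tangent_space v f \<Longrightarrow> x \<bullet> (A *v y) = 0"
    by auto
qed

section \<open>Normal traces at a fixed multi-index\<close>

text \<open>The vector multiplying the monomial in the trace on facet m. The constant is 1/2 from
  the symmetrisation times (ctr - v_p) . grad m = 1/(d + 1). Traces are taken against
  \<open>grad m\<close> instead of a unit normal, which changes them by a nonzero factor.\<close>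

definition face_trace ::
    "nat set \<Rightarrow> nat \<Rightarrow> real^'n^'n \<Rightarrow> (nat \<Rightarrow> nat \<Rightarrow> real) \<Rightarrow> nat \<Rightarrow> real^'n"
  where "face_trace f p A a m =
    A *v grad m + (1 / (2 * (real CARD('n) + 1))) *\<^sub>R (\<Sum>j\<in>N - f. a m j *\<^sub>R (v j - v p))"

lemma grad_sum_edges:
  assumes f: "f \<subseteq> N" and p: "p \<in> f" and l: "l \<in> N - f"
  shows "grad l \<bullet> (\<Sum>j\<in>N - f. c j *\<^sub>R (v j - v p)) = c l"
proof -
  have "grad l \<bullet> (\<Sum>j\<in>N - f. c j *\<^sub>R (v j - v p)) = (\<Sum>j\<in>N - f. if j = l then c l else 0)"
    unfolding inner_sum_right
  proof (rule sum.cong[OF refl])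
    fix j assume j: "j \<in> N - f"
    then have "grad l \<bullet> (v j - v p) = (if l = j then 1 else 0)"
      using f p l by (subst grad_edge) auto
    then show "grad l \<bullet> (c j *\<^sub>R (v j - v p)) = (if j = l then c l else 0)" by simp
  qed
  also have "\<dots> = c l" using l by simp
  finally show ?thesis .
qed

text \<open>Testing the trace on the facet \<open>m\<close> against \<open>grad l\<close> separates the symmetric
  contribution of \<open>A\<close> from the antisymmetric contribution of \<open>a\<close>.\<close>

lemma face_trace_inj:
  assumes f: "f \<subseteq> N" and p: "p \<in> f" and A: "A \<in> normal_tensors v f"
    and a: "\<And>i j. a i j = - a j i"
    and 0: "\<And>m. m \<in> N - f \<Longrightarrow> face_trace f p A a m = 0"
  shows "A = 0" and "\<And>i j. i \<in> N - f \<Longrightarrow> j \<in> N - f \<Longrightarrow> a i j = 0"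
proof -
  define c where "c = 1 / (2 * (real CARD('n) + 1))"
  have "c > 0" unfolding c_def by (simp add: add_pos_pos)
  have eq: "grad l \<bullet> (A *v grad m) + c * a m l = 0" if l: "l \<in> N - f" and m: "m \<in> N - f" for l m
  proof -
    have "0 = grad l \<bullet> face_trace f p A a m" using 0[OF m] by simp
    also have "\<dots> = grad l \<bullet> (A *v grad m) + c * a m l"
      unfolding face_trace_def c_def inner_add_right inner_scaleR_right grad_sum_edges[OF f p l] ..
    finally show ?thesis by simp
  qed
  show a0: "a i j = 0" if i: "i \<in> N - f" and j: "j \<in> N - f" for i j
  proof -
    have "c * a i j = c * a j i"
      using eq[OF i j] eq[OF j i] transpose_inner_swap[OF normal_tensorsD(1)[OF A], of "grad i" "grad j"]
      by linarith
    then show ?thesis using \<open>c > 0\<close> a[of i j] by simp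
  qed
  \<comment> \<open>With \<open>a\<close> gone, A kills the gradients off f, hence the normal space.
    Symmetry then leaves only the tangential block, which is zero for normal tensors.\<close>
  have Ag: "A *v grad m = 0" if m: "m \<in> N - f" for m
    using 0[OF m] a0[OF m] by (simp add: face_trace_def)
  have An: "A *v x = 0" if x: "x \<in> normal_space v f" for x
  proof -
    have "A *v x = A *v (\<Sum>m\<in>N - f. ((v m - v p) \<bullet> x) *\<^sub>R grad m)"
      using normal_repr[OF f p x] by simp
    also have "\<dots> = 0" unfolding mult_vec_sum_right mult_vec_scaleR_right by (simp add: Ag)
    finally show ?thesis .
  qed
  have "A *v y = 0" for y
  proof -
    obtain t u where tu: "t \<in> tangent_space v f" "u \<in> normal_space v f" "y = t + u"
      by (rule tangent_normal_decomp)
    have Ay: "A *v y = A *v t" by (simp add: tu(3) matrix_vector_right_distrib An[OF tu(2)])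
    have "z \<bullet> (A *v t) = 0" for z
    proof -
      obtain s w where sw: "s \<in> tangent_space v f" "w \<in> normal_space v f" "z = s + w"
        by (rule tangent_normal_decomp)
      have "w \<bullet> (A *v t) = t \<bullet> (A *v w)" by (rule transpose_inner_swap[OF normal_tensorsD(1)[OF A]])
      then have "w \<bullet> (A *v t) = 0" by (simp add: An[OF sw(2)])
      moreover have "s \<bullet> (A *v t) = 0" by (rule normal_tensorsD(2)[OF A sw(1) tu(1)])
      ultimately show ?thesis by (simp add: sw(3) inner_add_left)
    qed
    then show ?thesis unfolding Ay by (metis inner_eq_zero_iff)
  qed
  then show "A = 0" by (intro matrix_eqI) simp
qed

text \<open>Take the normal part of each edge v_i - v_p: removing the tangential part does not
  affect products with the normal vectors \<open>grad l\<close>.\<close>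

lemma normal_dual_basis:
  assumes f: "f \<subseteq> N" and p: "p \<in> f"
  obtains e where "\<And>i. e i \<in> normal_space v f"
    "\<And>i l. i \<in> N - f \<Longrightarrow> l \<in> N - f \<Longrightarrow> e i \<bullet> grad l = (if i = l then 1 else 0)"
proof -
  have "\<exists>u. u \<in> normal_space v f \<and> v i - v p - u \<in> tangent_space v f" for i
  proof -
    obtain t u where "t \<in> tangent_space v f" "u \<in> normal_space v f" "v i - v p = t + u"
      by (rule tangent_normal_decomp)
    then show ?thesis by (intro exI[of _ u]) simp
  qed
  then obtain e where e: "\<And>i. e i \<in> normal_space v f" "\<And>i. v i - v p - e i \<in> tangent_space v f"
    by metis
  have "e i \<bullet> grad l = (if i = l then 1 else 0)" if i: "i \<in> N - f" and l: "l \<in> N - f" for i l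
  proof -
    have "(v i - v p - e i) \<bullet> grad l = 0"
      using l by (intro normal_tangent[OF grad_normal[OF f] e(2)]) simp
    then have "e i \<bullet> grad l = grad l \<bullet> (v i - v p)"
      by (simp add: inner_diff_left inner_diff_right inner_commute)
    also have "\<dots> = (if i = l then 1 else 0)" using i l f p by (subst grad_edge) auto
    finally show ?thesis .
  qed
  with e(1) show ?thesis by (rule that)
qed

text \<open>Prescribed traces u define the matrix grad j . u_i. Its skew part is absorbed by
  \<open>a\<close>; the remaining vectors w have a symmetric matrix and are interpolated by a
  symmetric tensor.\<close>

lemma face_trace_surj:
  assumes f: "f \<subseteq> N" and p: "p \<in> f"
  obtains A a where "A \<in> normal_tensors v f" "\<And>i j. a i j = - a j i"
    "\<And>m. m \<in> N - f \<Longrightarrow> face_trace f p A a m = u m"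
proof -
  obtain e where e: "\<And>i. e i \<in> normal_space v f"
    "\<And>i l. i \<in> N - f \<Longrightarrow> l \<in> N - f \<Longrightarrow> e i \<bullet> grad l = (if i = l then 1 else 0)"
    using normal_dual_basis[OF f p] by metis
  define c where "c = 1 / (2 * (real CARD('n) + 1))"
  have "c > 0" unfolding c_def by (simp add: add_pos_pos)
  \<comment> \<open>The factor 1/2 extracts the skew part, and 1/c cancels the constant in
    \<open>face_trace\<close>.\<close>
  define a where "a i j = (1 / (2 * c)) * (grad j \<bullet> u i - grad i \<bullet> u j)" for i j
  define w where "w i = u i - c *\<^sub>R (\<Sum>j\<in>N - f. a i j *\<^sub>R (v j - v p))" for i
  have gw: "grad l \<bullet> w i = grad i \<bullet> w l" if i: "i \<in> N - f" and l: "l \<in> N - f" for i l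
  proof -
    have "grad l \<bullet> w i = grad l \<bullet> u i - c * a i l"
      unfolding w_def inner_diff_right inner_scaleR_right grad_sum_edges[OF f p l] ..
    moreover have "grad i \<bullet> w l = grad i \<bullet> u l - c * a l i"
      unfolding w_def inner_diff_right inner_scaleR_right grad_sum_edges[OF f p i] ..
    moreover have "c * a i l = (grad l \<bullet> u i - grad i \<bullet> u l) / 2"
      "c * a l i = (grad i \<bullet> u l - grad l \<bullet> u i) / 2"
      using \<open>c > 0\<close> by (simp_all add: a_def)
    ultimately show ?thesis by (simp add: field_simps)
  qed
  \<comment> \<open>The first sum sends \<open>grad m\<close> to w_m plus the unwanted sum of all
    (grad m . w_i) e_i; the second sum removes the latter, thanks to the symmetry
    \<open>gw\<close>.\<close>
  define A where "A = (\<Sum>i\<in>N - f. 2 *\<^sub>R symm (w i \<otimes>\<^sub>t e i))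
    - (\<Sum>i\<in>N - f. \<Sum>j\<in>N - f. (grad j \<bullet> w i) *\<^sub>R symm (e i \<otimes>\<^sub>t e j))"
  have "A \<in> normal_tensors v f"
    unfolding A_def
    by (intro subspace_diff subspace_sum subspace_scale subspace_normal_tensors normal_tensorsI e)
  moreover have "a i j = - a j i" for i j by (simp add: a_def algebra_simps)
  moreover have "face_trace f p A a m = u m" if m: "m \<in> N - f" for m
  proof -
    have delta: "(\<Sum>i\<in>N - f. (e i \<bullet> grad m) *\<^sub>R x i) = x m" for x :: "nat \<Rightarrow> real^'n"
    proof -
      have "(\<Sum>i\<in>N - f. (e i \<bullet> grad m) *\<^sub>R x i) = (\<Sum>i\<in>N - f. if i = m then x m else 0)"
        using e(2)[OF _ m] by (intro sum.cong refl) simp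
      then show ?thesis using m by simp
    qed
    have sw: "(\<Sum>i\<in>N - f. \<Sum>j\<in>N - f. (grad j \<bullet> w i) *\<^sub>R symm (e i \<otimes>\<^sub>t e j)) *v grad m
      = (\<Sum>i\<in>N - f. (grad m \<bullet> w i) *\<^sub>R e i)"
    proof -
      have "(\<Sum>i\<in>N - f. \<Sum>j\<in>N - f. (grad j \<bullet> w i) *\<^sub>R symm (e i \<otimes>\<^sub>t e j)) *v grad m
        = (\<Sum>i\<in>N - f. \<Sum>j\<in>N - f. (1/2) *\<^sub>R ((e j \<bullet> grad m) *\<^sub>R ((grad j \<bullet> w i) *\<^sub>R e i)))
        + (\<Sum>i\<in>N - f. \<Sum>j\<in>N - f. (1/2) *\<^sub>R ((e i \<bullet> grad m) *\<^sub>R ((grad j \<bullet> w i) *\<^sub>R e j)))"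
        unfolding mult_vec_sum mult_vec_scaleR symm_tensor_mult sum.distrib[symmetric]
        by (intro sum.cong refl) (simp add: scaleR_add_right mult_ac)
      also have "(\<Sum>i\<in>N - f. \<Sum>j\<in>N - f. (1/2) *\<^sub>R ((e j \<bullet> grad m) *\<^sub>R ((grad j \<bullet> w i) *\<^sub>R e i)))
        = (1/2) *\<^sub>R (\<Sum>i\<in>N - f. (grad m \<bullet> w i) *\<^sub>R e i)"
        unfolding scaleR_sum_right[symmetric] delta ..
      also have "(\<Sum>i\<in>N - f. \<Sum>j\<in>N - f. (1/2) *\<^sub>R ((e i \<bullet> grad m) *\<^sub>R ((grad j \<bullet> w i) *\<^sub>R e j)))
        = (1/2) *\<^sub>R (\<Sum>j\<in>N - f. (grad j \<bullet> w m) *\<^sub>R e j)"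
        by (subst sum.swap) (simp only: scaleR_sum_right[symmetric] delta)
      also have "(\<Sum>j\<in>N - f. (grad j \<bullet> w m) *\<^sub>R e j) = (\<Sum>i\<in>N - f. (grad m \<bullet> w i) *\<^sub>R e i)"
        using gw[OF m] by (intro sum.cong refl) simp
      finally show ?thesis by (simp add: scaleR_2[symmetric] flip: scaleR_add_left)
    qed
    have "A *v grad m = (\<Sum>i\<in>N - f. 2 *\<^sub>R symm (w i \<otimes>\<^sub>t e i)) *v grad m
       - (\<Sum>i\<in>N - f. (grad m \<bullet> w i) *\<^sub>R e i)"
      unfolding A_def matrix_vector_mult_diff_rdistrib sw ..
    also have "(\<Sum>i\<in>N - f. 2 *\<^sub>R symm (w i \<otimes>\<^sub>t e i)) *v grad m
      = (\<Sum>i\<in>N - f. (e i \<bullet> grad m) *\<^sub>R w i) + (\<Sum>i\<in>N - f. (grad m \<bullet> w i) *\<^sub>R e i)"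
      unfolding mult_vec_sum mult_vec_scaleR symm_tensor_mult sum.distrib[symmetric]
      by (intro sum.cong refl) (simp add: inner_commute)
    finally have "A *v grad m = w m" unfolding delta by simp
    then show ?thesis unfolding face_trace_def c_def[symmetric] by (simp add: w_def)
  qed
  ultimately show ?thesis by (rule that)
qed

section \<open>The basis of edge tensors\<close>

definition edge :: "nat \<Rightarrow> nat \<Rightarrow> real^'n" where "edge i j = v j - v i"

text \<open>The matrix b_ij = grad i . (A grad j) has vanishing row sums. When (v_j - v_i) \<otimes>
  (v_j - v_i) is expanded, the squares drop out and the mixed terms give -2 A; the factor -1/2
  compensates.\<close>

lemma edge_decomp:
  assumes A: "transpose A = A"
  shows "A = (\<Sum>i\<in>N. \<Sum>j\<in>N. (- (1/2) * (grad i \<bullet> (A *v grad j))) *\<^sub>R (edge i j \<otimes>\<^sub>t edge i j))"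
proof (rule matrix_eqI)
  fix x
  define b where "b i j = grad i \<bullet> (A *v grad j)" for i j
  have b_swap: "b i j = b j i" for i j unfolding b_def by (rule transpose_inner_swap[OF A])
  have b_sum: "(\<Sum>i\<in>N. b i j) = 0" for j
    unfolding b_def inner_sum_left[symmetric] grad_sum by simp
  have b_sum': "(\<Sum>j\<in>N. b i j) = 0" for i using b_sum[of i] by (simp add: b_swap[of i])
  define X where "X i = v i \<bullet> x" for i
  have Ax: "A *v x = (\<Sum>i\<in>N. \<Sum>j\<in>N. (b i j * X j) *\<^sub>R v i)"
  proof -
    have g: "grad i \<bullet> (A *v x) = (\<Sum>j\<in>N. b i j * X j)" for i
    proof -
      have "A *v x = A *v (\<Sum>j\<in>N. X j *\<^sub>R grad j)" unfolding X_def by (simp only: grad_dual)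
      then show ?thesis
        unfolding mult_vec_sum_right mult_vec_scaleR_right
        by (simp add: inner_sum_right b_def mult.commute)
    qed
    have "A *v x = (\<Sum>i\<in>N. (grad i \<bullet> (A *v x)) *\<^sub>R v i)" by (simp only: grad_repr)
    then show ?thesis unfolding g by (simp add: scaleR_sum_left)
  qed
  have Ax': "A *v x = (\<Sum>i\<in>N. \<Sum>j\<in>N. (b i j * X i) *\<^sub>R v j)"
    unfolding Ax by (subst sum.swap) (simp add: b_swap)
  have z1: "(\<Sum>i\<in>N. \<Sum>j\<in>N. (b i j * X j) *\<^sub>R v j) = 0"
    by (subst sum.swap) (simp add: b_sum flip: scaleR_sum_left sum_distrib_right)
  have z2: "(\<Sum>i\<in>N. \<Sum>j\<in>N. (b i j * X i) *\<^sub>R v i) = 0"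
    by (simp add: b_sum' flip: scaleR_sum_left sum_distrib_right)
  have "(\<Sum>i\<in>N. \<Sum>j\<in>N. (- (1/2) * b i j) *\<^sub>R (edge i j \<otimes>\<^sub>t edge i j)) *v x
    = (\<Sum>i\<in>N. \<Sum>j\<in>N. (1/2) *\<^sub>R ((b i j * X j) *\<^sub>R v i + (b i j * X i) *\<^sub>R v j
        - (b i j * X j) *\<^sub>R v j - (b i j * X i) *\<^sub>R v i))"
    unfolding mult_vec_sum mult_vec_scaleR tensor_mult
    by (intro sum.cong refl) (simp add: edge_def X_def inner_diff_left algebra_simps)
  also have "\<dots> = (1/2) *\<^sub>R (A *v x + A *v x)"
    unfolding scaleR_sum_right[symmetric] sum.distrib sum_subtractf Ax[symmetric] Ax'[symmetric] z1 z2 by simp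
  finally show "A *v x = (\<Sum>i\<in>N. \<Sum>j\<in>N. (- (1/2) * (grad i \<bullet> (A *v grad j))) *\<^sub>R (edge i j \<otimes>\<^sub>t edge i j)) *v x"
    unfolding b_def by simp
qed

text \<open>Polarisation: with u_i = v_i - v_p both u_i and u_j - u_i are edges, so the quadratic
  form determines all products of the spanning vectors u_i.\<close>

lemma edge_tensors_separate:
  assumes A: "transpose A = A" and 0: "\<And>i j. i \<in> N \<Longrightarrow> j \<in> N \<Longrightarrow> edge i j \<bullet> (A *v edge i j) = 0"
  shows "A = 0"
proof (rule matrix_eqI)
  fix x
  obtain p where p: "p \<in> N" by (rule obtain_other)
  define u where "u i = v i - v p" for i
  have uu: "u i \<bullet> (A *v u j) = 0" if i: "i \<in> N" and j: "j \<in> N" for i j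
  proof -
    have e: "edge i j = u j - u i" "edge p i = u i" "edge p j = u j" by (simp_all add: edge_def u_def)
    have "(u j - u i) \<bullet> (A *v (u j - u i)) = 0" using 0[OF i j] unfolding e .
    moreover have "u i \<bullet> (A *v u i) = 0" using 0[OF p i] unfolding e .
    moreover have "u j \<bullet> (A *v u j) = 0" using 0[OF p j] unfolding e .
    ultimately have "u j \<bullet> (A *v u i) + u i \<bullet> (A *v u j) = 0"
      by (simp add: matrix_vector_mult_diff_distrib inner_diff_left inner_diff_right)
    then show ?thesis using transpose_inner_swap[OF A, of "u i" "u j"] by simp
  qed
  have repr: "y = (\<Sum>i\<in>N. (grad i \<bullet> y) *\<^sub>R u i)" for y
  proof -
    have "(\<Sum>i\<in>N. (grad i \<bullet> y) *\<^sub>R u i) = y - (\<Sum>i\<in>N. grad i \<bullet> y) *\<^sub>R v p"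
      unfolding u_def scaleR_diff_right sum_subtractf grad_repr scaleR_sum_left ..
    also have "(\<Sum>i\<in>N. grad i \<bullet> y) = 0" unfolding inner_sum_left[symmetric] grad_sum by simp
    finally show ?thesis by simp
  qed
  have "y \<bullet> (A *v x) = 0" for y
  proof -
    have "y \<bullet> (A *v x) = (\<Sum>i\<in>N. (grad i \<bullet> y) *\<^sub>R u i) \<bullet> (A *v (\<Sum>j\<in>N. (grad j \<bullet> x) *\<^sub>R u j))"
      using repr[of x] repr[of y] by simp
    also have "\<dots> = 0"
      unfolding mult_vec_sum_right mult_vec_scaleR_right inner_sum_left inner_sum_right
      by (intro sum.neutral ballI) (simp add: uu)
    finally show ?thesis .
  qed
  then have "A *v x = 0" by (metis inner_eq_zero_iff)
  then show "A *v x = 0 *v x" by simp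
qed

end

section \<open>Integration over the cell\<close>

definition C1_fun :: "(real^'n \<Rightarrow> real) \<Rightarrow> (real^'n \<Rightarrow> real^'n) \<Rightarrow> bool"
  where "C1_fun h Dh \<longleftrightarrow> (\<forall>x. (h has_derivative (\<lambda>y. Dh x \<bullet> y)) (at x)) \<and> continuous_on UNIV Dh"

lemma C1_fun_continuous: "C1_fun h Dh \<Longrightarrow> continuous_on S h"
  unfolding C1_fun_def
  by (meson continuous_at_imp_continuous_on has_derivative_continuous)

lemma C1_fun_const: "C1_fun (\<lambda>x. c) (\<lambda>x. 0)"
  unfolding C1_fun_def
  by (auto intro!: has_derivative_eq_rhs[OF has_derivative_const] simp: fun_eq_iff)

lemma C1_fun_add: "C1_fun f Df \<Longrightarrow> C1_fun g Dg \<Longrightarrow> C1_fun (\<lambda>x. f x + g x) (\<lambda>x. Df x + Dg x)"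
  unfolding C1_fun_def
  by (auto intro!: has_derivative_eq_rhs[OF has_derivative_add] continuous_on_add
      simp: fun_eq_iff inner_add_left)

lemma C1_fun_mult:
  assumes f: "C1_fun f Df" and g: "C1_fun g Dg"
  shows "C1_fun (\<lambda>x. f x * g x) (\<lambda>x. f x *\<^sub>R Dg x + g x *\<^sub>R Df x)"
  unfolding C1_fun_def
proof (intro conjI allI)
  fix x
  have "((\<lambda>x. f x * g x) has_derivative (\<lambda>h. f x * (Dg x \<bullet> h) + (Df x \<bullet> h) * g x)) (at x)"
    using f g unfolding C1_fun_def by (intro has_derivative_mult) auto
  then show "((\<lambda>x. f x * g x) has_derivative (\<lambda>h. (f x *\<^sub>R Dg x + g x *\<^sub>R Df x) \<bullet> h)) (at x)"
    by (simp add: inner_add_left mult.commute)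
next
  show "continuous_on UNIV (\<lambda>x. f x *\<^sub>R Dg x + g x *\<^sub>R Df x)"
    using f g C1_fun_continuous[OF f] C1_fun_continuous[OF g] unfolding C1_fun_def
    by (intro continuous_on_add continuous_on_scaleR) auto
qed

lemma C1_fun_scale: "C1_fun f Df \<Longrightarrow> C1_fun (\<lambda>x. c * f x) (\<lambda>x. c *\<^sub>R Df x)"
  using C1_fun_mult[OF C1_fun_const[of c], of f Df] by simp

lemma C1_fun_diff: "C1_fun f Df \<Longrightarrow> C1_fun g Dg \<Longrightarrow> C1_fun (\<lambda>x. f x - g x) (\<lambda>x. Df x - Dg x)"
  using C1_fun_add[OF _ C1_fun_scale[of g Dg "-1"], of f Df] by simp

lemma C1_fun_exp:
  assumes f: "C1_fun f Df"
  shows "C1_fun (\<lambda>x. exp (f x)) (\<lambda>x. exp (f x) *\<^sub>R Df x)"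
  unfolding C1_fun_def
proof (intro conjI allI)
  fix x
  have "((\<lambda>x. exp (f x)) has_derivative (\<lambda>h. exp (f x) * (Df x \<bullet> h))) (at x)"
    using f unfolding C1_fun_def by (auto intro!: derivative_eq_intros)
  then show "((\<lambda>x. exp (f x)) has_derivative (\<lambda>h. (exp (f x) *\<^sub>R Df x) \<bullet> h)) (at x)" by simp
next
  show "continuous_on UNIV (\<lambda>x. exp (f x) *\<^sub>R Df x)"
    using f C1_fun_continuous[OF f] unfolding C1_fun_def
    by (intro continuous_on_scaleR continuous_on_exp) auto
qed

lemma C1_fun_coord: "C1_fun (\<lambda>x. x $ i) (\<lambda>x. axis i 1)"
  for i :: "'n::finite"
proof -
  have "((\<lambda>x. x $ i) has_derivative (\<lambda>y. axis i 1 \<bullet> y)) (at x)" for x :: "real^'n"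
    unfolding inner_axis' by (auto intro!: bounded_linear_imp_has_derivative bounded_linear_vec_nth)
  then show ?thesis by (simp add: C1_fun_def)
qed

lemma C1_fun_field_inner:
  assumes "C1_field phi Dphi"
  shows "C1_fun (\<lambda>x. t \<bullet> phi x) (\<lambda>x. t v* Dphi x)"
  unfolding C1_fun_def
proof (intro conjI allI)
  fix x
  have "((\<lambda>x. t \<bullet> phi x) has_derivative (\<lambda>h. t \<bullet> (Dphi x *v h))) (at x)"
    using assms unfolding C1_field_def by (intro has_derivative_inner_right) auto
  then show "((\<lambda>x. t \<bullet> phi x) has_derivative (\<lambda>h. (t v* Dphi x) \<bullet> h)) (at x)"
    by (simp add: dot_lmul_matrix)
next
  have "continuous_on UNIV Dphi" using assms unfolding C1_field_def by simp
  then show "continuous_on UNIV (\<lambda>x. t v* Dphi x)"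
    unfolding vector_matrix_mult_def by (intro continuous_intros)
qed

definition fun_C1 :: "(real^'n \<Rightarrow> real) set" where "fun_C1 = {f. \<exists>Df. C1_fun f Df}"

lemma polys_C1:
  fixes p :: "real^'n \<Rightarrow> real"
  assumes "p \<in> polys r"
  obtains Dp where "C1_fun p Dp"
proof -
  have sub: "subspace (fun_C1 :: (real^'n \<Rightarrow> real) set)"
    unfolding subspace_def fun_C1_def zero_fun_def plus_fun_def scaleR_fun_def real_scaleR_def
    using C1_fun_const C1_fun_add C1_fun_scale by blast
  have pow: "\<exists>Df. C1_fun (\<lambda>x. (x $ i) ^ n) Df" for i :: 'n and n
  proof (induct n)
    case 0
    show ?case using C1_fun_const by auto
  next
    case (Suc n)
    then show ?case using C1_fun_mult[OF C1_fun_coord] by auto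
  qed
  have prod: "\<exists>Df. C1_fun (\<lambda>x. \<Prod>i\<in>I. (x $ i) ^ a i) Df" if "finite I" for I :: "'n set" and a
    using that
  proof (induct I rule: finite_induct)
    case empty
    show ?case using C1_fun_const by auto
  next
    case (insert i I)
    then show ?case using pow[of i "a i"] C1_fun_mult by simp blast
  qed
  have "(polys r :: (real^'n \<Rightarrow> real) set) \<subseteq> fun_C1"
    unfolding polys_def
  proof (rule span_minimal[OF _ sub], rule subsetI)
    fix p :: "real^'n \<Rightarrow> real"
    assume "p \<in> {\<lambda>x. \<Prod>i\<in>UNIV. (x $ i) ^ a i | a :: 'n \<Rightarrow> nat. sum a UNIV \<le> r}"
    then obtain a :: "'n \<Rightarrow> nat" where "p = (\<lambda>x. \<Prod>i\<in>UNIV. (x $ i) ^ a i)" by blast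
    then show "p \<in> fun_C1" using prod[of UNIV a] by (simp add: fun_C1_def)
  qed
  then show ?thesis using assms that by (auto simp: fun_C1_def)
qed

lemma polys_continuous: "p \<in> polys r \<Longrightarrow> continuous_on S p"
  using polys_C1 C1_fun_continuous by metis

context simplex
begin

abbreviation MC :: "(real^'n) measure" where "MC \<equiv> lebesgue_on (cell v)"

lemma cell_lmeasurable: "cell v \<in> lmeasurable"
  by (rule lmeasurable_compact[OF compact_cell])

lemma cell_sets [simp]: "cell v \<in> sets lebesgue"
  using cell_lmeasurable by (rule fmeasurableD)

lemma cell_borel [simp]: "cell v \<in> sets borel"
  by (rule borel_closed[OF compact_imp_closed[OF compact_cell]])

lemma finite_measure_MC: "finite_measure MC"
  by (rule finite_measure_lebesgue_on[OF cell_lmeasurable])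

lemma AE_MC_iff: "(AE x in MC. P x) \<longleftrightarrow> (AE x in lebesgue. x \<in> cell v \<longrightarrow> P x)"
  by (rule AE_restrict_space_iff) simp

lemma AE_MC_icell: "AE x in MC. x \<in> icell"
proof -
  have "cell v - icell \<in> null_sets lebesgue"
    using negligible_cell_diff by (simp add: negligible_iff_null_sets)
  then have "AE x in lebesgue. x \<notin> cell v - icell" by (rule AE_not_in)
  then show ?thesis unfolding AE_MC_iff by (rule eventually_mono) simp
qed

text \<open>The part of \<open>U\<close> where f is nonzero is open and negligible, hence
  empty.\<close>

lemma open_AE_zero:
  fixes f :: "real^'n \<Rightarrow> 'b::real_normed_vector"
  assumes U: "open U" "U \<subseteq> cell v" and f: "continuous_on U f"
    and 0: "AE x in MC. x \<in> U \<longrightarrow> f x = 0" and x: "x \<in> U"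
  shows "f x = 0"
proof (rule ccontr)
  assume "f x \<noteq> 0"
  define Z where "Z = U \<inter> f -` (- {0})"
  have Z: "open Z" unfolding Z_def by (rule continuous_open_preimage[OF f U(1)]) auto
  have "AE x in lebesgue. x \<notin> Z"
    using 0 unfolding AE_MC_iff by (rule eventually_mono) (use U(2) in \<open>auto simp: Z_def\<close>)
  moreover have "Z \<in> sets lebesgue" using Z by (metis borel_open sets_completionI_sets sets_lborel)
  ultimately have "negligible Z" by (simp add: negligible_iff_null_sets AE_iff_null_sets)
  then have "Z = {}" using Z open_not_negligible by blast
  then show False using \<open>f x \<noteq> 0\<close> x by (auto simp: Z_def)
qed

text \<open>These functions are closed under sums and products, include the characteristic functions
  of subcells, and are integrable over cell and facets alike. Borel measurability on the whole space
  is asked for because facets are Lebesgue null sets.\<close>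

definition bm :: "(real^'n \<Rightarrow> 'b::euclidean_space) \<Rightarrow> bool"
  where "bm f \<longleftrightarrow> f \<in> borel_measurable borel \<and> bounded (f ` cell v)"

lemma bm_continuous: "continuous_on UNIV f \<Longrightarrow> bm f"
  unfolding bm_def
proof
  assume f: "continuous_on UNIV f"
  then show "f \<in> borel_measurable borel" by (rule borel_measurable_continuous_onI)
  have "continuous_on (cell v) f" using f by (rule continuous_on_subset) simp
  then show "bounded (f ` cell v)" by (intro compact_imp_bounded compact_continuous_image compact_cell)
qed

lemma bm_if: "bm f \<Longrightarrow> S \<in> sets borel \<Longrightarrow> bm (\<lambda>x. if x \<in> S then f x else 0)"
  unfolding bm_def
proof
  assume f: "f \<in> borel_measurable borel \<and> bounded (f ` cell v)" and S: "S \<in> sets borel"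
  then show "(\<lambda>x. if x \<in> S then f x else 0) \<in> borel_measurable borel"
    by (intro measurable_If_set) auto
  have "(\<lambda>x. if x \<in> S then f x else 0) ` cell v \<subseteq> insert 0 (f ` cell v)" by auto
  then show "bounded ((\<lambda>x. if x \<in> S then f x else 0) ` cell v)"
    using f bounded_subset by (metis bounded_insert)
qed

lemma bm_add: "bm f \<Longrightarrow> bm g \<Longrightarrow> bm (\<lambda>x. f x + g x)"
  unfolding bm_def by (simp add: bounded_plus_comp borel_measurable_add)

lemma bm_const: "bm (\<lambda>x. c)"
  by (intro bm_continuous continuous_on_const)

lemma bm_sum: "(\<And>i. i \<in> I \<Longrightarrow> bm (f i)) \<Longrightarrow> bm (\<lambda>x. \<Sum>i\<in>I. f i x)"
proof (induct I rule: infinite_finite_induct)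
  case (insert i I)
  then have "bm (\<lambda>x. f i x + (\<Sum>i\<in>I. f i x))" by (intro bm_add) auto
  then show ?case using insert by simp
qed (simp_all add: bm_const)

lemma bm_bilinear:
  fixes h :: "'a::euclidean_space \<Rightarrow> 'b::euclidean_space \<Rightarrow> 'c::euclidean_space"
  assumes h: "bounded_bilinear h" and f: "bm f" and g: "bm g"
  shows "bm (\<lambda>x. h (f x) (g x))"
proof -
  interpret bounded_bilinear h by fact
  have h_cont: "continuous_on UNIV (\<lambda>z. h (fst z) (snd z))"
    by (rule continuous_on[OF continuous_on_fst[OF continuous_on_id] continuous_on_snd[OF continuous_on_id]])
  have fm: "f \<in> borel_measurable borel" and gm: "g \<in> borel_measurable borel"
    using f g by (simp_all only: bm_def)
  have "(\<lambda>x. h (f x) (g x)) \<in> borel_measurable borel"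
    by (rule borel_measurable_continuous_Pair[OF fm gm h_cont])
  moreover
  obtain A where A: "\<And>x. x \<in> cell v \<Longrightarrow> norm (f x) \<le> A"
    using f unfolding bm_def bounded_iff by blast
  obtain B where B: "\<And>x. x \<in> cell v \<Longrightarrow> norm (g x) \<le> B"
    using g unfolding bm_def bounded_iff by blast
  obtain K where K: "0 < K" "\<And>a b. norm (h a b) \<le> norm a * norm b * K"
    using pos_bounded by blast
  have "norm (h (f x) (g x)) \<le> A * B * K" if x: "x \<in> cell v" for x
  proof -
    have "0 \<le> A" using A[OF x] norm_ge_zero order_trans by blast
    then have "norm (f x) * norm (g x) \<le> A * B"
      using A[OF x] B[OF x] by (intro mult_mono) auto
    then have "norm (f x) * norm (g x) * K \<le> A * B * K"
      using K(1) by (intro mult_right_mono) auto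
    then show ?thesis using K(2)[of "f x" "g x"] by linarith
  qed
  then have "bounded ((\<lambda>x. h (f x) (g x)) ` cell v)"
    unfolding bounded_iff by blast
  ultimately show ?thesis unfolding bm_def by blast
qed

lemmas bm_mult = bm_bilinear[OF bounded_bilinear_mult]
  and bm_scaleR = bm_bilinear[OF bounded_bilinear_scaleR]
  and bm_inner = bm_bilinear[OF bounded_bilinear_inner]

lemma bm_linear:
  fixes h :: "'a::euclidean_space \<Rightarrow> 'b::euclidean_space"
  assumes "linear h" and f: "bm f"
  shows "bm (\<lambda>x. h (f x))"
proof -
  interpret bounded_linear h using assms(1) by (simp add: linear_conv_bounded_linear)
  have "(\<lambda>x. h (f x)) \<in> borel_measurable borel"
    using f borel_measurable_continuous_onI[OF continuous_on[OF continuous_on_id]]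
    unfolding bm_def by (intro measurable_compose[of f borel borel h]) auto
  moreover have "bounded (h ` (f ` cell v))"
    using f unfolding bm_def by (intro bounded_linear_image[OF _ bounded_linear_axioms]) auto
  ultimately show ?thesis unfolding bm_def image_image by blast
qed

lemma bm_mult_vec: "bm f \<Longrightarrow> bm (\<lambda>x. f x *v y)" for f :: "real^'n \<Rightarrow> real^'n^'n"
  by (rule bm_linear[of "\<lambda>A. A *v y"]) (auto intro!: linearI simp: mult_vec_add mult_vec_scaleR)

lemma borel_imp_MC:
  "f \<in> borel_measurable borel \<Longrightarrow> f \<in> borel_measurable MC"
  by (intro measurable_restrict_space1 measurable_completion) simp

lemma bm_integrable: "bm f \<Longrightarrow> integrable MC f"
proof -
  assume f: "bm f"
  then obtain B where "\<And>x. x \<in> cell v \<Longrightarrow> norm (f x) \<le> B"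
    unfolding bm_def bounded_iff by blast
  then show ?thesis
    using f unfolding bm_def
    by (intro finite_measure.integrable_const_bound[OF finite_measure_MC, of _ B] borel_imp_MC)
      (auto intro!: AE_I2 simp: space_restrict_space)
qed

lemma integral_zero_imp_zero:
  fixes f :: "real^'n \<Rightarrow> real"
  assumes f: "continuous_on UNIV f" and ge: "\<And>x. x \<in> cell v \<Longrightarrow> 0 \<le> f x"
    and 0: "integral\<^sup>L MC f = 0" and x: "x \<in> icell"
  shows "f x = 0"
proof -
  have "AE x in MC. 0 \<le> f x" using ge by (intro AE_I2) (simp add: space_restrict_space)
  then have "AE x in MC. f x = 0"
    using 0 bm_integrable[OF bm_continuous[OF f]] by (simp add: integral_nonneg_eq_0_iff_AE)
  then have "AE x in MC. x \<in> icell \<longrightarrow> f x = 0" by (rule eventually_mono) simp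
  then show ?thesis
    using open_AE_zero[OF open_icell icell_subset _ _ x, of f] f continuous_on_subset by blast
qed

text \<open>The segment from a point of the open facet to the centre runs through the open subcell
  m, so facet values are limits from there.\<close>

lemma rface_limit:
  fixes f :: "real^'n \<Rightarrow> 'b::real_normed_vector"
  assumes f: "continuous_on UNIV f" and m: "m \<in> N" and x: "x \<in> rface m"
    and 0: "\<And>y. y \<in> isubcell m \<Longrightarrow> f y = 0"
  shows "f x = 0"
proof -
  \<comment> \<open>The double successor keeps the step below 1: the centre itself lies in no open
    subcell.\<close>
  define y where "y = (\<lambda>n. x + inverse (real (Suc (Suc n))) *\<^sub>R (ctr - x))"
  have "(\<lambda>n. x + inverse (real (Suc (Suc n))) *\<^sub>R (ctr - x)) \<longlonglongrightarrow> x + 0 *\<^sub>R (ctr - x)"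
    by (intro tendsto_intros LIMSEQ_Suc[OF LIMSEQ_inverse_real_of_nat])
  then have y: "y \<longlonglongrightarrow> x" by (simp only: y_def scaleR_zero_left add_0_right)
  have bary: "bary v i (y n) = bary v i x + inverse (real (Suc (Suc n))) * (1 / (real CARD('n) + 1) - bary v i x)"
    if "i \<in> N" for i n
  proof -
    have "bary v i (y n) = bary v i x + grad i \<bullet> (y n - x)" by (simp add: grad_diff)
    also have "grad i \<bullet> (y n - x) = inverse (real (Suc (Suc n))) * (grad i \<bullet> (ctr - x))" by (simp add: y_def)
    finally show ?thesis using that by (simp only: grad_diff bary_center)
  qed
  have "y n \<in> isubcell m" for n
  proof -
    define s where "s = inverse (real (Suc (Suc n)))"
    have s: "0 < s" "s < 1" unfolding s_def by (simp_all add: inverse_less_1_iff)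
    define c where "c = 1 / (real CARD('n) + 1)"
    have c: "0 < c" unfolding c_def by (simp add: add_pos_pos)
    have b: "bary v i (y n) = (1 - s) * bary v i x + s * c" if "i \<in> N" for i
      unfolding bary[OF that] s_def[symmetric] c_def[symmetric] by (simp add: algebra_simps)
    have "0 < bary v i (y n) \<and> (i \<noteq> m \<longrightarrow> bary v m (y n) < bary v i (y n))" if i: "i \<in> N" for i
    proof (cases "i = m")
      case True
      then show ?thesis using x b[OF m] s c by (simp add: rface_def)
    next
      case False
      then have pos: "0 < bary v i x" and z: "bary v m x = 0" using x i by (simp_all add: rface_def)
      have "0 < (1 - s) * bary v i x" using s pos by simp
      moreover have "0 < s * c" using s c by simp
      ultimately show ?thesis unfolding b[OF i] b[OF m] z by simp
    qed
    then show ?thesis unfolding isubcell_def by blast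
  qed
  then have "f (y n) = 0" for n by (rule 0)
  moreover have "(\<lambda>n. f (y n)) \<longlonglongrightarrow> f x"
    using f y by (intro continuous_on_tendsto_compose[of UNIV f y x]) auto
  ultimately show ?thesis by (simp add: LIMSEQ_const_iff)
qed

end

section \<open>Green's formula along edges\<close>

context simplex
begin

text \<open>Along t_ij only \<lambda>_i and \<lambda>_j change, at rates -1 and 1. A line in this
  direction can cross the boundary only through the facets i and j.\<close>

lemma bary_edge: "i \<in> N \<Longrightarrow> j \<in> N \<Longrightarrow>
    bary v l (x + s *\<^sub>R edge i j) = bary v l x + s * ((if l = j then 1 else 0) - (if l = i then 1 else 0))"
proof -
  assume "i \<in> N" "j \<in> N"
  then have "grad l \<bullet> edge i j = (if l = j then 1 else 0) - (if l = i then 1 else 0)"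
    unfolding edge_def by (intro grad_edge)
  moreover have "grad l \<bullet> (x + s *\<^sub>R edge i j - x) = bary v l (x + s *\<^sub>R edge i j) - bary v l x"
    by (rule grad_diff)
  ultimately show ?thesis by simp
qed

lemma C1_line:
  assumes h: "C1_fun h Dh"
  shows "((\<lambda>s. h (y + s *\<^sub>R t)) has_real_derivative (Dh (y + s *\<^sub>R t) \<bullet> t)) (at s)"
proof -
  have 1: "((\<lambda>s. y + s *\<^sub>R t) has_derivative (\<lambda>u. u *\<^sub>R t)) (at s)"
    by (auto intro!: derivative_eq_intros)
  have 2: "(h has_derivative (\<lambda>k. Dh (y + s *\<^sub>R t) \<bullet> k)) (at (y + s *\<^sub>R t))"
    using h unfolding C1_fun_def by blast
  show ?thesis
    unfolding has_field_derivative_def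
    by (rule has_derivative_eq_rhs[OF has_derivative_compose[OF 1 2]]) (simp add: fun_eq_iff mult.commute)
qed

lemma edge_lipschitz:
  assumes ij: "i \<in> N" "j \<in> N" and h: "C1_fun h Dh"
    and K: "\<And>x. x \<in> cell v \<Longrightarrow> \<bar>Dh x \<bullet> edge i j\<bar> \<le> K"
    and y: "y \<in> cell v" "y + s *\<^sub>R edge i j \<in> cell v" and s: "0 \<le> s"
  shows "\<bar>h (y + s *\<^sub>R edge i j) - h y\<bar> \<le> K * s"
proof (cases "s = 0")
  case False
  then have s: "0 < s" using s by simp
  obtain z where z: "0 < z" "z < s"
    "h (y + s *\<^sub>R edge i j) - h (y + 0 *\<^sub>R edge i j) = (s - 0) * (Dh (y + z *\<^sub>R edge i j) \<bullet> edge i j)"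
    using MVT2[OF s C1_line[OF h, of y "edge i j"]] by blast
  have "y + z *\<^sub>R edge i j \<in> cell v"
    unfolding cell_iff
  proof
    fix l assume l: "l \<in> N"
    have "0 \<le> bary v l y" "0 \<le> bary v l (y + s *\<^sub>R edge i j)"
      using y l unfolding cell_iff by blast+
    then show "0 \<le> bary v l (y + z *\<^sub>R edge i j)"
      using z(1,2) unfolding bary_edge[OF ij] by (simp split: if_splits)
  qed
  then have "\<bar>Dh (y + z *\<^sub>R edge i j) \<bullet> edge i j\<bar> * s \<le> K * s"
    using K s by (intro mult_right_mono) auto
  then show ?thesis using z(3) s by (simp add: abs_mult mult.commute)
qed simp

text \<open>A line parallel to t_ij enters the cell through facet j and leaves it through facet i,
  and h vanishes on both. If only one end of the step is inside, the bound comes from the portion of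
  the step within the cell.\<close>

lemma edge_difference_bound:
  assumes ij: "i \<in> N" "j \<in> N" "i \<noteq> j" and h: "C1_fun h Dh"
    and van: "\<And>x. x \<in> cell v \<Longrightarrow> bary v i x = 0 \<or> bary v j x = 0 \<Longrightarrow> h x = 0"
    and K: "\<And>x. x \<in> cell v \<Longrightarrow> \<bar>Dh x \<bullet> edge i j\<bar> \<le> K" "0 \<le> K" and s: "0 < s"
  shows "\<bar>indicator (cell v) (x + s *\<^sub>R edge i j) * h (x + s *\<^sub>R edge i j)
    - indicator (cell v) x * h x\<bar> \<le> K * s"
proof -
  let ?y = "x + s *\<^sub>R edge i j"
  note be = bary_edge[OF ij(1,2)]
  consider "x \<in> cell v" "?y \<in> cell v" | "x \<in> cell v" "?y \<notin> cell v"
    | "x \<notin> cell v" "?y \<in> cell v" | "x \<notin> cell v" "?y \<notin> cell v" by blast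
  then show ?thesis
  proof cases
    case 1
    then show ?thesis using edge_lipschitz[OF ij(1,2) h K(1), of x s] s by simp
  next
    case 2
    \<comment> \<open>The parameter at which \<lambda>_i reaches 0, that is, at which the line
      leaves the cell.\<close>
    define z where "z = bary v i x"
    obtain l where l: "l \<in> N" "bary v l ?y < 0" using 2(2) unfolding cell_iff by (meson not_le)
    have "0 \<le> bary v l x" using 2(1) l(1) unfolding cell_iff by blast
    then have "l = i" using l s unfolding be by (simp split: if_splits)
    then have zs: "z < s" using l ij(3) unfolding be z_def by simp
    have z0: "0 \<le> z" using 2(1) ij(1) unfolding cell_iff z_def by blast
    have zc: "x + z *\<^sub>R edge i j \<in> cell v"
      unfolding cell_iff
    proof
      fix l assume "l \<in> N"
      then have "0 \<le> bary v l x" using 2(1) unfolding cell_iff by blast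
      then show "0 \<le> bary v l (x + z *\<^sub>R edge i j)"
        using z0 ij(3) unfolding be by (simp add: z_def split: if_splits)
    qed
    have "bary v i (x + z *\<^sub>R edge i j) = 0" unfolding be using ij(3) by (simp add: z_def)
    then have "h (x + z *\<^sub>R edge i j) = 0" using van[OF zc] by blast
    then have "\<bar>h x\<bar> \<le> K * z"
      using edge_lipschitz[OF ij(1,2) h K(1) 2(1) zc z0] by simp
    also have "\<dots> \<le> K * s" using zs K(2) by (intro mult_left_mono) auto
    finally show ?thesis using 2 by simp
  next
    case 3
    \<comment> \<open>The way back from the end point to facet j, where \<lambda>_j = 0.\<close>
    define z where "z = bary v j ?y"
    obtain l where l: "l \<in> N" "bary v l x < 0" using 3(1) unfolding cell_iff by (meson not_le)
    have "0 \<le> bary v l ?y" using 3(2) l(1) unfolding cell_iff by blast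
    then have "l = j" using l s unfolding be by (simp split: if_splits)
    then have zs: "z < s" using l ij(3) unfolding z_def be by simp
    have z0: "0 \<le> z" using 3(2) ij(2) unfolding cell_iff z_def by blast
    have yz: "?y = (x + (s - z) *\<^sub>R edge i j) + z *\<^sub>R edge i j"
      by (simp add: algebra_simps)
    have zc: "x + (s - z) *\<^sub>R edge i j \<in> cell v"
      unfolding cell_iff
    proof
      fix l assume "l \<in> N"
      then have "0 \<le> bary v l ?y" using 3(2) unfolding cell_iff by blast
      then show "0 \<le> bary v l (x + (s - z) *\<^sub>R edge i j)"
        using z0 ij(3) z_def unfolding be by (simp split: if_splits)
    qed
    have "bary v j (x + (s - z) *\<^sub>R edge i j) = 0"
      using ij(3) z_def unfolding be by simp
    then have "h (x + (s - z) *\<^sub>R edge i j) = 0" using van[OF zc] by blast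
    then have "\<bar>h ?y\<bar> \<le> K * z"
      using edge_lipschitz[OF ij(1,2) h K(1) zc _ z0] 3(2) unfolding yz[symmetric] by simp
    also have "\<dots> \<le> K * s" using zs K(2) by (intro mult_left_mono) auto
    finally show ?thesis using 3 by simp
  next
    case 4
    then show ?thesis using K(2) s by simp
  qed
qed

text \<open>Translations are carried out in \<open>lborel\<close>, whereas the degrees of freedom
  integrate over \<open>lebesgue_on\<close>; extension by zero links the two.\<close>

lemma lborel_cell_integral:
  fixes f :: "real^'n \<Rightarrow> real"
  assumes f: "continuous_on UNIV f"
  shows "integrable lborel (\<lambda>x. indicator (cell v) x * f x)"
    and "integral\<^sup>L lborel (\<lambda>x. indicator (cell v) x * f x) = integral\<^sup>L MC f"
    and "(\<lambda>x. indicator (cell v) x * f x) \<in> borel_measurable borel"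
proof -
  have "f \<in> borel_measurable borel" using f by (rule borel_measurable_continuous_onI)
  then show m: "(\<lambda>x. indicator (cell v) x * f x) \<in> borel_measurable borel"
    by (intro borel_measurable_times borel_measurable_indicator) simp_all
  have "integrable MC f" by (rule bm_integrable[OF bm_continuous[OF f]])
  then have "integrable lebesgue (\<lambda>x. indicator (cell v) x * f x)"
    by (subst (asm) integrable_restrict_space) simp_all
  then show "integrable lborel (\<lambda>x. indicator (cell v) x * f x)"
    using m by (subst (asm) integrable_completion) simp_all
  have "integral\<^sup>L MC f = integral\<^sup>L lebesgue (\<lambda>x. indicator (cell v) x * f x)"
    by (subst integral_restrict_space) simp_all
  also have "\<dots> = integral\<^sup>L lborel (\<lambda>x. indicator (cell v) x * f x)"
    using m by (subst integral_completion) simp_all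
  finally show "integral\<^sup>L lborel (\<lambda>x. indicator (cell v) x * f x) = integral\<^sup>L MC f" ..
qed

lemma AE_lborel_icell: "AE x in lborel. x \<in> cell v \<longrightarrow> x \<in> icell"
  using AE_MC_icell unfolding AE_MC_iff AE_completion_iff .

text \<open>The difference quotients of the extension of \<open>h\<close> by zero in the direction of the edge
  have vanishing integral by translation invariance and are bounded, because every line
  parallel to the edge leaves the cell through one of the facets on which \<open>h\<close> vanishes.\<close>

lemma edge_integral_zero:
  assumes ij: "i \<in> N" "j \<in> N" "i \<noteq> j" and h: "C1_fun h Dh"
    and van: "\<And>x. x \<in> cell v \<Longrightarrow> bary v i x = 0 \<or> bary v j x = 0 \<Longrightarrow> h x = 0"
  shows "(LINT x|MC. Dh x \<bullet> edge i j) = 0"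
proof -
  let ?t = "edge i j"
  define h0 where "h0 = (\<lambda>x. indicator (cell v) x * h x)"
  define s where "s = (\<lambda>n. inverse (real (Suc n)))"
  define F where "F = (\<lambda>x. indicator (cell v) x * (Dh x \<bullet> ?t))"
  define f where "f = (\<lambda>n x. (h0 (s n *\<^sub>R ?t + x) - h0 x) / s n)"
  have s: "0 < s n" "s n \<le> 1" for n by (simp_all add: s_def inverse_le_1_iff)
  have hc: "continuous_on UNIV h" by (rule C1_fun_continuous[OF h])
  have Dc: "continuous_on UNIV (\<lambda>x. Dh x \<bullet> ?t)"
    using h unfolding C1_fun_def by (intro continuous_on_inner continuous_on_const) auto
  obtain K where K: "0 < K" "\<And>x. x \<in> cell v \<Longrightarrow> \<bar>Dh x \<bullet> ?t\<bar> \<le> K"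
    using bm_continuous[OF Dc] unfolding bm_def bounded_pos by auto
  obtain B where B: "\<And>x. x \<in> cell v \<Longrightarrow> norm x \<le> B"
    using compact_imp_bounded[OF compact_cell] unfolding bounded_iff by blast
  \<comment> \<open>Outside the ball of radius R neither x nor x + s t lies in the cell, because s
    is at most 1; the dominating function can thus have bounded support.\<close>
  define R where "R = B + norm ?t"
  note h0_int = lborel_cell_integral[OF hc, folded h0_def]
  note F_int = lborel_cell_integral[OF Dc, folded F_def]
  have shift_m: "(\<lambda>x. h0 (c + x)) \<in> borel_measurable borel" for c
    by (rule measurable_compose[OF _ h0_int(3)]) simp
  have shift: "integrable lborel (\<lambda>x. h0 (c + x))"
    "integral\<^sup>L lborel (\<lambda>x. h0 (c + x)) = integral\<^sup>L lborel h0" for c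
  proof -
    have "integrable (distr lborel borel ((+) c)) h0" unfolding lborel_distr_plus by (rule h0_int(1))
    then show "integrable lborel (\<lambda>x. h0 (c + x))"
      using h0_int(3) by (subst (asm) integrable_distr_eq) simp_all
    have "integral\<^sup>L (distr lborel borel ((+) c)) h0 = integral\<^sup>L lborel (\<lambda>x. h0 (c + x))"
      using h0_int(3) by (subst integral_distr) simp_all
    then show "integral\<^sup>L lborel (\<lambda>x. h0 (c + x)) = integral\<^sup>L lborel h0"
      unfolding lborel_distr_plus by simp
  qed
  have f0: "integral\<^sup>L lborel (f n) = 0" for n
    unfolding f_def using shift h0_int(1) by simp
  have "(\<lambda>n. integral\<^sup>L lborel (f n)) \<longlonglongrightarrow> integral\<^sup>L lborel F"
  proof (rule integral_dominated_convergence)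
    show "F \<in> borel_measurable lborel" using F_int(3) by simp
    show "f n \<in> borel_measurable lborel" for n
      unfolding f_def using shift_m h0_int(3)
      by (intro borel_measurable_divide borel_measurable_diff) simp_all
    show "integrable lborel (\<lambda>x. K * indicator (cball 0 R) x)"
      by (intro integrable_mult_right integrable_real_indicator emeasure_bounded_finite) simp_all
    show "AE x in lborel. norm (f n x) \<le> K * indicator (cball 0 R) x" for n
    proof (rule AE_I2)
      fix x
      have eq: "s n *\<^sub>R ?t + x = x + s n *\<^sub>R ?t" by simp
      show "norm (f n x) \<le> K * indicator (cball 0 R) x"
      proof (cases "x \<in> cball 0 R")
        case True
        have "\<bar>h0 (x + s n *\<^sub>R ?t) - h0 x\<bar> \<le> K * s n"
          unfolding h0_def using K(1) by (intro edge_difference_bound[OF ij h van K(2)] s) auto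
        then show ?thesis
          unfolding f_def eq using True s(1)[of n] by (simp add: divide_le_eq abs_mult)
      next
        case False
        have nx: "R < norm x" using False by simp
        have "x \<notin> cell v" using B[of x] nx unfolding R_def using norm_ge_zero[of ?t] by fastforce
        moreover have "x + s n *\<^sub>R ?t \<notin> cell v"
        proof
          assume "x + s n *\<^sub>R ?t \<in> cell v"
          then have "norm (x + s n *\<^sub>R ?t) \<le> B" by (rule B)
          moreover have "norm x \<le> norm (x + s n *\<^sub>R ?t) + norm (s n *\<^sub>R ?t)"
            using norm_triangle_ineq4[of "x + s n *\<^sub>R ?t" "s n *\<^sub>R ?t"] by simp
          moreover have "norm (s n *\<^sub>R ?t) \<le> norm ?t"
            using s[of n] mult_left_le_one_le[of "norm ?t" "s n"] by simp
          ultimately show False using nx by (simp add: R_def)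
        qed
        ultimately show ?thesis using K(1) unfolding f_def eq h0_def by simp
      qed
    qed
    \<comment> \<open>Convergence may fail on the boundary of the cell, a null set. Inside, the
      quotient is eventually that of h; outside, it is eventually 0.\<close>
    show "AE x in lborel. (\<lambda>n. f n x) \<longlonglongrightarrow> F x"
      using AE_lborel_icell
    proof (rule eventually_mono)
      fix x assume x: "x \<in> cell v \<longrightarrow> x \<in> icell"
      have s_lim: "s \<longlonglongrightarrow> 0" unfolding s_def by (rule LIMSEQ_inverse_real_of_nat)
      have "(\<lambda>n. x + s n *\<^sub>R ?t) \<longlonglongrightarrow> x + 0 *\<^sub>R ?t"
        by (intro tendsto_intros s_lim)
      then have lim: "(\<lambda>n. x + s n *\<^sub>R ?t) \<longlonglongrightarrow> x" by simp
      show "(\<lambda>n. f n x) \<longlonglongrightarrow> F x"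
      proof (cases "x \<in> cell v")
        case True
        then have "x \<in> icell" using x by blast
        then have ev: "\<forall>\<^sub>F n in sequentially. x + s n *\<^sub>R ?t \<in> icell"
          by (rule topological_tendstoD[OF lim open_icell])
        have "((\<lambda>k. (h (x + k *\<^sub>R ?t) - h x) / k) \<longlongrightarrow> Dh x \<bullet> ?t) (at 0)"
          using C1_line[OF h, of x ?t 0] unfolding DERIV_def by simp
        moreover have "filterlim s (at 0) sequentially"
          using s_lim s(1) by (auto simp: filterlim_at intro!: always_eventually) (metis less_irrefl)
        ultimately have "(\<lambda>n. (h (x + s n *\<^sub>R ?t) - h x) / s n) \<longlonglongrightarrow> Dh x \<bullet> ?t"
          by (rule filterlim_compose)
        moreover have "\<forall>\<^sub>F n in sequentially. (h (x + s n *\<^sub>R ?t) - h x) / s n = f n x"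
          using ev
        proof (rule eventually_mono)
          fix n assume "x + s n *\<^sub>R ?t \<in> icell"
          then have "x + s n *\<^sub>R ?t \<in> cell v" using icell_subset by blast
          then show "(h (x + s n *\<^sub>R ?t) - h x) / s n = f n x"
            using True by (simp add: f_def h0_def add.commute)
        qed
        ultimately have "(\<lambda>n. f n x) \<longlonglongrightarrow> Dh x \<bullet> ?t" by (rule Lim_transform_eventually)
        then show ?thesis using True by (simp add: F_def)
      next
        case False
        have op: "open (- cell v)" using compact_imp_closed[OF compact_cell] by (simp add: open_Compl)
        have "\<forall>\<^sub>F n in sequentially. x + s n *\<^sub>R ?t \<in> - cell v"
          using False by (intro topological_tendstoD[OF lim op]) simp
        then have "\<forall>\<^sub>F n in sequentially. f n x = F x"
          by (rule eventually_mono) (use False in \<open>simp add: f_def h0_def F_def add.commute\<close>)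
        then show ?thesis by (rule tendsto_eventually)
      qed
    qed
  qed
  then have "(\<lambda>n::nat. 0::real) \<longlonglongrightarrow> integral\<^sup>L lborel F" unfolding f0 .
  then have "integral\<^sup>L lborel F = 0" by (simp add: LIMSEQ_const_iff)
  then show ?thesis unfolding F_int(2) .
qed

section \<open>Normal traces of fields in \<open>H\<^sub>0(div)\<close>\<close>

text \<open>Functions homogeneous of degree R about the vertex v_m, as characterised by Euler's
  identity.\<close>

definition euler :: "nat \<Rightarrow> real \<Rightarrow> (real^'n \<Rightarrow> real) set"
  where "euler m R = {q. \<exists>Dq. C1_fun q Dq \<and> (\<forall>x. Dq x \<bullet> (x - v m) = R * q x)}"

lemma C1_fun_bary: "C1_fun (bary v i) (\<lambda>x. grad i)"
  unfolding C1_fun_def using has_derivative_bary by simp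

lemma subspace_euler: "subspace (euler m R)"
  unfolding subspace_def euler_def zero_fun_def plus_fun_def scaleR_fun_def real_scaleR_def
proof (intro conjI ballI allI; clarsimp)
  show "\<exists>Dq. C1_fun (\<lambda>x. 0) Dq \<and> (\<forall>x. Dq x \<bullet> (x - v m) = 0)"
    using C1_fun_const by force
next
  fix f Df g Dg
  assume "C1_fun f Df" "\<forall>x. Df x \<bullet> (x - v m) = R * f x" "C1_fun g Dg" "\<forall>x. Dg x \<bullet> (x - v m) = R * g x"
  then show "\<exists>Dq. C1_fun (\<lambda>x. f x + g x) Dq \<and> (\<forall>x. Dq x \<bullet> (x - v m) = R * (f x + g x))"
    by (intro exI[of _ "\<lambda>x. Df x + Dg x"]) (simp add: C1_fun_add inner_add_left distrib_left)
next
  fix c f Df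
  assume "C1_fun f Df" "\<forall>x. Df x \<bullet> (x - v m) = R * f x"
  then show "\<exists>Dq. C1_fun (\<lambda>x. c * f x) Dq \<and> (\<forall>x. Dq x \<bullet> (x - v m) = R * (c * f x))"
    by (intro exI[of _ "\<lambda>x. c *\<^sub>R Df x"]) (simp add: C1_fun_scale)
qed

lemma euler_mult:
  assumes "f \<in> euler m R" "g \<in> euler m S"
  shows "(\<lambda>x. f x * g x) \<in> euler m (R + S)"
proof -
  obtain Df Dg where "C1_fun f Df" "\<forall>x. Df x \<bullet> (x - v m) = R * f x"
    "C1_fun g Dg" "\<forall>x. Dg x \<bullet> (x - v m) = S * g x"
    using assms unfolding euler_def by blast
  then show ?thesis
    unfolding euler_def
    by (intro CollectI exI[of _ "\<lambda>x. f x *\<^sub>R Dg x + g x *\<^sub>R Df x"])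
      (simp add: C1_fun_mult inner_add_left algebra_simps)
qed

lemma euler_one: "(\<lambda>x. 1) \<in> euler m 0"
  unfolding euler_def using C1_fun_const by force

text \<open>For i different from m, \<lambda>_i is affine and vanishes at v_m, hence is homogeneous
  of degree 1 about it.\<close>

lemma euler_bary: "m \<in> N \<Longrightarrow> i \<noteq> m \<Longrightarrow> bary v i \<in> euler m 1"
  unfolding euler_def using C1_fun_bary
  by (intro CollectI exI[of _ "\<lambda>x. grad i"]) (simp add: grad_diff bary_vertex)

lemma euler_power: "f \<in> euler m 1 \<Longrightarrow> (\<lambda>x. f x ^ n) \<in> euler m (real n)"
proof (induct n)
  case 0
  show ?case using euler_one by simp
next
  case (Suc n)
  then show ?case using euler_mult[of f m 1 "\<lambda>x. f x ^ n" "real n"] by (simp add: add.commute)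
qed

lemma euler_mon:
  assumes m: "m \<in> N" and f: "finite f" "m \<notin> f"
  shows "mon (bary v) f a \<in> euler m (real (sum a f))"
  using f
proof (induct f rule: finite_induct)
  case empty
  show ?case using euler_one by (simp add: mon_def)
next
  case (insert i f)
  then have "(\<lambda>x. bary v i x ^ a i * mon (bary v) f a x) \<in> euler m (real (a i) + real (sum a f))"
    using m by (intro euler_mult euler_power euler_bary) auto
  then show ?case using insert by (simp add: mon_def)
qed

lemma hom_euler:
  assumes m: "m \<in> N" and q: "q \<in> hom_polys (bary v) (N - {m}) (int r)"
  obtains Dq where "C1_fun q Dq" "\<And>x. Dq x \<bullet> (x - v m) = real r * q x"
proof -
  have "hom_polys (bary v) (N - {m}) (int r) \<subseteq> euler m (real r)"
    unfolding hom_polys_eq_span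
  proof (rule span_minimal[OF _ subspace_euler], rule image_subsetI)
    fix a assume "a \<in> midx (N - {m}) r"
    then have "sum a (N - {m}) = r" by (simp add: midx_def)
    then show "mon (bary v) (N - {m}) a \<in> euler m (real r)"
      using euler_mon[OF m, of "N - {m}" a] by simp
  qed
  then show ?thesis using q that unfolding euler_def by blast
qed

text \<open>With u = n \<lambda>_m both exp (-u) and u exp (-u) are bounded by 1 and tend to 0 off
  facet m, so dominated convergence applies. The second weight covers terms whose factor n is paid
  for by a factor \<lambda>_m.\<close>

lemma exp_layer_limit:
  fixes f :: "real^'n \<Rightarrow> real"
  assumes m: "m \<in> N" and f: "integrable MC f"
  shows "(\<lambda>n. LINT x|MC. exp (- (real n * bary v m x)) * f x) \<longlonglongrightarrow> 0" (is ?A)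
    and "(\<lambda>n. LINT x|MC. real n * bary v m x * exp (- (real n * bary v m x)) * f x) \<longlonglongrightarrow> 0" (is ?B)
proof -
  have bm: "bary v m \<in> borel_measurable MC"
    using bm_continuous[OF continuous_bary] unfolding bm_def by (intro borel_imp_MC) blast
  have fm: "f \<in> borel_measurable MC" using f by (rule borel_measurable_integrable)
  have ge: "0 \<le> bary v m x" if "x \<in> cell v" for x using that m unfolding cell_iff by blast
  have atop: "filterlim (\<lambda>n. real n * bary v m x) at_top sequentially" if "x \<in> icell" for x
  proof -
    have "0 < bary v m x" using that m unfolding icell_def by blast
    then show ?thesis
      by (rule filterlim_at_top_mult_tendsto_pos[OF tendsto_const _ filterlim_real_sequentially])
  qed
  have "(\<lambda>n. LINT x|MC. exp (- (real n * bary v m x)) * f x) \<longlonglongrightarrow> (LINT x|MC. 0)"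
  proof (rule integral_dominated_convergence[where w="\<lambda>x. \<bar>f x\<bar>"])
    show "(\<lambda>x. exp (- (real n * bary v m x)) * f x) \<in> borel_measurable MC" for n
      using bm fm by measurable
    show "integrable MC (\<lambda>x. \<bar>f x\<bar>)" using f by simp
    show "AE x in MC. norm (exp (- (real n * bary v m x)) * f x) \<le> \<bar>f x\<bar>" for n
    proof (rule AE_I2)
      fix x assume "x \<in> space MC"
      then have "exp (- (real n * bary v m x)) \<le> 1" using ge[of x] by (simp add: space_restrict_space)
      then show "norm (exp (- (real n * bary v m x)) * f x) \<le> \<bar>f x\<bar>"
        by (simp add: abs_mult mult_left_le_one_le)
    qed
    show "AE x in MC. (\<lambda>n. exp (- (real n * bary v m x)) * f x) \<longlonglongrightarrow> 0"
      using AE_MC_icell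
    proof (rule eventually_mono)
      fix x assume "x \<in> icell"
      then have "filterlim (\<lambda>n. - (real n * bary v m x)) at_bot sequentially"
        unfolding filterlim_uminus_at_top[symmetric] by (rule atop)
      then have "(\<lambda>n. exp (- (real n * bary v m x))) \<longlonglongrightarrow> 0" by (rule filterlim_compose[OF exp_at_bot])
      then show "(\<lambda>n. exp (- (real n * bary v m x)) * f x) \<longlonglongrightarrow> 0" by (rule tendsto_mult_left_zero)
    qed
  qed simp
  then show ?A by simp
  have "(\<lambda>n. LINT x|MC. real n * bary v m x * exp (- (real n * bary v m x)) * f x) \<longlonglongrightarrow> (LINT x|MC. 0)"
  proof (rule integral_dominated_convergence[where w="\<lambda>x. \<bar>f x\<bar>"])
    show "(\<lambda>x. real n * bary v m x * exp (- (real n * bary v m x)) * f x) \<in> borel_measurable MC" for n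
      using bm fm by measurable
    show "integrable MC (\<lambda>x. \<bar>f x\<bar>)" using f by simp
    show "AE x in MC. norm (real n * bary v m x * exp (- (real n * bary v m x)) * f x) \<le> \<bar>f x\<bar>" for n
    proof (rule AE_I2)
      fix x assume "x \<in> space MC"
      then have u: "0 \<le> real n * bary v m x" using ge[of x] by (simp add: space_restrict_space)
      define u where "u = real n * bary v m x"
      have "u \<le> exp u" using exp_ge_add_one_self[of u] by linarith
      then have "u * exp (- u) \<le> 1" by (simp add: exp_minus field_simps)
      moreover have "0 \<le> u * exp (- u)" using u unfolding u_def by simp
      ultimately have "\<bar>u * exp (- u)\<bar> * \<bar>f x\<bar> \<le> \<bar>f x\<bar>" by (simp add: mult_left_le_one_le)
      then show "norm (real n * bary v m x * exp (- (real n * bary v m x)) * f x) \<le> \<bar>f x\<bar>"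
        unfolding u_def by (simp add: abs_mult)
    qed
    show "AE x in MC. (\<lambda>n. real n * bary v m x * exp (- (real n * bary v m x)) * f x) \<longlonglongrightarrow> 0"
      using AE_MC_icell
    proof (rule eventually_mono)
      fix x assume "x \<in> icell"
      then have "(\<lambda>n. (real n * bary v m x) ^ 1 / exp (real n * bary v m x)) \<longlonglongrightarrow> 0"
        by (intro filterlim_compose[OF tendsto_power_div_exp_0 atop])
      then have "(\<lambda>n. real n * bary v m x * exp (- (real n * bary v m x))) \<longlonglongrightarrow> 0"
        by (simp add: exp_minus divide_inverse)
      then show "(\<lambda>n. real n * bary v m x * exp (- (real n * bary v m x)) * f x) \<longlonglongrightarrow> 0"
        by (rule tendsto_mult_left_zero)
    qed
  qed simp
  then show ?B by simp
qed

end

section \<open>Vanishing of the pointwise trace by a boundary layer argument\<close>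

lemma C1_field_scaleR:
  fixes e :: "real^'n"
  assumes "C1_fun f Df"
  shows "C1_field (\<lambda>x. f x *\<^sub>R e) (\<lambda>x. e \<otimes>\<^sub>t Df x)"
  unfolding C1_field_def
proof (intro conjI allI)
  fix x
  have "((\<lambda>x. f x *\<^sub>R e) has_derivative (\<lambda>h. (Df x \<bullet> h) *\<^sub>R e)) (at x)"
    using assms unfolding C1_fun_def by (intro has_derivative_scaleR_left) blast
  then show "((\<lambda>x. f x *\<^sub>R e) has_derivative (\<lambda>h. (e \<otimes>\<^sub>t Df x) *v h)) (at x)" by simp
next
  have "continuous_on UNIV Df" using assms unfolding C1_fun_def by blast
  then show "continuous_on UNIV (\<lambda>x. e \<otimes>\<^sub>t Df x)"
    unfolding tensor_def by (intro continuous_intros)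
qed

lemma polys_mult_vec:
  assumes "\<And>i j. (\<lambda>x. P x $ i $ j) \<in> polys r"
  shows "(\<lambda>x. (P x *v y) $ i) \<in> polys r"
  unfolding matrix_vector_mult_def
  using polys_sum[of UNIV "\<lambda>j x. y $ j * P x $ i $ j"] assms
  by (simp add: polys_scale mult.commute)

lemma polys_form:
  fixes P :: "real^'m \<Rightarrow> real^'n^'n"
  assumes "\<And>i j. (\<lambda>x. P x $ i $ j) \<in> polys r"
  shows "(\<lambda>x. z \<bullet> (P x *v y)) \<in> polys r"
  unfolding inner_vec_def inner_real_def
  by (intro polys_sum polys_scale polys_mult_vec assms)

lemma polys_matrix_continuous:
  fixes P :: "real^'m \<Rightarrow> real^'n^'k"
  assumes "\<And>i j. (\<lambda>x. P x $ i $ j) \<in> polys r"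
  shows "continuous_on S P"
proof -
  have "continuous_on S (\<lambda>x. \<chi> i j. P x $ i $ j)"
    by (intro continuous_on_vec_lambda polys_continuous[OF assms])
  then show ?thesis by (simp add: vec_nth_inverse)
qed

context simplex
begin

text \<open>On a set of finite measure |g| \<le> 1 + |g|^2 turns square integrability into
  integrability, and w is bounded on the cell.\<close>

lemma L2_inner_integrable:
  fixes g :: "real^'n \<Rightarrow> 'b::euclidean_space"
  assumes g: "g \<in> L2_on (cell v)" and w: "continuous_on UNIV w"
  shows "integrable MC (\<lambda>x. g x \<bullet> w x)"
proof -
  obtain B where B: "0 < B" "\<And>x. x \<in> cell v \<Longrightarrow> norm (w x) \<le> B"
    using bm_continuous[OF w] unfolding bm_def bounded_pos by auto
  have gm: "g \<in> borel_measurable MC" and gi: "integrable MC (\<lambda>x. (norm (g x))\<^sup>2)"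
    using g unfolding L2_on_def by auto
  have wm: "w \<in> borel_measurable MC"
    by (intro borel_imp_MC borel_measurable_continuous_onI w)
  have "integrable MC (\<lambda>x. B * (1 + (norm (g x))\<^sup>2))"
    using gi bm_integrable[OF bm_const[of "1::real"]] by (intro integrable_mult_right Bochner_Integration.integrable_add)
  then show ?thesis
  proof (rule Bochner_Integration.integrable_bound)
    show "(\<lambda>x. g x \<bullet> w x) \<in> borel_measurable MC" using gm wm by (rule borel_measurable_inner)
    show "AE x in MC. norm (g x \<bullet> w x) \<le> norm (B * (1 + (norm (g x))\<^sup>2))"
    proof (rule AE_I2)
      fix x assume "x \<in> space MC"
      then have x: "x \<in> cell v" by (simp add: space_restrict_space)
      have "\<bar>g x \<bullet> w x\<bar> \<le> norm (g x) * norm (w x)" by (rule Cauchy_Schwarz_ineq2)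
      also have "\<dots> \<le> norm (g x) * B" using B(2)[OF x] by (intro mult_left_mono) auto
      also have "norm (g x) \<le> 1 + (norm (g x))\<^sup>2"
        using zero_le_power2[of "norm (g x) - 1/2"] by (simp add: power2_diff power_divide)
      then have "norm (g x) * B \<le> (1 + (norm (g x))\<^sup>2) * B" using B(1) by (intro mult_right_mono) auto
      finally have "\<bar>g x \<bullet> w x\<bar> \<le> B * (1 + (norm (g x))\<^sup>2)" by (simp add: mult.commute)
      then show "norm (g x \<bullet> w x) \<le> norm (B * (1 + (norm (g x))\<^sup>2))" by simp
    qed
  qed
qed

text \<open>The radial field is a combination of the edges at v_m with weights \<lambda>_j, so
  Green's formulas along single edges add up to one for the radial field.\<close>

lemma sum_bary_edges: "(\<Sum>j\<in>N - {m}. bary v j x *\<^sub>R edge m j) = x - v m"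
  and sum_bary_others: "m \<in> N \<Longrightarrow> (\<Sum>j\<in>N - {m}. bary v j x) = 1 - bary v m x"
proof -
  have "(\<Sum>j\<in>N - {m}. bary v j x *\<^sub>R edge m j) = (\<Sum>j\<in>N. bary v j x *\<^sub>R edge m j)"
    by (rule sum.mono_neutral_left) (auto simp: edge_def)
  also have "\<dots> = x - v m"
    by (simp add: edge_def scaleR_diff_right sum_subtractf bary_repr bary_sum flip: scaleR_sum_left)
  finally show "(\<Sum>j\<in>N - {m}. bary v j x *\<^sub>R edge m j) = x - v m" .
  assume "m \<in> N"
  then show "(\<Sum>j\<in>N - {m}. bary v j x) = 1 - bary v m x"
    using sum.remove[of N m "\<lambda>j. bary v j x"] bary_sum[of x] by simp
qed

text \<open>Green's formula for \<open>(1 - exp (- n \<lambda>\<^sub>m)) q\<^sup>2 (x - v\<^sub>m)\<close>, whose normal component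
  vanishes on all facets. The divergence of \<open>q\<^sup>2 (x - v\<^sub>m)\<close> is a positive multiple of \<open>q\<^sup>2\<close> by
  Euler's identity.\<close>

lemma radial_green:
  assumes m: "m \<in> N" and q: "q \<in> hom_polys (bary v) (N - {m}) (int r)"
  shows "real n * (LINT x|MC. exp (- (real n * bary v m x)) * ((1 - bary v m x) * (q x)\<^sup>2))
    = (2 * real r + real CARD('n)) * (LINT x|MC. (1 - exp (- (real n * bary v m x))) * (q x)\<^sup>2)"
proof -
  obtain Dq where Dq: "C1_fun q Dq" "\<And>x. Dq x \<bullet> (x - v m) = real r * q x"
    using hom_euler[OF m q] by metis
  define E where "E x = exp (- (real n * bary v m x))" for x
  define Q where "Q x = q x * q x" for x
  define DQ where "DQ x = q x *\<^sub>R Dq x + q x *\<^sub>R Dq x" for x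
  have CQ: "C1_fun Q DQ" unfolding Q_def DQ_def using C1_fun_mult[OF Dq(1) Dq(1)] .
  have "C1_fun (\<lambda>x. - real n * bary v m x) (\<lambda>x. - real n *\<^sub>R grad m)"
    by (rule C1_fun_scale[OF C1_fun_bary])
  then have CE: "C1_fun E (\<lambda>x. E x *\<^sub>R (- real n *\<^sub>R grad m))"
    unfolding E_def using C1_fun_exp by fastforce
  have CF: "C1_fun (\<lambda>x. 1 - E x) (\<lambda>x. (real n * E x) *\<^sub>R grad m)"
    using C1_fun_diff[OF C1_fun_const[of 1] CE] by (simp add: mult.commute)
  define D where "D j x = ((1 - E x) * Q x) *\<^sub>R grad j
    + bary v j x *\<^sub>R ((1 - E x) *\<^sub>R DQ x + Q x *\<^sub>R ((real n * E x) *\<^sub>R grad m))" for j x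
  have CD: "C1_fun (\<lambda>x. ((1 - E x) * Q x) * bary v j x) (D j)" for j
    unfolding D_def by (rule C1_fun_mult[OF C1_fun_mult[OF CF CQ] C1_fun_bary])
  \<comment> \<open>Lines parallel to the edge m j cross the facets m and j. On the first 1 - E
    vanishes, since the exponent is 0; on the second \<lambda>_j does.\<close>
  have int0: "(LINT x|MC. D j x \<bullet> edge m j) = 0" if j: "j \<in> N - {m}" for j
    using m _ _ CD
  proof (rule edge_integral_zero)
    fix x assume "bary v m x = 0 \<or> bary v j x = 0"
    then show "((1 - E x) * Q x) * bary v j x = 0" by (auto simp: E_def)
  qed (use j in auto)
  have cont: "continuous_on UNIV E" "continuous_on UNIV Q" "continuous_on UNIV (D j)" for j
    using C1_fun_continuous[OF CE] C1_fun_continuous[OF CQ] CD unfolding C1_fun_def by blast+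
  have qc: "continuous_on UNIV q" by (rule C1_fun_continuous[OF Dq(1)])
  \<comment> \<open>The summand d comes from grad j . t_mj = 1 for the d other vertices, and 2 r
    from Euler's identity for q^2. The term with n stems from the derivative of 1 - E, since grad m
    . t_mj = -1.\<close>
  have sumD: "(\<Sum>j\<in>N - {m}. D j x \<bullet> edge m j)
    = (2 * real r + real CARD('n)) * ((1 - E x) * Q x) - real n * (E x * ((1 - bary v m x) * Q x))" for x
  proof -
    have "D j x \<bullet> edge m j = (1 - E x) * Q x + (1 - E x) * (DQ x \<bullet> (bary v j x *\<^sub>R edge m j))
      - (real n * E x * Q x) * bary v j x" if j: "j \<in> N - {m}" for j
    proof -
      have "grad j \<bullet> edge m j = 1" "grad m \<bullet> edge m j = - 1"
        using j m by (simp_all add: edge_def grad_edge)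
      then show ?thesis by (simp add: D_def inner_add_left algebra_simps)
    qed
    then have "(\<Sum>j\<in>N - {m}. D j x \<bullet> edge m j) = (\<Sum>j\<in>N - {m}. (1 - E x) * Q x
      + (1 - E x) * (DQ x \<bullet> (bary v j x *\<^sub>R edge m j)) - (real n * E x * Q x) * bary v j x)"
      by (rule sum.cong[OF refl])
    also have "\<dots> = real (card (N - {m})) * ((1 - E x) * Q x)
      + (1 - E x) * (DQ x \<bullet> (\<Sum>j\<in>N - {m}. bary v j x *\<^sub>R edge m j))
      - (real n * E x * Q x) * (\<Sum>j\<in>N - {m}. bary v j x)"
      by (simp only: sum_subtractf sum.distrib sum_constant inner_sum_right sum_distrib_left)
    also have "card (N - {m}) = CARD('n)" using m by simp
    also have "DQ x \<bullet> (\<Sum>j\<in>N - {m}. bary v j x *\<^sub>R edge m j) = 2 * real r * Q x"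
      unfolding sum_bary_edges DQ_def Q_def inner_add_left inner_scaleR_left Dq(2) by simp
    finally show ?thesis unfolding sum_bary_others[OF m] by (simp add: algebra_simps)
  qed
  have i1: "integrable MC (\<lambda>x. D j x \<bullet> edge m j)" for j
    by (intro bm_integrable bm_continuous continuous_intros cont)
  have i2: "integrable MC (\<lambda>x. (1 - E x) * Q x)"
    by (intro bm_integrable bm_continuous continuous_intros cont)
  have i3: "integrable MC (\<lambda>x. E x * ((1 - bary v m x) * Q x))"
    by (intro bm_integrable bm_continuous continuous_intros cont)
  have "0 = (\<Sum>j\<in>N - {m}. (LINT x|MC. D j x \<bullet> edge m j))" by (simp add: int0)
  also have "\<dots> = (LINT x|MC. (\<Sum>j\<in>N - {m}. D j x \<bullet> edge m j))"
    by (rule Bochner_Integration.integral_sum[symmetric]) (rule i1)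
  also have "\<dots> = (2 * real r + real CARD('n)) * (LINT x|MC. (1 - E x) * Q x)
    - real n * (LINT x|MC. E x * ((1 - bary v m x) * Q x))"
    unfolding sumD using i2 i3 by simp
  finally show ?thesis unfolding E_def Q_def power2_eq_square by simp
qed

text \<open>The test fields \<open>exp (- n \<lambda>\<^sub>m) (1 - \<lambda>\<^sub>m) q e\<^sub>i\<close> concentrate on the facet opposite to \<open>m\<close>, where
  \<open>q\<close>, the part of the \<open>i\<close>-th component of the trace that is homogeneous in the other barycentric
  coordinates, equals that component.\<close>

lemma H0_trace:
  assumes tau: "tau \<in> H0_div (cell v)"
    and P: "\<And>i j. (\<lambda>x. P x $ i $ j) \<in> polys (Suc r)" and eq: "\<And>x. x \<in> cell v \<Longrightarrow> tau x = P x"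
    and m: "m \<in> N" and x: "x \<in> rface m"
  shows "P x *v grad m = 0"
proof -
  obtain g where g: "g \<in> L2_on (cell v)"
    and green: "\<And>phi Dphi. C1_field phi Dphi \<Longrightarrow>
      (LINT x|MC. tau x \<bullet> Dphi x) + (LINT x|MC. g x \<bullet> phi x) = 0"
    using tau unfolding H0_div_def by blast
  have Pc: "continuous_on UNIV P" by (rule polys_matrix_continuous[OF P])
  have "(P x *v grad m) $ i = 0" for i
  proof -
    define p where "p = (\<lambda>x. (P x *v grad m) $ i)"
    have pp: "p \<in> polys (Suc r)" unfolding p_def by (rule polys_mult_vec[OF P])
    obtain q s where q: "q \<in> hom_polys (bary v) (N - {m}) (int (Suc r))" and s: "s \<in> polys r"
      and split: "\<And>x. p x = q x + bary v m x * s x"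
      using poly_split_face[OF m pp] by metis
    have qp: "q \<in> polys (Suc r)" using hom_subset_polys[of "N - {m}"] q by blast
    have pc: "continuous_on UNIV p" and qc: "continuous_on UNIV q" and sc: "continuous_on UNIV s"
      using pp qp s by (auto intro: polys_continuous)
    obtain Dq where Dq: "C1_fun q Dq" using polys_C1[OF qp] by metis
    \<comment> \<open>The factor 1 - \<lambda>_m is 1 on facet m; it reproduces the integrand on the
      left of \<open>radial_green\<close>.\<close>
    define w where "w x = (1 - bary v m x) * q x" for x
    obtain Dw where Dw: "C1_fun w Dw"
      unfolding w_def using C1_fun_mult[OF C1_fun_diff[OF C1_fun_const C1_fun_bary] Dq] by blast
    have wc: "continuous_on UNIV w" by (rule C1_fun_continuous[OF Dw])
    have Dwc: "continuous_on UNIV Dw" using Dw unfolding C1_fun_def by blast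
    define E where "E n x = exp (- (real n * bary v m x))" for n x
    have Ec: "continuous_on UNIV (E n)" for n unfolding E_def by (intro continuous_intros)
    define A where "A x = (P x *v Dw x) $ i + g x \<bullet> (w x *\<^sub>R axis i 1)" for x
    have A1: "continuous_on UNIV (\<lambda>x. (P x *v Dw x) $ i)"
      unfolding matrix_vector_mult_def by (simp, intro continuous_intros Pc Dwc)
    have A2: "integrable MC (\<lambda>x. g x \<bullet> (w x *\<^sub>R axis i 1))"
      by (intro L2_inner_integrable[OF g] continuous_intros wc)
    have A: "integrable MC A"
      unfolding A_def by (intro Bochner_Integration.integrable_add A2 bm_integrable[OF bm_continuous[OF A1]])
    \<comment> \<open>Green's formula for E w e_i, sorted by whether the derivative falls on E. If
      it does, it brings down n and the trace component p; all other terms are collected in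
      \<open>A\<close>.\<close>
    have key: "real n * (LINT x|MC. E n x * (w x * p x)) = (LINT x|MC. E n x * A x)" for n
    proof -
      have "C1_fun (\<lambda>x. - real n * bary v m x) (\<lambda>x. - real n *\<^sub>R grad m)"
        by (rule C1_fun_scale[OF C1_fun_bary])
      then have CE: "C1_fun (E n) (\<lambda>x. E n x *\<^sub>R (- real n *\<^sub>R grad m))"
        unfolding E_def using C1_fun_exp by fastforce
      define Dpsi where "Dpsi x = E n x *\<^sub>R Dw x + w x *\<^sub>R (E n x *\<^sub>R (- real n *\<^sub>R grad m))" for x
      have Cpsi: "C1_fun (\<lambda>x. E n x * w x) Dpsi"
        unfolding Dpsi_def by (rule C1_fun_mult[OF CE Dw])
      have "0 = (LINT x|MC. tau x \<bullet> (axis i 1 \<otimes>\<^sub>t Dpsi x)) + (LINT x|MC. g x \<bullet> ((E n x * w x) *\<^sub>R axis i 1))"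
        using green[OF C1_field_scaleR[OF Cpsi, of "axis i 1"]] by simp
      also have "(LINT x|MC. tau x \<bullet> (axis i 1 \<otimes>\<^sub>t Dpsi x))
        = (LINT x|MC. E n x * (P x *v Dw x) $ i - real n * (E n x * (w x * p x)))"
      proof (rule Bochner_Integration.integral_cong[OF refl])
        fix x assume "x \<in> space MC"
        then have "tau x = P x" by (intro eq) (simp add: space_restrict_space)
        then have "tau x \<bullet> (axis i 1 \<otimes>\<^sub>t Dpsi x) = (P x *v Dpsi x) $ i"
          by (simp add: inner_tensor inner_axis')
        also have "\<dots> = E n x * (P x *v Dw x) $ i - real n * (E n x * (w x * p x))"
          unfolding Dpsi_def matrix_vector_right_distrib mult_vec_scaleR_right p_def
          by (simp add: mult_ac)
        finally show "tau x \<bullet> (axis i 1 \<otimes>\<^sub>t Dpsi x)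
          = E n x * (P x *v Dw x) $ i - real n * (E n x * (w x * p x))" .
      qed
      also have "\<dots> = (LINT x|MC. E n x * (P x *v Dw x) $ i) - real n * (LINT x|MC. E n x * (w x * p x))"
      proof -
        have "integrable MC (\<lambda>x. E n x * (P x *v Dw x) $ i)" "integrable MC (\<lambda>x. E n x * (w x * p x))"
          by (intro bm_integrable bm_continuous continuous_on_mult Ec A1 wc pc)+
        then show ?thesis by simp
      qed
      also have "(LINT x|MC. E n x * (P x *v Dw x) $ i) - real n * (LINT x|MC. E n x * (w x * p x))
          + (LINT x|MC. g x \<bullet> ((E n x * w x) *\<^sub>R axis i 1))
        = (LINT x|MC. E n x * A x) - real n * (LINT x|MC. E n x * (w x * p x))"
      proof -
        have "integrable MC (\<lambda>x. E n x * (P x *v Dw x) $ i)"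
          by (intro bm_integrable bm_continuous continuous_on_mult Ec A1)
        moreover have "integrable MC (\<lambda>x. g x \<bullet> ((E n x * w x) *\<^sub>R axis i 1))"
          by (intro L2_inner_integrable[OF g] continuous_on_scaleR continuous_on_mult Ec wc continuous_on_const)
        moreover have "E n x * A x = E n x * (P x *v Dw x) $ i + g x \<bullet> ((E n x * w x) *\<^sub>R axis i 1)" for x
          by (simp add: A_def algebra_simps)
        ultimately show ?thesis by simp
      qed
      finally show ?thesis by simp
    qed
    have lim1: "(\<lambda>n. real n * (LINT x|MC. E n x * (w x * p x))) \<longlonglongrightarrow> 0"
      unfolding key using exp_layer_limit(1)[OF m A] unfolding E_def .
    have lim2: "(\<lambda>n. LINT x|MC. real n * bary v m x * E n x * (w x * s x)) \<longlonglongrightarrow> 0"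
      unfolding E_def
      by (intro exp_layer_limit(2)[OF m] bm_integrable bm_continuous continuous_on_mult wc sc)
    \<comment> \<open>Here p = q + \<lambda>_m s. The second summand is of the type u exp (-u) and
      drops out in the limit, leaving w q = (1 - \<lambda>_m) q^2.\<close>
    have "real n * (LINT x|MC. E n x * (w x * p x)) - (LINT x|MC. real n * bary v m x * E n x * (w x * s x))
      = real n * (LINT x|MC. E n x * ((1 - bary v m x) * (q x)\<^sup>2))" for n
    proof -
      have i1: "integrable MC (\<lambda>x. E n x * (w x * p x))"
        by (intro bm_integrable bm_continuous continuous_on_mult Ec wc pc)
      have i2: "integrable MC (\<lambda>x. bary v m x * E n x * (w x * s x))"
        by (intro bm_integrable bm_continuous continuous_on_mult Ec wc sc continuous_bary)
      have "(LINT x|MC. real n * bary v m x * E n x * (w x * s x))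
        = real n * (LINT x|MC. bary v m x * E n x * (w x * s x))"
        unfolding mult.assoc by simp
      then have "real n * (LINT x|MC. E n x * (w x * p x)) - (LINT x|MC. real n * bary v m x * E n x * (w x * s x))
        = real n * (LINT x|MC. E n x * (w x * p x) - bary v m x * E n x * (w x * s x))"
        using i1 i2 by (simp add: right_diff_distrib)
      also have "(\<lambda>x. E n x * (w x * p x) - bary v m x * E n x * (w x * s x))
        = (\<lambda>x. E n x * ((1 - bary v m x) * (q x)\<^sup>2))"
        unfolding split w_def by (intro ext) (simp add: algebra_simps power2_eq_square)
      finally show ?thesis .
    qed
    then have lim3: "(\<lambda>n. real n * (LINT x|MC. E n x * ((1 - bary v m x) * (q x)\<^sup>2))) \<longlonglongrightarrow> 0"
      using tendsto_diff[OF lim1 lim2] by simp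
    define K where "K = 2 * real (Suc r) + real CARD('n)"
    have K: "0 < K" unfolding K_def by (intro add_nonneg_pos) simp_all
    have iQ: "integrable MC (\<lambda>x. (q x)\<^sup>2)"
      by (intro bm_integrable bm_continuous continuous_intros qc)
    have "(LINT x|MC. (1 - E n x) * (q x)\<^sup>2) = (LINT x|MC. (q x)\<^sup>2) - (LINT x|MC. E n x * (q x)\<^sup>2)" for n
    proof -
      have "integrable MC (\<lambda>x. E n x * (q x)\<^sup>2)"
        by (intro bm_integrable bm_continuous continuous_intros qc Ec)
      then show ?thesis using iQ by (simp add: left_diff_distrib)
    qed
    moreover have "(\<lambda>n. LINT x|MC. E n x * (q x)\<^sup>2) \<longlonglongrightarrow> 0"
      unfolding E_def by (rule exp_layer_limit(1)[OF m iQ])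
    ultimately have "(\<lambda>n. K * (LINT x|MC. (1 - E n x) * (q x)\<^sup>2)) \<longlonglongrightarrow> K * ((LINT x|MC. (q x)\<^sup>2) - 0)"
      by (simp only:) (intro tendsto_intros)
    \<comment> \<open>\<open>radial_green\<close> identifies this sequence with the one of
      \<open>lim3\<close>; comparing the two limits shows that q^2 has integral 0.\<close>
    moreover have "(\<lambda>n. K * (LINT x|MC. (1 - E n x) * (q x)\<^sup>2)) \<longlonglongrightarrow> 0"
      using lim3 unfolding E_def radial_green[OF m q] K_def .
    ultimately have "K * ((LINT x|MC. (q x)\<^sup>2) - 0) = 0" by (rule LIMSEQ_unique)
    then have z: "(LINT x|MC. (q x)\<^sup>2) = 0" using K by simp
    have q0: "q y = 0" if "y \<in> icell" for y
    proof -
      have "(q y)\<^sup>2 = 0"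
        by (rule integral_zero_imp_zero[OF _ _ z that]) (auto intro!: continuous_on_power qc)
      then show ?thesis by simp
    qed
    have "q x = 0"
      using isubcell_subset by (intro rface_limit[OF qc m x] q0) blast
    then have "p x = 0" using split[of x] x by (simp add: rface_def)
    then show ?thesis by (simp add: p_def)
  qed
  then show ?thesis by (simp add: vec_eq_iff)
qed

end

section \<open>The bubble space\<close>

lemma matrix_expansion: "A = (\<Sum>z\<in>UNIV. (A $ fst z $ snd z) *\<^sub>R axis (fst z) (axis (snd z) 1))"
  for A :: "real^'n^'n"
proof -
  have "(\<Sum>z\<in>UNIV. (A $ fst z $ snd z) *\<^sub>R axis (fst z) (axis (snd z) (1::real))) $ i $ j = A $ i $ j"
    for i j :: 'n
  proof -
    have "(\<Sum>z\<in>UNIV. (A $ fst z $ snd z) *\<^sub>R axis (fst z) (axis (snd z) (1::real))) $ i $ j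
      = (\<Sum>z\<in>UNIV. if z = (i, j) then A $ i $ j else 0)"
      by (simp only: sum_component) (rule sum.cong[OF refl], auto simp: axis_def)
    then show ?thesis by simp
  qed
  then show ?thesis by (simp add: vec_eq_iff)
qed

text \<open>The Riesz lemma wants generators inside \<open>V\<close>, while expansions only place
  \<open>V\<close> in the span of some finite set. A maximal independent subset of \<open>V\<close>
  is finite by comparison with that set.\<close>

lemma finite_spanning_subset:
  assumes V: "subspace V" and S: "finite S" "V \<subseteq> span S"
  obtains B where "finite B" "B \<subseteq> V" "span B = V"
proof -
  obtain B where B: "B \<subseteq> V" "independent B" "V \<subseteq> span B"
    using maximal_independent_subset by metis
  have "finite B" using independent_span_bound[OF S(1) B(2)] B(1) S(2) by blast
  moreover have "span B \<subseteq> V" using B(1) V by (rule span_minimal)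
  ultimately show ?thesis using that B by blast
qed

lemma subspace_polys_on: "subspace (polys_on r D)"
proof -
  have "subspace ((\<lambda>p x. if x \<in> D then p x else 0) ` polys r)"
    by (rule linear_subspace_image[OF _ subspace_polys])
      (auto intro!: linearI simp: fun_eq_iff)
  moreover have "polys_on r D = (\<lambda>p x. if x \<in> D then p x else 0) ` polys r"
    unfolding polys_on_def by blast
  ultimately show ?thesis by simp
qed

context simplex
begin

lemma polys_on_finite:
  fixes D :: "(real^'n) set"
  obtains S where "finite S" "polys_on r D \<subseteq> span S"
proof -
  let ?b = "\<lambda>a x. if x \<in> D then mon (bary v) N a x else 0"
  have "polys_on r D \<subseteq> span (?b ` midx N r)"
  proof
    fix q assume "q \<in> polys_on r D"
    then obtain p where p: "p \<in> polys r" "q = (\<lambda>x. if x \<in> D then p x else 0)"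
      unfolding polys_on_def by blast
    then obtain c where c: "p = (\<lambda>x. \<Sum>a\<in>midx N r. c a * mon (bary v) N a x)"
      unfolding polys_eq_hom hom_polys_iff[OF finite_N] by blast
    have "q = (\<Sum>a\<in>midx N r. c a *\<^sub>R ?b a)"
      unfolding p c by (intro ext) (simp add: sum_fun_apply)
    then show "q \<in> span (?b ` midx N r)"
      by (simp only: span_image_finite[OF finite_midx[OF finite_N]]) blast
  qed
  then show ?thesis using that finite_midx[OF finite_N] by blast
qed

lemma fields_finite:
  fixes V :: "(real^'n \<Rightarrow> 'b::real_vector) set" and e :: "'i \<Rightarrow> 'b"
  assumes V: "subspace V" and I: "finite I"
    and repr: "\<And>q. q \<in> V \<Longrightarrow> \<exists>c. (\<forall>i\<in>I. c i \<in> polys_on r D) \<and> q = (\<lambda>x. \<Sum>i\<in>I. c i x *\<^sub>R e i)"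
  obtains B where "finite B" "B \<subseteq> V" "span B = V"
proof -
  obtain S where S: "finite S" "polys_on r D \<subseteq> span S" by (rule polys_on_finite)
  let ?h = "\<lambda>i (p::real^'n \<Rightarrow> real) x. p x *\<^sub>R e i"
  let ?S = "\<Union>i\<in>I. ?h i ` S"
  have lin: "linear (?h i)" for i
    by (rule linearI) (simp_all add: fun_eq_iff scaleR_add_left)
  have "V \<subseteq> span ?S"
  proof
    fix q assume "q \<in> V"
    then obtain c where c: "\<forall>i\<in>I. c i \<in> polys_on r D" "q = (\<lambda>x. \<Sum>i\<in>I. c i x *\<^sub>R e i)"
      using repr by blast
    have "?h i (c i) \<in> span ?S" if i: "i \<in> I" for i
    proof -
      have "?h i (c i) \<in> ?h i ` span S" using c(1) S(2) i by blast
      also have "\<dots> = span (?h i ` S)" by (rule linear_span_image[OF lin, symmetric])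
      also have "\<dots> \<subseteq> span ?S" using i by (intro span_mono) blast
      finally show ?thesis .
    qed
    then have "(\<Sum>i\<in>I. ?h i (c i)) \<in> span ?S" by (rule span_sum)
    moreover have "q = (\<Sum>i\<in>I. ?h i (c i))" unfolding c(2) by (intro ext) (simp add: sum_fun_apply)
    ultimately show "q \<in> span ?S" by simp
  qed
  moreover have "finite ?S" using I S(1) by simp
  ultimately show ?thesis using finite_spanning_subset[OF V] that by blast
qed

lemma subspace_vec_polys_on: "subspace (vec_polys_on r D)"
  using subspace_polys_on[of r D]
  unfolding subspace_def vec_polys_on_def zero_fun_def plus_fun_def scaleR_fun_def by simp

lemma subspace_sym_polys_on: "subspace (sym_polys_on r D)"
  using subspace_polys_on[of r D]
  unfolding subspace_def sym_polys_on_def sym_mats_def zero_fun_def plus_fun_def scaleR_fun_def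
  by (simp add: transpose_add transpose_scaleR) (simp add: transpose_def vec_eq_iff)

lemma vec_polys_on_finite:
  obtains B :: "(real^'n \<Rightarrow> real^'n) set"
  where "finite B" "B \<subseteq> vec_polys_on r D" "span B = vec_polys_on r D"
proof (rule fields_finite[OF subspace_vec_polys_on[of r D] finite[of "UNIV :: 'n set"]])
  fix q :: "real^'n \<Rightarrow> real^'n" assume "q \<in> vec_polys_on r D"
  then show "\<exists>c. (\<forall>i\<in>UNIV. c i \<in> polys_on r D) \<and> q = (\<lambda>x. \<Sum>i\<in>UNIV. c i x *\<^sub>R axis i 1)"
    unfolding vec_polys_on_def
    by (intro exI[of _ "\<lambda>i x. q x $ i"]) (simp add: fun_eq_iff basis_expansion flip: scalar_mult_eq_scaleR)
qed (rule that)

lemma sym_polys_on_finite: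
  obtains B :: "(real^'n \<Rightarrow> real^'n^'n) set"
  where "finite B" "B \<subseteq> sym_polys_on r D" "span B = sym_polys_on r D"
proof (rule fields_finite[OF subspace_sym_polys_on[of r D] finite[of "UNIV :: ('n \<times> 'n) set"]])
  fix q :: "real^'n \<Rightarrow> real^'n^'n" assume "q \<in> sym_polys_on r D"
  then show "\<exists>c. (\<forall>z\<in>UNIV. c z \<in> polys_on r D)
      \<and> q = (\<lambda>x. \<Sum>z\<in>UNIV. c z x *\<^sub>R axis (fst z) (axis (snd z) 1))"
    unfolding sym_polys_on_def
    by (intro exI[of _ "\<lambda>z x. q x $ fst z $ snd z"]) (simp add: fun_eq_iff flip: matrix_expansion)
qed (rule that)

text \<open>Entries determine their polynomials only up to functions vanishing on \<open>D\<close>,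
  so the chosen ones may fail to be symmetric off \<open>D\<close>; averaging with the transpose
  repairs this.\<close>

lemma sym_polys_on_repr:
  assumes "q \<in> sym_polys_on r D"
  obtains P where "\<And>i j. (\<lambda>x. P x $ i $ j) \<in> polys r" "\<And>x. transpose (P x) = P x"
    "q = (\<lambda>x. if x \<in> D then P x else 0)"
proof -
  have "\<exists>p\<in>polys r. (\<lambda>x. q x $ i $ j) = (\<lambda>x. if x \<in> D then p x else 0)" for i j
    using assms unfolding sym_polys_on_def polys_on_def by blast
  then obtain p where p: "\<And>i j. p i j \<in> polys r"
    "\<And>i j. (\<lambda>x. q x $ i $ j) = (\<lambda>x. if x \<in> D then p i j x else 0)"
    by metis
  define P where "P x = (\<chi> i j. (1/2) * (p i j x + p j i x))" for x
  have "(\<lambda>x. P x $ i $ j) \<in> polys r" for i j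
    unfolding P_def by (simp, intro polys_scale[of _ _ "1/2", simplified] polys_add p)
  moreover have "transpose (P x) = P x" for x
    by (simp add: P_def transpose_def vec_eq_iff add.commute)
  moreover have "q x = (if x \<in> D then P x else 0)" for x
  proof -
    have qp: "q x $ i $ j = (if x \<in> D then p i j x else 0)" for i j
      using fun_cong[OF p(2)] .
    have "transpose (q x) = q x" using assms unfolding sym_polys_on_def sym_mats_def by blast
    then have "q x $ j $ i = q x $ i $ j" for i j
      unfolding transpose_def vec_eq_iff by simp
    then have "x \<in> D \<Longrightarrow> p i j x = p j i x" for i j using qp by metis
    then show ?thesis by (simp add: vec_eq_iff qp P_def)
  qed
  ultimately show ?thesis using that by blast
qed

lemma sym_polys_on_bm:
  assumes "q \<in> sym_polys_on r (cell v)"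
  shows "bm q"
proof (rule sym_polys_on_repr[OF assms])
  fix P assume P: "\<And>i j. (\<lambda>x. P x $ i $ j) \<in> polys r" "q = (\<lambda>x. if x \<in> cell v then P x else 0)"
  show ?thesis
    unfolding P(2) by (intro bm_if bm_continuous polys_matrix_continuous[OF P(1)] cell_borel)
qed

lemma bm_L2:
  assumes f: "bm f"
  shows "f \<in> L2_on (cell v)"
proof -
  have "integrable MC (\<lambda>x. f x \<bullet> f x)" by (rule bm_integrable[OF bm_inner[OF f f]])
  moreover have "f \<in> borel_measurable MC" using f by (intro borel_imp_MC) (simp only: bm_def)
  ultimately show ?thesis by (simp only: L2_on_def power2_norm_eq_inner mem_Collect_eq)
qed

lemma edge_self: "edge i i = 0"
  by (simp add: edge_def)

text \<open>The coefficient \<lambda>_i \<lambda>_j s_ij vanishes on both facets that lines parallel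
  to t_ij cross. Green's formula along the edge therefore allows arbitrary boundary values of t_ij .
  phi, and the derivative of the coefficient along the edge gives the divergence.\<close>

lemma bubble_mem:
  assumes s: "\<And>i j. s i j \<in> polys r"
  shows "(\<lambda>x. if x \<in> cell v then (\<Sum>i\<in>N. \<Sum>j\<in>N. (bary v i x * bary v j x * s i j x)
    *\<^sub>R (edge i j \<otimes>\<^sub>t edge i j)) else 0) \<in> bubble_div v (Suc (Suc r))" (is "?tau \<in> _")
proof -
  define c where "c i j = (\<lambda>x. bary v i x * bary v j x * s i j x)" for i j
  define tau where "tau x = (\<Sum>i\<in>N. \<Sum>j\<in>N. c i j x *\<^sub>R (edge i j \<otimes>\<^sub>t edge i j))" for x
  have tau_eq: "?tau = (\<lambda>x. if x \<in> cell v then tau x else 0)" unfolding tau_def c_def ..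
  have c_polys: "c i j \<in> polys (Suc (Suc r))" for i j
    unfolding c_def using polys_mult[OF polys_mult[OF bary_in_polys bary_in_polys] s] by simp
  have "\<exists>D. C1_fun (c i j) D" for i j using polys_C1[OF c_polys] by metis
  then obtain D where D: "\<And>i j. C1_fun (c i j) (D i j)" by metis
  have cc: "continuous_on S (c i j)" for S i j by (rule polys_continuous[OF c_polys])
  have Dc: "continuous_on UNIV (D i j)" for i j using D unfolding C1_fun_def by blast
  define g where "g x = (\<Sum>i\<in>N. \<Sum>j\<in>N. (D i j x \<bullet> edge i j) *\<^sub>R edge i j)" for x
  have tauc: "continuous_on UNIV tau" unfolding tau_def by (intro continuous_intros cc)
  have gc: "continuous_on UNIV g" unfolding g_def by (intro continuous_intros Dc)
  have bmt: "bm ?tau" unfolding tau_eq by (intro bm_if bm_continuous tauc) simp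
  have trans: "transpose (?tau x) = ?tau x" for x
    by (simp add: transpose_sum transpose_scaleR transpose_tensor) (simp add: transpose_def vec_eq_iff)
  have green: "(LINT x|MC. ?tau x \<bullet> Dphi x) + (LINT x|MC. g x \<bullet> phi x) = 0"
    if phi: "C1_field phi Dphi" for phi Dphi
  proof -
    define I where "I i j x = c i j x * (edge i j \<bullet> (Dphi x *v edge i j))
      + (D i j x \<bullet> edge i j) * (edge i j \<bullet> phi x)" for i j x
    have phic: "continuous_on UNIV Dphi" "continuous_on UNIV phi"
      using phi unfolding C1_field_def
      by (auto intro!: continuous_at_imp_continuous_on dest: has_derivative_continuous)
    have Dphi_vec: "continuous_on UNIV (\<lambda>x. Dphi x *v y)" for y
      unfolding matrix_vector_mult_def by (intro continuous_intros phic)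
    have I0: "(LINT x|MC. I i j x) = 0" if ij: "i \<in> N" "j \<in> N" for i j
    proof (cases "i = j")
      case True
      then show ?thesis by (simp add: I_def edge_self)
    next
      case False
      have "(LINT x|MC. (c i j x *\<^sub>R (edge i j v* Dphi x) + (edge i j \<bullet> phi x) *\<^sub>R D i j x) \<bullet> edge i j) = 0"
        using ij False C1_fun_mult[OF D C1_fun_field_inner[OF phi]]
        by (rule edge_integral_zero) (auto simp: c_def)
      moreover have "(c i j x *\<^sub>R (edge i j v* Dphi x) + (edge i j \<bullet> phi x) *\<^sub>R D i j x) \<bullet> edge i j = I i j x" for x
        by (simp add: I_def inner_add_left dot_lmul_matrix mult.commute)
      ultimately show ?thesis by simp
    qed
    have Ii: "integrable MC (I i j)" for i j
      unfolding I_def by (intro bm_integrable bm_continuous continuous_intros cc Dc phic Dphi_vec)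
    have "integrable MC (\<lambda>x. ?tau x \<bullet> Dphi x)" "integrable MC (\<lambda>x. g x \<bullet> phi x)"
      by (intro bm_integrable bm_inner bmt bm_continuous gc phic)+
    then have "(LINT x|MC. ?tau x \<bullet> Dphi x) + (LINT x|MC. g x \<bullet> phi x)
      = (LINT x|MC. ?tau x \<bullet> Dphi x + g x \<bullet> phi x)" by simp
    also have "\<dots> = (LINT x|MC. (\<Sum>i\<in>N. \<Sum>j\<in>N. I i j x))"
    proof (rule Bochner_Integration.integral_cong[OF refl])
      fix x assume "x \<in> space MC"
      then have "?tau x = tau x" by (simp add: space_restrict_space tau_def c_def)
      then have "?tau x \<bullet> Dphi x = (\<Sum>i\<in>N. \<Sum>j\<in>N. c i j x * (edge i j \<bullet> (Dphi x *v edge i j)))"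
        by (simp add: tau_def inner_sum_left inner_commute[of "_ \<otimes>\<^sub>t _"] inner_tensor)
      moreover have "g x \<bullet> phi x = (\<Sum>i\<in>N. \<Sum>j\<in>N. (D i j x \<bullet> edge i j) * (edge i j \<bullet> phi x))"
        by (simp add: g_def inner_sum_left)
      ultimately show "?tau x \<bullet> Dphi x + g x \<bullet> phi x = (\<Sum>i\<in>N. \<Sum>j\<in>N. I i j x)"
        by (simp add: I_def sum.distrib)
    qed
    also have "\<dots> = (\<Sum>i\<in>N. \<Sum>j\<in>N. (LINT x|MC. I i j x))"
      by (subst Bochner_Integration.integral_sum, (intro Bochner_Integration.integrable_sum Ii))
        (intro sum.cong refl Bochner_Integration.integral_sum Ii)
    also have "\<dots> = 0" by (simp add: I0)
    finally show ?thesis .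
  qed
  have weak: "has_weak_div ?tau g (cell v)"
    unfolding has_weak_div_def
  proof (intro allI impI)
    fix phi Dphi
    assume "C1_field phi Dphi \<and> compact (closure {x. phi x \<noteq> 0}) \<and> closure {x. phi x \<noteq> 0} \<subseteq> interior (cell v)"
    then show "(LINT x|MC. ?tau x \<bullet> Dphi x) = - (LINT x|MC. g x \<bullet> phi x)"
      using green[of phi Dphi] by linarith
  qed
  have "AE x in MC. ?tau x \<in> sym_mats"
    using trans by (intro AE_I2) (simp only: sym_mats_def mem_Collect_eq)
  then have "?tau \<in> H0_div (cell v)"
    unfolding H0_div_def using bm_L2[OF bmt] bm_L2[OF bm_continuous[OF gc]] weak green by blast
  moreover have "?tau \<in> sym_polys_on (Suc (Suc r)) (cell v)"
    unfolding sym_polys_on_def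
  proof (intro CollectI conjI allI)
    fix a b
    have "(\<lambda>x. tau x $ a $ b) \<in> polys (Suc (Suc r))"
      unfolding tau_def by (simp, intro polys_sum) (simp add: polys_scale c_polys mult.commute[of "c _ _ _"])
    moreover have "(\<lambda>x. ?tau x $ a $ b) = (\<lambda>x. if x \<in> cell v then tau x $ a $ b else 0)"
      by (rule ext) (simp add: tau_def c_def)
    ultimately show "(\<lambda>x. ?tau x $ a $ b) \<in> polys_on (Suc (Suc r)) (cell v)"
      unfolding polys_on_def by (intro CollectI exI[of _ "\<lambda>x. tau x $ a $ b"] conjI)
    show "?tau x \<in> sym_mats" for x using trans[of x] by (simp only: sym_mats_def mem_Collect_eq)
  qed
  ultimately show ?thesis unfolding bubble_div_def by blast
qed

lemma bubble_repr:
  assumes "tau \<in> bubble_div v (Suc r)"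
  obtains P where "\<And>i j. (\<lambda>x. P x $ i $ j) \<in> polys (Suc r)" "\<And>x. transpose (P x) = P x"
    "tau = (\<lambda>x. if x \<in> cell v then P x else 0)"
    "\<And>m x. m \<in> N \<Longrightarrow> x \<in> rface m \<Longrightarrow> P x *v grad m = 0"
proof -
  have H: "tau \<in> H0_div (cell v)" and S: "tau \<in> sym_polys_on (Suc r) (cell v)"
    using assms unfolding bubble_div_def by auto
  show ?thesis
  proof (rule sym_polys_on_repr[OF S])
    fix P assume P: "\<And>i j. (\<lambda>x. P x $ i $ j) \<in> polys (Suc r)" "\<And>x. transpose (P x) = P x"
      "tau = (\<lambda>x. if x \<in> cell v then P x else 0)"
    have "P x *v grad m = 0" if "m \<in> N" "x \<in> rface m" for m x
      using H P(1) _ that by (rule H0_trace) (simp add: P(3))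
    with P show ?thesis by (rule that)
  qed
qed

section \<open>Interior moments of trace-free fields\<close>

lemma cell_limit:
  fixes f :: "real^'n \<Rightarrow> 'b::real_normed_vector"
  assumes f: "continuous_on UNIV f" and x: "x \<in> cell v" and 0: "\<And>y. y \<in> icell \<Longrightarrow> f y = 0"
  shows "f x = 0"
proof -
  define y where "y = (\<lambda>n. x + inverse (real (Suc n)) *\<^sub>R (ctr - x))"
  have "(\<lambda>n. x + inverse (real (Suc n)) *\<^sub>R (ctr - x)) \<longlonglongrightarrow> x + 0 *\<^sub>R (ctr - x)"
    by (intro tendsto_intros LIMSEQ_inverse_real_of_nat)
  then have y: "y \<longlonglongrightarrow> x" by (simp only: y_def scaleR_zero_left add_0_right)
  have "y n \<in> icell" for n
    unfolding icell_def
  proof (intro CollectI ballI)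
    fix i assume i: "i \<in> N"
    define s where "s = inverse (real (Suc n))"
    have s: "0 < s" "s \<le> 1" unfolding s_def by (simp_all add: inverse_le_1_iff)
    have "bary v i (y n) = bary v i x + grad i \<bullet> (y n - x)" by (simp add: grad_diff)
    also have "grad i \<bullet> (y n - x) = s * (1 / (real CARD('n) + 1) - bary v i x)"
      unfolding y_def s_def using i by (simp only: add_diff_cancel_left' inner_scaleR_right grad_diff bary_center)
    finally have "bary v i (y n) = (1 - s) * bary v i x + s * (1 / (real CARD('n) + 1))"
      by (simp add: algebra_simps)
    moreover have "0 \<le> (1 - s) * bary v i x" using x i s unfolding cell_iff by simp
    moreover have "0 < s * (1 / (real CARD('n) + 1))" using s by (simp add: add_pos_pos)
    ultimately show "0 < bary v i (y n)" by linarith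
  qed
  then have "f (y n) = 0" for n by (rule 0)
  moreover have "(\<lambda>n. f (y n)) \<longlonglongrightarrow> f x"
    using f y by (intro continuous_on_tendsto_compose[of UNIV f y x]) auto
  ultimately show ?thesis by (simp add: LIMSEQ_const_iff)
qed


text \<open>The entries grad i . (P grad j) with i \<noteq> j vanish on facets i and j and so have
  the form \<lambda>_i \<lambda>_j s_ij. The s_ij have degree r and make up an admissible test
  tensor, whose moment is the integral of the sum of \<lambda>_i \<lambda>_j s_ij^2. By
  \<open>edge_decomp\<close> these entries determine P.\<close>

lemma trace_free_zero:
  assumes P: "\<And>i j. (\<lambda>x. P x $ i $ j) \<in> polys (Suc (Suc r))" "\<And>x. transpose (P x) = P x"
    "\<And>m x. m \<in> N \<Longrightarrow> x \<in> rface m \<Longrightarrow> P x *v grad m = 0"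
    and dof: "\<And>q. q \<in> sym_polys_on r (cell v) \<Longrightarrow> (LINT x|MC. P x \<bullet> q x) = 0"
    and x: "x \<in> icell"
  shows "P x = 0"
proof -
  \<comment> \<open>The implication allows \<open>s\<close> to be chosen for all pairs at once; its
    values at other pairs are never read.\<close>
  have "\<exists>s\<in>polys r. i \<in> N \<and> j \<in> N \<and> i \<noteq> j \<longrightarrow>
    (\<forall>x. grad i \<bullet> (P x *v grad j) = bary v i x * bary v j x * s x)" for i j
  proof (cases "i \<in> N \<and> j \<in> N \<and> i \<noteq> j")
    case True
    have z: "grad i \<bullet> (P x *v grad j) = 0" if "x \<in> rface j" for x
      using P(3)[of j x] True that by simp
    have z': "grad i \<bullet> (P x *v grad j) = 0" if "x \<in> rface i" for x
      using P(3)[of i x] True that transpose_inner_swap[OF P(2), of "grad i" x "grad j"] by simp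
    have "\<exists>s. s \<in> polys r \<and> (\<forall>x. grad i \<bullet> (P x *v grad j) = bary v i x * bary v j x * s x)"
      using poly_vanish_two_faces[of i j "\<lambda>x. grad i \<bullet> (P x *v grad j)" r] True
        polys_form[OF P(1)] z z' by metis
    then show ?thesis by blast
  next
    case False
    then show ?thesis using polys_one by blast
  qed
  then obtain s where s: "\<And>i j. s i j \<in> polys r"
    "\<And>i j x. i \<in> N \<Longrightarrow> j \<in> N \<Longrightarrow> i \<noteq> j \<Longrightarrow> grad i \<bullet> (P x *v grad j) = bary v i x * bary v j x * s i j x"
    by metis
  define Q where "Q x = (\<Sum>i\<in>N. \<Sum>j\<in>N - {i}. s i j x *\<^sub>R symm (grad i \<otimes>\<^sub>t grad j))" for x
  define q where "q = (\<lambda>x. if x \<in> cell v then Q x else 0)"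
  have Qs: "transpose (Q x) = Q x" for x
    unfolding Q_def transpose_sum transpose_scaleR transpose_symm ..
  have Qp: "(\<lambda>x. Q x $ a $ b) \<in> polys r" for a b
  proof -
    have "Q x $ a $ b = (\<Sum>i\<in>N. \<Sum>j\<in>N - {i}. symm (grad i \<otimes>\<^sub>t grad j) $ a $ b * s i j x)" for x
      unfolding Q_def by (simp add: mult.commute)
    then show ?thesis by (simp only:) (intro polys_sum polys_scale s(1))
  qed
  have "q \<in> sym_polys_on r (cell v)"
    unfolding sym_polys_on_def
  proof (intro CollectI conjI allI)
    fix a b
    have "(\<lambda>x. q x $ a $ b) = (\<lambda>x. if x \<in> cell v then Q x $ a $ b else 0)"
      unfolding q_def by (rule ext) simp
    then show "(\<lambda>x. q x $ a $ b) \<in> polys_on r (cell v)"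
      unfolding polys_on_def using Qp[of a b] by (intro CollectI exI[of _ "\<lambda>x. Q x $ a $ b"] conjI)
    show "q x \<in> sym_mats" for x
      unfolding q_def sym_mats_def using Qs by (simp add: transpose_def vec_eq_iff)
  qed
  then have int0: "(LINT x|MC. P x \<bullet> q x) = 0" by (rule dof)
  define f where "f x = (\<Sum>i\<in>N. \<Sum>j\<in>N - {i}. bary v i x * bary v j x * (s i j x)\<^sup>2)" for x
  have "(LINT x|MC. P x \<bullet> q x) = (LINT x|MC. f x)"
  proof (rule Bochner_Integration.integral_cong[OF refl])
    fix x assume "x \<in> space MC"
    then have "P x \<bullet> q x = P x \<bullet> Q x" by (simp add: q_def space_restrict_space)
    also have "\<dots> = (\<Sum>i\<in>N. \<Sum>j\<in>N - {i}. s i j x * (grad i \<bullet> (P x *v grad j)))"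
      unfolding Q_def inner_sum_right inner_scaleR_right inner_symm_tensor[OF P(2)] ..
    also have "\<dots> = f x"
      unfolding f_def by (intro sum.cong refl) (simp add: s(2) power2_eq_square)
    finally show "P x \<bullet> q x = f x" .
  qed
  then have f_int: "integral\<^sup>L MC f = 0" using int0 by simp
  have term_nonneg: "0 \<le> bary v i x * bary v j x * (s i j x)\<^sup>2" if "x \<in> cell v" "i \<in> N" "j \<in> N" for i j x
    using that unfolding cell_iff by simp
  have f_nonneg: "0 \<le> f x" if "x \<in> cell v" for x
    unfolding f_def using term_nonneg[OF that] by (intro sum_nonneg) simp
  have fc: "continuous_on UNIV f"
    unfolding f_def by (intro continuous_intros polys_continuous[OF s(1)])
  have xc: "x \<in> cell v" using x icell_subset by blast
  have "f x = 0" by (rule integral_zero_imp_zero[OF fc f_nonneg f_int x])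
  then have 1: "(\<Sum>j\<in>N - {i}. bary v i x * bary v j x * (s i j x)\<^sup>2) = 0" if "i \<in> N" for i
    unfolding f_def using term_nonneg[OF xc] that
    by (subst (asm) sum_nonneg_eq_0_iff) (auto intro!: sum_nonneg)
  have 2: "bary v i x * bary v j x * (s i j x)\<^sup>2 = 0" if "i \<in> N" "j \<in> N - {i}" for i j
  proof -
    have "\<forall>j\<in>N - {i}. bary v i x * bary v j x * (s i j x)\<^sup>2 = 0"
      using 1[OF that(1)] term_nonneg[OF xc that(1)] by (subst (asm) sum_nonneg_eq_0_iff) auto
    then show ?thesis using that(2) by blast
  qed
  have z: "(- (1/2) * (grad i \<bullet> (P x *v grad j))) *\<^sub>R (edge i j \<otimes>\<^sub>t edge i j) = 0"
    if "i \<in> N" "j \<in> N" for i j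
  proof (cases "i = j")
    case True
    then show ?thesis by (simp add: edge_self tensor_def vec_eq_iff)
  next
    case False
    have "bary v i x * bary v j x * s i j x = 0" using 2[of i j] that False by simp
    then show ?thesis using s(2)[OF that False] by simp
  qed
  show ?thesis by (subst edge_decomp[OF P(2)]) (intro sum.neutral ballI z)
qed

text \<open>The polynomial representatives are subtracted instead of the fields, so membership of
  the difference in the bubble space does not come up.\<close>

lemma bubble_unique:
  assumes tau: "tau \<in> bubble_div v (Suc (Suc r))" and tau': "tau' \<in> bubble_div v (Suc (Suc r))"
    and dof: "\<And>q. q \<in> sym_polys_on r (cell v) \<Longrightarrow> cell_dof v tau q = cell_dof v tau' q"
  shows "AE x in MC. tau x = tau' x"
proof (rule bubble_repr[OF tau], rule bubble_repr[OF tau'])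
  fix P P' assume P: "\<And>i j. (\<lambda>x. P x $ i $ j) \<in> polys (Suc (Suc r))" "\<And>x. transpose (P x) = P x"
    "tau = (\<lambda>x. if x \<in> cell v then P x else 0)"
    "\<And>m x. m \<in> N \<Longrightarrow> x \<in> rface m \<Longrightarrow> P x *v grad m = 0"
  assume P': "\<And>i j. (\<lambda>x. P' x $ i $ j) \<in> polys (Suc (Suc r))" "\<And>x. transpose (P' x) = P' x"
    "tau' = (\<lambda>x. if x \<in> cell v then P' x else 0)"
    "\<And>m x. m \<in> N \<Longrightarrow> x \<in> rface m \<Longrightarrow> P' x *v grad m = 0"
  define R where "R x = P x + (-1) *\<^sub>R P' x" for x
  have "R x = 0" if x: "x \<in> icell" for x
  proof (rule trace_free_zero[OF _ _ _ _ x])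
    show "(\<lambda>x. R x $ i $ j) \<in> polys (Suc (Suc r))" for i j
      unfolding R_def using polys_add[OF P(1)[of i j] polys_scale[OF P'(1)[of i j], of "-1"]] by simp
    show "transpose (R x) = R x" for x
      unfolding R_def transpose_add transpose_scaleR P(2) P'(2) ..
    show "R x *v grad m = 0" if "m \<in> N" "x \<in> rface m" for m x
      unfolding R_def mult_vec_add mult_vec_scaleR P(4)[OF that] P'(4)[OF that] by simp
    fix q assume q: "q \<in> sym_polys_on r (cell v)"
    have i: "integrable MC (\<lambda>x. P x \<bullet> q x)" "integrable MC (\<lambda>x. P' x \<bullet> q x)"
      by (intro bm_integrable bm_inner sym_polys_on_bm[OF q] bm_continuous
          polys_matrix_continuous[OF P(1)] polys_matrix_continuous[OF P'(1)])+
    have "cell_dof v tau q = (LINT x|MC. P x \<bullet> q x)" "cell_dof v tau' q = (LINT x|MC. P' x \<bullet> q x)"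
      unfolding cell_dof_def P(3) P'(3)
      by (intro Bochner_Integration.integral_cong[OF refl], simp add: space_restrict_space)+
    then show "(LINT x|MC. R x \<bullet> q x) = 0"
      using i dof[OF q] by (simp add: R_def inner_diff_left)
  qed
  then have eq: "P x = P' x" if "x \<in> icell" for x using that by (simp add: R_def)
  show ?thesis
    using AE_MC_icell by (rule eventually_mono) (simp add: P(3) P'(3) eq)
qed

text \<open>For the bubble with edge coefficients \<lambda>_i \<lambda>_j (t_ij . p t_ij), the
  interior moment against q is a symmetric form in p and q on the test space itself. It is definite
  by \<open>edge_tensors_separate\<close>, so the Riesz lemma solves for p. \<open>L\<close> is
  linear on the test space only, since it will contain an integral.\<close>

lemma bubble_exists:
  assumes Ladd: "\<And>p q. p \<in> sym_polys_on r (cell v) \<Longrightarrow> q \<in> sym_polys_on r (cell v) \<Longrightarrow> L (p + q) = L p + L q"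
    and Lscale: "\<And>c p. p \<in> sym_polys_on r (cell v) \<Longrightarrow> L (c *\<^sub>R p) = c * L p"
  obtains tau where "tau \<in> bubble_div v (Suc (Suc r))"
    "\<And>q. q \<in> sym_polys_on r (cell v) \<Longrightarrow> cell_dof v tau q = L q"
proof -
  let ?V = "sym_polys_on r (cell v)"
  define e where "e i j p x = edge i j \<bullet> (p x *v edge i j)" for i j and p :: "real^'n \<Rightarrow> real^'n^'n" and x
  define w where "w i j p q x = bary v i x * bary v j x * (e i j p x * e i j q x)" for i j p q x
  define B where "B p q = (\<Sum>i\<in>N. \<Sum>j\<in>N. integral\<^sup>L MC (w i j p q))" for p q
  have bme: "bm (e i j p)" if "p \<in> ?V" for i j p
    unfolding e_def[abs_def] by (intro bm_inner bm_const bm_mult_vec sym_polys_on_bm[OF that])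
  have wi: "integrable MC (w i j p q)" if "p \<in> ?V" "q \<in> ?V" for i j p q
    unfolding w_def[abs_def] using that
    by (intro bm_integrable bm_mult bme bm_continuous[OF continuous_bary])
  have w_comm: "w i j p q = w i j q p" for i j p q unfolding w_def[abs_def] by (simp add: mult_ac)
  have e_add: "e i j (p + q) x = e i j p x + e i j q x" for i j p q x
    by (simp add: e_def mult_vec_add inner_add_right)
  have e_scale: "e i j (c *\<^sub>R p) x = c * e i j p x" for i j p c x
    by (simp add: e_def mult_vec_scaleR)
  obtain S where S: "finite S" "S \<subseteq> ?V" "span S = ?V" by (rule sym_polys_on_finite)
  have "\<exists>p\<in>span S. \<forall>q\<in>span S. B p q = L q"
    using subspace_sym_polys_on[of r "cell v"] S(1,2)
  proof (rule riesz_finite_span)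
    show "B p q = B q p" for p q unfolding B_def by (simp add: w_comm[of _ _ p q])
  next
    fix p q z assume V: "p \<in> ?V" "q \<in> ?V" "z \<in> ?V"
    have "w i j (p + q) z = (\<lambda>x. w i j p z x + w i j q z x)" for i j
      by (rule ext) (simp add: w_def e_add algebra_simps)
    then show "B (p + q) z = B p z + B q z"
      unfolding B_def sum.distrib[symmetric] using wi V by simp
  next
    fix c p z assume V: "p \<in> ?V" "z \<in> ?V"
    have "w i j (c *\<^sub>R p) z = (\<lambda>x. c * w i j p z x)" for i j
      by (rule ext) (simp add: w_def e_scale algebra_simps)
    then show "B (c *\<^sub>R p) z = c * B p z"
      unfolding B_def sum_distrib_left by simp
  next
    fix p assume pV: "p \<in> ?V" and 0: "B p p = 0"
    show "p = 0"
    proof (rule sym_polys_on_repr[OF pV])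
      fix P assume P: "\<And>i j. (\<lambda>x. P x $ i $ j) \<in> polys r" "\<And>x. transpose (P x) = P x"
        "p = (\<lambda>x. if x \<in> cell v then P x else 0)"
      define f where "f i j x = bary v i x * bary v j x * (e i j P x)\<^sup>2" for i j x
      have ep: "(\<lambda>x. e i j P x) \<in> polys r" for i j
        unfolding e_def by (rule polys_form[OF P(1)])
      have fc: "continuous_on UNIV (f i j)" for i j
        unfolding f_def[abs_def] by (intro continuous_intros polys_continuous[OF ep])
      have f_nonneg: "0 \<le> f i j x" if "x \<in> cell v" "i \<in> N" "j \<in> N" for i j x
        using that unfolding cell_iff f_def by simp
      have wf: "integral\<^sup>L MC (w i j p p) = integral\<^sup>L MC (f i j)" for i j
        by (rule Bochner_Integration.integral_cong[OF refl])
          (simp add: space_restrict_space w_def f_def e_def P(3) power2_eq_square)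
      have int_nonneg: "0 \<le> integral\<^sup>L MC (f i j)" if "i \<in> N" "j \<in> N" for i j
        using f_nonneg that
        by (intro Bochner_Integration.integral_nonneg_AE AE_I2) (simp add: space_restrict_space)
      have "(\<Sum>i\<in>N. \<Sum>j\<in>N. integral\<^sup>L MC (f i j)) = 0" using 0 unfolding B_def wf .
      then have 1: "(\<Sum>j\<in>N. integral\<^sup>L MC (f i j)) = 0" if "i \<in> N" for i
        using int_nonneg that by (subst (asm) sum_nonneg_eq_0_iff) (auto intro!: sum_nonneg)
      have 2: "integral\<^sup>L MC (f i j) = 0" if "i \<in> N" "j \<in> N" for i j
        using 1[OF that(1)] int_nonneg that by (subst (asm) sum_nonneg_eq_0_iff) auto
      have P0: "P x = 0" if x: "x \<in> icell" for x
      proof (rule edge_tensors_separate[OF P(2)])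
        fix i j assume ij: "i \<in> N" "j \<in> N"
        have "f i j x = 0"
          using integral_zero_imp_zero[OF fc f_nonneg[OF _ ij] 2[OF ij] x] .
        moreover have "0 < bary v i x" "0 < bary v j x" using x ij unfolding icell_def by blast+
        ultimately have "e i j P x = 0" unfolding f_def by simp
        then show "edge i j \<bullet> (P x *v edge i j) = 0" unfolding e_def .
      qed
      \<comment> \<open>The field must vanish as a function, hence on the boundary of the cell as
        well.\<close>
      have "P x = 0" if "x \<in> cell v" for x
        using polys_matrix_continuous[OF P(1)] that P0 by (rule cell_limit)
      then show "p = 0" unfolding P(3) by (intro ext) simp
    qed
  qed (use Ladd Lscale in auto)
  then obtain p where p: "p \<in> ?V" "\<And>q. q \<in> ?V \<Longrightarrow> B p q = L q" unfolding S(3) by blast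
  show ?thesis
  proof (rule sym_polys_on_repr[OF p(1)])
    fix P assume P: "\<And>i j. (\<lambda>x. P x $ i $ j) \<in> polys r" "\<And>x. transpose (P x) = P x"
      "p = (\<lambda>x. if x \<in> cell v then P x else 0)"
    define tau where "tau = (\<lambda>x. if x \<in> cell v then (\<Sum>i\<in>N. \<Sum>j\<in>N.
      (bary v i x * bary v j x * e i j P x) *\<^sub>R (edge i j \<otimes>\<^sub>t edge i j)) else 0)"
    have "(\<lambda>x. e i j P x) \<in> polys r" for i j
      unfolding e_def by (rule polys_form[OF P(1)])
    then have "tau \<in> bubble_div v (Suc (Suc r))"
      unfolding tau_def by (rule bubble_mem[of "\<lambda>i j x. e i j P x"])
    moreover have "cell_dof v tau q = L q" if q: "q \<in> ?V" for q
    proof -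
      have "cell_dof v tau q = (LINT x|MC. (\<Sum>i\<in>N. \<Sum>j\<in>N. w i j p q x))"
        unfolding cell_dof_def
      proof (rule Bochner_Integration.integral_cong[OF refl])
        fix x assume "x \<in> space MC"
        then have x: "x \<in> cell v" by (simp add: space_restrict_space)
        have "tau x \<bullet> q x = (\<Sum>i\<in>N. \<Sum>j\<in>N. (bary v i x * bary v j x * e i j P x) * e i j q x)"
          using x unfolding tau_def e_def
          by (simp add: inner_sum_left inner_commute[of "_ \<otimes>\<^sub>t _"] inner_tensor)
        also have "\<dots> = (\<Sum>i\<in>N. \<Sum>j\<in>N. w i j p q x)"
          using x by (intro sum.cong refl) (simp add: w_def e_def P(3))
        finally show "tau x \<bullet> q x = (\<Sum>i\<in>N. \<Sum>j\<in>N. w i j p q x)" .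
      qed
      also have "\<dots> = (\<Sum>i\<in>N. \<Sum>j\<in>N. integral\<^sup>L MC (w i j p q))"
        using wi[OF p(1) q]
        by (subst Bochner_Integration.integral_sum, (intro Bochner_Integration.integrable_sum))
          (simp_all add: Bochner_Integration.integral_sum)
      also have "\<dots> = B p q" unfolding B_def ..
      also have "\<dots> = L q" by (rule p(2)[OF q])
      finally show ?thesis .
    qed
    ultimately show ?thesis by (rule that)
  qed
qed

end

section \<open>Integration over a facet\<close>

locale simplex_face = simplex v N for v :: "nat \<Rightarrow> real^'n" and N +
  fixes m :: nat and nu :: "real^'n"
  assumes m: "m \<in> N" and nu_norm: "norm nu = 1" and nu_normal: "nu \<in> normal_space v (N - {m})"
begin

abbreviation F :: "nat set" where "F \<equiv> N - {m}"
abbreviation p0 :: "real^'n" where "p0 \<equiv> v (Min F)"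
abbreviation height :: "real^'n \<Rightarrow> real" where "height y \<equiv> (y - p0) \<bullet> nu"
abbreviation pr :: "real^'n \<Rightarrow> real^'n" where "pr y \<equiv> y - height y *\<^sub>R nu"
abbreviation slab :: "(real^'n) set" where "slab \<equiv> {y. 0 \<le> height y \<and> height y \<le> 1}"

text \<open>Since the surface measure is the image of a slab of height one, facet integrals are
  volume integrals over this prism; null sets and open sets can then be handled in the full
  space.\<close>

definition prism :: "(real^'n) set" where "prism = {y \<in> slab. pr y \<in> face v F}"

definition fint :: "(real^'n \<Rightarrow> real) \<Rightarrow> real"
  where "fint f = (LINT x : face v F | hyperplane_measure p0 nu. f x)"

lemma Min_F: "Min F \<in> F"
proof -
  obtain j where "j \<in> N" "j \<noteq> m" by (rule obtain_other)
  then show ?thesis by (intro Min_in) auto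
qed

lemma nu_inner: "nu \<bullet> nu = 1"
  using nu_norm by (simp add: norm_eq_1)

text \<open>Only vertex m is off the facet, so the normal space is the line spanned by
  \<open>grad m\<close>. The sign of c reflects the orientation of \<open>nu\<close>, which is
  free.\<close>

lemma nu_grad: obtains c where "c \<noteq> 0" "nu = c *\<^sub>R grad m"
proof -
  have "N - F = {m}" using m by auto
  then have "nu = ((v m - p0) \<bullet> nu) *\<^sub>R grad m"
    using normal_repr[OF Diff_subset Min_F nu_normal] by simp
  moreover from this have "(v m - p0) \<bullet> nu \<noteq> 0" using nu_norm by (metis norm_zero scaleR_zero_left zero_neq_one)
  ultimately show ?thesis using that by blast
qed

lemma bary_p0: "bary v m p0 = 0"
  using Min_F by (simp add: bary_vertex)

lemma height_zero_iff: "bary v m x = 0 \<longleftrightarrow> height x = 0"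
proof -
  obtain c where c: "c \<noteq> 0" "nu = c *\<^sub>R grad m" by (rule nu_grad)
  have "height x = c * (grad m \<bullet> (x - p0))" by (simp add: c(2) inner_commute)
  also have "grad m \<bullet> (x - p0) = bary v m x" by (simp add: grad_diff bary_p0)
  finally show ?thesis using c(1) by simp
qed

lemma height_pr: "height (pr y) = 0"
  by (simp add: inner_diff_left nu_inner)

lemma bary_pr: "bary v m (pr y) = 0"
  unfolding height_zero_iff by (rule height_pr)

lemma pr_fixed: "bary v m x = 0 \<Longrightarrow> pr x = x"
  by (simp add: height_zero_iff)

lemma face_F_iff: "x \<in> face v F \<longleftrightarrow> (\<forall>i\<in>F. 0 \<le> bary v i x) \<and> bary v m x = 0"
proof -
  have "N - F = {m}" using m by auto
  then show ?thesis using face_iff[OF Diff_subset, of x "{m}"] m by (metis Diff_iff insertI1 order_refl singletonD)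
qed

lemma face_subset_cell: "face v F \<subseteq> cell v"
  using face_F_iff cell_iff by (metis Diff_iff order_refl singletonD subsetI)

lemma rface_subset: "rface m \<subseteq> face v F"
  unfolding rface_def face_F_iff[abs_def] by (auto simp: face_F_iff less_imp_le)

lemma continuous_pr: "continuous_on S pr"
  by (intro continuous_intros)

lemma face_closed: "closed (face v F)"
  using compact_face[OF Diff_subset] by (rule compact_imp_closed)

lemma slab_closed: "closed slab"
proof -
  have "slab = {y. 0 \<le> height y} \<inter> {y. height y \<le> 1}" by auto
  then show ?thesis
    by (simp only:) (intro closed_Int closed_Collect_le continuous_intros)
qed

lemma prism_closed: "closed prism"
proof -
  have "prism = slab \<inter> (pr -` face v F)" unfolding prism_def by auto
  moreover have "closed (pr -` face v F)"
    by (rule closed_vimage[OF face_closed continuous_pr])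
  ultimately show ?thesis using slab_closed by (simp only: closed_Int)
qed

lemma prism_bounded: "bounded prism"
proof -
  obtain B where B: "\<And>x. x \<in> cell v \<Longrightarrow> norm x \<le> B"
    using compact_imp_bounded[OF compact_cell] unfolding bounded_iff by blast
  have "norm y \<le> B + 1" if y: "y \<in> prism" for y
  proof -
    have "pr y \<in> cell v" and h: "\<bar>height y\<bar> \<le> 1"
      using y face_subset_cell unfolding prism_def by auto
    then have "norm (pr y) \<le> B" by (intro B)
    moreover have "norm y \<le> norm (pr y) + norm (height y *\<^sub>R nu)"
      using norm_triangle_ineq[of "pr y" "height y *\<^sub>R nu"] by simp
    moreover have "norm (height y *\<^sub>R nu) \<le> 1" using h nu_norm by simp
    ultimately show ?thesis by linarith
  qed
  then show ?thesis unfolding bounded_iff by blast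
qed

lemma fint_eq:
  assumes f: "f \<in> borel_measurable borel"
  shows "fint f = (LINT y|lborel. indicator prism y * f (pr y))"
proof -
  have s: "slab \<inter> space lborel \<in> sets lborel" using slab_closed by simp
  have prm: "pr \<in> borel_measurable (restrict_space lborel slab)"
    by (intro measurable_restrict_space1) (simp add: borel_measurable_continuous_onI continuous_pr)
  have fm: "(\<lambda>x. indicator (face v F) x *\<^sub>R f x) \<in> borel_measurable borel"
    using f face_closed by (intro borel_measurable_scaleR borel_measurable_indicator) simp_all
  have "fint f = integral\<^sup>L (distr (restrict_space lborel slab) borel pr) (\<lambda>x. indicator (face v F) x *\<^sub>R f x)"
    unfolding fint_def set_lebesgue_integral_def hyperplane_measure_def ..
  also have "\<dots> = integral\<^sup>L (restrict_space lborel slab) (\<lambda>y. indicator (face v F) (pr y) *\<^sub>R f (pr y))"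
    by (rule integral_distr[OF prm fm])
  also have "\<dots> = integral\<^sup>L lborel (\<lambda>y. indicator slab y *\<^sub>R (indicator (face v F) (pr y) *\<^sub>R f (pr y)))"
    by (rule integral_restrict_space[OF s])
  also have "(\<lambda>y. indicator slab y *\<^sub>R (indicator (face v F) (pr y) *\<^sub>R f (pr y)))
    = (\<lambda>y. indicator prism y * f (pr y))"
    by (intro ext) (simp add: prism_def indicator_def)
  finally show ?thesis .
qed

lemma prism_measurable:
  fixes f :: "real^'n \<Rightarrow> real"
  assumes "f \<in> borel_measurable borel"
  shows "(\<lambda>y. indicator prism y * f (pr y)) \<in> borel_measurable lborel"
proof -
  have "pr \<in> borel_measurable borel" by (rule borel_measurable_continuous_onI[OF continuous_pr])
  then have "(\<lambda>y. f (pr y)) \<in> borel_measurable borel" using assms by (rule measurable_compose)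
  moreover have "indicator prism \<in> borel_measurable borel"
    using prism_closed by (intro borel_measurable_indicator) simp
  ultimately have "(\<lambda>y. indicator prism y * f (pr y)) \<in> borel_measurable borel"
    by (rule borel_measurable_times[rotated])
  then show ?thesis by simp
qed

lemma prism_integrable:
  fixes f :: "real^'n \<Rightarrow> real"
  assumes f: "bm f"
  shows "integrable lborel (\<lambda>y. indicator prism y * f (pr y))"
proof -
  obtain B where B: "\<And>x. x \<in> cell v \<Longrightarrow> norm (f x) \<le> B"
    using f unfolding bm_def bounded_iff by blast
  have "integrable lborel (\<lambda>y. B * indicator prism y)"
    using prism_closed prism_bounded
    by (intro integrable_mult_right integrable_real_indicator emeasure_bounded_finite) simp_all
  then show ?thesis
  proof (rule Bochner_Integration.integrable_bound)
    show "(\<lambda>y. indicator prism y * f (pr y)) \<in> borel_measurable lborel"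
      using f by (intro prism_measurable) (simp only: bm_def)
    show "AE y in lborel. norm (indicator prism y * f (pr y)) \<le> norm (B * indicator prism y)"
    proof (rule AE_I2)
      fix y
      have "norm (f (pr y)) \<le> \<bar>B\<bar>" if "y \<in> prism"
      proof -
        have "pr y \<in> cell v" using that face_subset_cell unfolding prism_def by auto
        then show ?thesis using B[of "pr y"] by linarith
      qed
      then show "norm (indicator prism y * f (pr y)) \<le> norm (B * indicator prism y)"
        by (cases "y \<in> prism") simp_all
    qed
  qed
qed

lemma fint_add: "bm f \<Longrightarrow> bm g \<Longrightarrow> fint (\<lambda>x. f x + g x) = fint f + fint g"
proof -
  assume f: "bm f" and g: "bm g"
  have m: "h \<in> borel_measurable borel" if "bm h" for h :: "real^'n \<Rightarrow> real"
    using that by (simp only: bm_def)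
  have "fint (\<lambda>x. f x + g x) = (LINT y|lborel. indicator prism y * f (pr y) + indicator prism y * g (pr y))"
    unfolding fint_eq[OF m[OF bm_add[OF f g]]] by (simp add: distrib_left)
  also have "\<dots> = fint f + fint g"
    unfolding fint_eq[OF m[OF f]] fint_eq[OF m[OF g]]
    by (rule Bochner_Integration.integral_add[OF prism_integrable[OF f] prism_integrable[OF g]])
  finally show ?thesis .
qed

lemma fint_scale: "fint (\<lambda>x. c * f x) = c * fint f"
  unfolding fint_def by (simp add: set_lebesgue_integral_def mult.left_commute)

text \<open>Composed with the projection, \<lambda>_l is an affine function of y. It takes the value
  1 at v_l, so its zero set is a hyperplane or empty.\<close>

lemma negligible_facet_boundary:
  assumes l: "l \<in> F"
  shows "negligible {y. bary v l (pr y) = 0}"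
proof -
  define b where "b = grad l - (grad l \<bullet> nu) *\<^sub>R nu"
  define c where "c = bary v l 0 + (p0 \<bullet> nu) * (grad l \<bullet> nu)"
  have eq: "bary v l (pr y) = b \<bullet> y + c" for y
    unfolding bary_affine[of l "pr y"] b_def c_def
    by (simp add: inner_diff_left inner_diff_right algebra_simps inner_commute[of nu])
  have "bary v l (pr (v l)) = 1"
    using l m by (subst pr_fixed) (auto simp: bary_vertex)
  then have "b \<noteq> 0 \<or> - c \<noteq> 0" unfolding eq by auto
  then have "negligible {y. b \<bullet> y = - c}" by (rule negligible_hyperplane)
  moreover have "{y. b \<bullet> y = - c} = {y. bary v l (pr y) = 0}" unfolding eq by auto
  ultimately show ?thesis by simp
qed

text \<open>The relative boundary of the facet lifts to finitely many null sets. Hence the values on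
  interfaces between subcells do not influence facet integrals.\<close>

lemma AE_rface: "AE y in lborel. y \<in> prism \<longrightarrow> pr y \<in> rface m"
proof -
  have "AE y in lborel. bary v l (pr y) \<noteq> 0" if "l \<in> F" for l
  proof -
    have "{y. bary v l (pr y) = 0} \<in> null_sets lebesgue"
      using negligible_facet_boundary[OF that] by (simp add: negligible_iff_null_sets)
    then have "AE y in lebesgue. y \<notin> {y. bary v l (pr y) = 0}" by (rule AE_not_in)
    then show ?thesis unfolding AE_completion_iff by simp
  qed
  then have "AE y in lborel. \<forall>l\<in>F. bary v l (pr y) \<noteq> 0"
    by (intro AE_finite_allI) simp_all
  then show ?thesis
  proof (rule eventually_mono)
    fix y assume 0: "\<forall>l\<in>F. bary v l (pr y) \<noteq> 0"
    show "y \<in> prism \<longrightarrow> pr y \<in> rface m"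
    proof
      assume "y \<in> prism"
      then have "pr y \<in> face v F" unfolding prism_def by blast
      then have ge: "\<forall>i\<in>F. 0 \<le> bary v i (pr y)" unfolding face_F_iff by blast
      have "0 < bary v i (pr y)" if "i \<in> F" for i
        using ge 0 that by (metis order_le_less)
      then show "pr y \<in> rface m" unfolding rface_def using bary_pr by blast
    qed
  qed
qed

lemma fint_cong:
  assumes f: "f \<in> borel_measurable borel" and g: "g \<in> borel_measurable borel"
    and eq: "\<And>x. x \<in> rface m \<Longrightarrow> f x = g x"
  shows "fint f = fint g"
  unfolding fint_eq[OF f] fint_eq[OF g]
proof (rule integral_cong_AE[OF prism_measurable[OF f] prism_measurable[OF g]])
  show "AE y in lborel. indicator prism y * f (pr y) = indicator prism y * g (pr y)"
    using AE_rface by (rule eventually_mono) (auto simp: indicator_def eq)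
qed

text \<open>If f is nonzero at a point of the open facet, then f composed with the projection is
  nonzero on a nonempty open subset of the prism.\<close>

lemma fint_zero:
  assumes f: "continuous_on UNIV f" and ge: "\<And>x. x \<in> face v F \<Longrightarrow> 0 \<le> f x"
    and 0: "fint f = 0" and x: "x \<in> rface m"
  shows "f x = 0"
proof (rule ccontr)
  assume nz: "f x \<noteq> 0"
  have fm: "f \<in> borel_measurable borel" using f by (rule borel_measurable_continuous_onI)
  have "AE y in lborel. 0 \<le> indicator prism y * f (pr y)"
    using ge by (intro AE_I2) (simp add: indicator_def prism_def)
  then have ae: "AE y in lborel. indicator prism y * f (pr y) = 0"
    using 0 prism_integrable[OF bm_continuous[OF f]] unfolding fint_eq[OF fm]
    by (simp add: integral_nonneg_eq_0_iff_AE)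
  define U where "U = ({y. 0 < height y} \<inter> {y. height y < 1}) \<inter> (\<Inter>l\<in>F. {y. 0 < bary v l (pr y)})"
  define Z where "Z = U \<inter> (\<lambda>y. f (pr y)) -` (- {0})"
  have bc: "continuous_on UNIV (\<lambda>y. bary v l (pr y))" for l
    by (rule continuous_on_compose2[OF continuous_bary continuous_pr subset_UNIV])
  have fc: "continuous_on UNIV (\<lambda>y. f (pr y))"
    by (rule continuous_on_compose2[OF f continuous_pr subset_UNIV])
  have "open U"
    unfolding U_def
  proof (intro open_Int open_INT ballI)
    show "finite F" by simp
    show "open {y. 0 < height y}" "open {y. height y < 1}"
      by (intro open_Collect_less continuous_intros)+
    show "open {y. 0 < bary v l (pr y)}" for l
      by (intro open_Collect_less continuous_on_const bc)
  qed
  then have Zo: "open Z"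
    unfolding Z_def using fc by (intro continuous_open_preimage continuous_on_subset[OF fc]) auto
  have UP: "U \<subseteq> prism"
  proof
    fix y assume "y \<in> U"
    then have y: "0 < height y" "height y < 1" "\<forall>l\<in>F. 0 < bary v l (pr y)" unfolding U_def by auto
    then have "pr y \<in> face v F" unfolding face_F_iff using bary_pr[of y] less_imp_le by blast
    then show "y \<in> prism" unfolding prism_def using y by simp
  qed
  have "AE y in lebesgue. y \<notin> Z"
    unfolding AE_completion_iff using ae
    by (rule eventually_mono) (use UP in \<open>auto simp: Z_def indicator_def\<close>)
  moreover have "Z \<in> sets lebesgue" using Zo by (metis borel_open sets_completionI_sets sets_lborel)
  ultimately have "negligible Z" by (simp add: negligible_iff_null_sets AE_iff_null_sets)
  then have "Z = {}" using Zo open_not_negligible by blast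
  \<comment> \<open>Half the height of the slab puts the lifted point in the interior of the
    prism.\<close>
  moreover have "x + (1/2) *\<^sub>R nu \<in> Z"
  proof -
    have xm: "bary v m x = 0" using x unfolding rface_def by blast
    then have hx: "height x = 0" by (simp only: height_zero_iff)
    have h: "height (x + (1/2) *\<^sub>R nu) = 1/2"
    proof -
      have "height (x + (1/2) *\<^sub>R nu) = height x + (1/2) * (nu \<bullet> nu)"
        by (simp add: inner_diff_left inner_add_left)
      then show ?thesis using hx nu_inner by simp
    qed
    have pr: "pr (x + (1/2) *\<^sub>R nu) = x" unfolding h by simp
    have "\<forall>l\<in>F. 0 < bary v l x" using x unfolding rface_def by blast
    then show ?thesis unfolding Z_def U_def using nz by (simp add: h pr)
  qed
  ultimately show False by blast
qed

end

section \<open>Monomial expansions of the shape functions\<close>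

text \<open>Full support encodes the factor b_f: the scalar bubbles of f are spanned by these
  monomials. Every multi-index on a facet belongs to exactly one f, its support.\<close>

definition eidx :: "nat set \<Rightarrow> nat \<Rightarrow> (nat \<Rightarrow> nat) set"
  where "eidx f k = {a \<in> midx f k. \<forall>i\<in>f. a i \<noteq> 0}"

text \<open>Multiplication by b_f on the level of exponents; \<open>unshift\<close> is the inverse
  on exponents of full support.\<close>

definition shift :: "nat set \<Rightarrow> (nat \<Rightarrow> nat) \<Rightarrow> nat \<Rightarrow> nat"
  where "shift f b i = (if i \<in> f then b i + 1 else 0)"

definition unshift :: "(nat \<Rightarrow> nat) \<Rightarrow> nat \<Rightarrow> nat" where "unshift a i = a i - 1"

lemma finite_eidx [simp]: "finite f \<Longrightarrow> finite (eidx f k)"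
  by (simp add: eidx_def)

lemma mon_shift: "mon mu f (shift f b) x = (\<Prod>i\<in>f. mu i x) * mon mu f b x"
  unfolding mon_def prod.distrib[symmetric] by (rule prod.cong) (auto simp: shift_def)

lemma sum_shift: "finite f \<Longrightarrow> sum (shift f b) f = sum b f + card f"
proof -
  have "sum (shift f b) f = (\<Sum>i\<in>f. b i + 1)" by (rule sum.cong) (auto simp: shift_def)
  then show ?thesis by (simp only: sum.distrib) simp
qed

lemma unshift_shift: "b \<in> midx f r \<Longrightarrow> unshift (shift f b) = b"
  by (rule ext) (auto simp: unshift_def shift_def midx_def)

lemma shift_unshift: "a \<in> eidx f k \<Longrightarrow> shift f (unshift a) = a"
proof
  fix i assume "a \<in> eidx f k"
  then show "shift f (unshift a) i = a i"
    by (cases "i \<in> f") (simp_all add: unshift_def shift_def eidx_def midx_def)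
qed

lemma unshift_midx:
  assumes "finite f" and a: "a \<in> eidx f k"
  shows "card f \<le> k" and "unshift a \<in> midx f (k - card f)"
proof -
  have s: "sum (unshift a) f + card f = k"
    using sum_shift[OF assms(1), of "unshift a"] a unfolding shift_unshift[OF a]
    by (simp add: eidx_def midx_def)
  then show "card f \<le> k" by linarith
  have "unshift a i = 0" if "i \<notin> f" for i
    using a that by (simp add: unshift_def eidx_def midx_def)
  then show "unshift a \<in> midx f (k - card f)" using s by (auto simp: midx_def)
qed

lemma shift_bij: "finite f \<Longrightarrow> bij_betw (shift f) (midx f r) (eidx f (r + card f))"
proof (rule bij_betw_byWitness[where f'=unshift])
  assume f: "finite f"
  show "\<forall>b\<in>midx f r. unshift (shift f b) = b" using unshift_shift by blast
  show "\<forall>a\<in>eidx f (r + card f). shift f (unshift a) = a" using shift_unshift by blast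
  show "shift f ` midx f r \<subseteq> eidx f (r + card f)"
  proof (rule image_subsetI)
    fix b assume b: "b \<in> midx f r"
    then have "sum (shift f b) f = r + card f" unfolding sum_shift[OF f] by (simp add: midx_def)
    then show "shift f b \<in> eidx f (r + card f)" by (simp add: eidx_def midx_def shift_def)
  qed
  show "unshift ` eidx f (r + card f) \<subseteq> midx f r"
    using unshift_midx(2)[OF f, of _ "r + card f"] by auto
qed

lemma bubble_poly_expand:
  assumes f: "finite f" and p: "p \<in> hom_polys mu f (int k - int (card f))"
  obtains c where "\<And>x. (\<Prod>i\<in>f. mu i x) * p x = (\<Sum>a\<in>eidx f k. c a * mon mu f a x)"
proof (cases "k < card f")
  case True
  \<comment> \<open>The integer degree is negative and the space is zero. The truncated difference
    \<open>k - card f\<close> is used only in the other case.\<close>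
  then have "p = 0" using p hom_polys_neg[of "int k - int (card f)" mu f] by simp
  then show ?thesis by (intro that[of "\<lambda>_. 0"]) simp
next
  case False
  define r where "r = k - card f"
  have k: "k = r + card f" using False by (simp add: r_def)
  then have "int k - int (card f) = int r" by simp
  then obtain c where c: "p = (\<lambda>x. \<Sum>b\<in>midx f r. c b * mon mu f b x)"
    using p hom_polys_iff[OF f] by metis
  have "(\<Prod>i\<in>f. mu i x) * p x = (\<Sum>a\<in>eidx f k. c (unshift a) * mon mu f a x)" for x
  proof -
    have "(\<Sum>a\<in>eidx f k. c (unshift a) * mon mu f a x)
      = (\<Sum>b\<in>midx f r. c (unshift (shift f b)) * mon mu f (shift f b) x)"
      unfolding k by (rule sum.reindex_bij_betw[OF shift_bij[OF f], symmetric])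
    also have "\<dots> = (\<Sum>b\<in>midx f r. (\<Prod>i\<in>f. mu i x) * (c b * mon mu f b x))"
      by (intro sum.cong refl) (simp add: unshift_shift mon_shift)
    finally show ?thesis unfolding c by (simp add: sum_distrib_left)
  qed
  then show ?thesis by (rule that)
qed

lemma bubble_mon_factor:
  assumes f: "finite f" and a: "a \<in> eidx f k"
  obtains p where "p \<in> hom_polys mu f (int k - int (card f))"
    "\<And>x. mon mu f a x = (\<Prod>i\<in>f. mu i x) * p x"
proof
  have "int k - int (card f) = int (k - card f)" using unshift_midx(1)[OF f a] by simp
  then show "mon mu f (unshift a) \<in> hom_polys mu f (int k - int (card f))"
    using unshift_midx(2)[OF f a] by (simp only: hom_polys_eq_span) (intro span_base imageI)
  show "mon mu f a x = (\<Prod>i\<in>f. mu i x) * mon mu f (unshift a) x" for x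
    unfolding mon_shift[symmetric] shift_unshift[OF a] ..
qed

text \<open>Common normal form of both families: one parameter from \<open>W\<close> for each
  monomial, turned into a tensor field by \<open>e\<close>. For normal bubbles this field is
  constant, for the \<phi> bubbles it is constant on each open subcell.\<close>

definition combs ::
    "(nat \<Rightarrow> 'a \<Rightarrow> real) \<Rightarrow> nat set \<Rightarrow> nat \<Rightarrow> ('c::real_vector \<Rightarrow> 'a \<Rightarrow> 'b::real_vector) \<Rightarrow> 'c set \<Rightarrow> ('a \<Rightarrow> 'b) set"
  where "combs mu f k e W = {\<lambda>x. \<Sum>a\<in>eidx f k. mon mu f a x *\<^sub>R e (w a) x | w. \<forall>a. w a \<in> W}"

lemma subspace_combs:
  assumes W: "subspace W" and e: "linear e"
  shows "subspace (combs mu f k e W)"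
proof (rule subspaceI)
  show "0 \<in> combs mu f k e W"
    unfolding combs_def using subspace_0[OF W]
    by (intro CollectI exI[of _ "\<lambda>_. 0"] conjI) (auto simp: fun_eq_iff linear_0[OF e])
next
  fix p q assume "p \<in> combs mu f k e W" "q \<in> combs mu f k e W"
  then obtain w u where w: "p = (\<lambda>x. \<Sum>a\<in>eidx f k. mon mu f a x *\<^sub>R e (w a) x)" "\<forall>a. w a \<in> W"
    and u: "q = (\<lambda>x. \<Sum>a\<in>eidx f k. mon mu f a x *\<^sub>R e (u a) x)" "\<forall>a. u a \<in> W"
    unfolding combs_def by blast
  have "p + q = (\<lambda>x. \<Sum>a\<in>eidx f k. mon mu f a x *\<^sub>R e (w a + u a) x)"
    by (rule ext) (simp add: w u linear_add[OF e] scaleR_add_right sum.distrib)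
  moreover have "\<forall>a. w a + u a \<in> W" using w u subspace_add[OF W] by blast
  ultimately show "p + q \<in> combs mu f k e W"
    unfolding combs_def by (intro CollectI exI[of _ "\<lambda>a. w a + u a"] conjI)
next
  fix c p assume "p \<in> combs mu f k e W"
  then obtain w where w: "p = (\<lambda>x. \<Sum>a\<in>eidx f k. mon mu f a x *\<^sub>R e (w a) x)" "\<forall>a. w a \<in> W"
    unfolding combs_def by blast
  have "c *\<^sub>R p = (\<lambda>x. \<Sum>a\<in>eidx f k. mon mu f a x *\<^sub>R e (c *\<^sub>R w a) x)"
    by (rule ext) (simp add: w linear_scale[OF e] scaleR_sum_right mult.commute)
  moreover have "\<forall>a. c *\<^sub>R w a \<in> W" using w subspace_scale[OF W] by blast
  ultimately show "c *\<^sub>R p \<in> combs mu f k e W"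
    unfolding combs_def by (intro CollectI exI[of _ "\<lambda>a. c *\<^sub>R w a"] conjI)
qed

lemma generator_in_combs:
  assumes f: "finite f" and p: "p \<in> hom_polys mu f (int k - int (card f))"
    and W: "subspace W" and e: "linear e" and w: "w \<in> W"
  shows "(\<lambda>x. ((\<Prod>i\<in>f. mu i x) * p x) *\<^sub>R e w x) \<in> combs mu f k e W"
proof -
  obtain c where c: "\<And>x. (\<Prod>i\<in>f. mu i x) * p x = (\<Sum>a\<in>eidx f k. c a * mon mu f a x)"
    using bubble_poly_expand[OF f p] by metis
  have "(\<lambda>x. ((\<Prod>i\<in>f. mu i x) * p x) *\<^sub>R e w x)
    = (\<lambda>x. \<Sum>a\<in>eidx f k. mon mu f a x *\<^sub>R e (c a *\<^sub>R w) x)"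
    by (rule ext, simp only: c scaleR_sum_left linear_scale[OF e] scaleR_fun_apply scaleR_scaleR)
      (simp only: mult.commute)
  moreover have "\<forall>a. c a *\<^sub>R w \<in> W" using w subspace_scale[OF W] by blast
  ultimately show ?thesis unfolding combs_def by (intro CollectI exI[of _ "\<lambda>a. c a *\<^sub>R w"] conjI)
qed

definition anti :: "(nat \<Rightarrow> nat \<Rightarrow> real) set" where "anti = {a. \<forall>i j. a i j = - a j i}"

lemma subspace_anti: "subspace anti"
  unfolding subspace_def anti_def
proof (intro conjI ballI allI CollectI)
  fix a b :: "nat \<Rightarrow> nat \<Rightarrow> real" and i j
  assume "a \<in> {a. \<forall>i j. a i j = - a j i}" "b \<in> {a. \<forall>i j. a i j = - a j i}"
  then have "a i j = - a j i" "b i j = - b j i" by blast+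
  then show "(a + b) i j = - (a + b) j i" by simp
next
  fix c and a :: "nat \<Rightarrow> nat \<Rightarrow> real" and i j
  assume "a \<in> {a. \<forall>i j. a i j = - a j i}"
  then have "a i j = - a j i" by blast
  then show "(c *\<^sub>R a) i j = - (c *\<^sub>R a) j i" by simp
qed simp

context simplex
begin

lemma normal_rep:
  assumes f: "f \<subseteq> N"
  shows "bubble_normal v k f = combs (bary v) f k (\<lambda>A x. A) (normal_tensors v f)"
proof
  have fin: "finite f" using f finite_N by (rule finite_subset)
  have lin: "linear (\<lambda>(A::real^'n^'n) (x::real^'n). A)" by (rule linearI) (simp_all add: fun_eq_iff)
  show "bubble_normal v k f \<subseteq> combs (bary v) f k (\<lambda>A x. A) (normal_tensors v f)"
    unfolding bubble_normal_def
  proof (rule span_minimal[OF _ subspace_combs[OF subspace_normal_tensors lin]], rule subsetI)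
    fix u assume "u \<in> {\<lambda>x. ((\<Prod>i\<in>f. bary v i x) * p x) *\<^sub>R A | p A.
            p \<in> hom_polys (bary v) f (int k - int (card f)) \<and> A \<in> normal_tensors v f}"
    then obtain p A where "u = (\<lambda>x. ((\<Prod>i\<in>f. bary v i x) * p x) *\<^sub>R A)"
      "p \<in> hom_polys (bary v) f (int k - int (card f))" "A \<in> normal_tensors v f" by blast
    then show "u \<in> combs (bary v) f k (\<lambda>A x. A) (normal_tensors v f)"
      using generator_in_combs[OF fin _ subspace_normal_tensors lin] by blast
  qed
  show "combs (bary v) f k (\<lambda>A x. A) (normal_tensors v f) \<subseteq> bubble_normal v k f"
  proof
    fix u assume "u \<in> combs (bary v) f k (\<lambda>A x. A) (normal_tensors v f)"
    then obtain A where A: "u = (\<lambda>x. \<Sum>a\<in>eidx f k. mon (bary v) f a x *\<^sub>R A a)" "\<forall>a. A a \<in> normal_tensors v f"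
      unfolding combs_def by blast
    have "u = (\<Sum>a\<in>eidx f k. (\<lambda>x. mon (bary v) f a x *\<^sub>R A a))"
      by (rule ext) (simp add: A(1) sum_fun_apply)
    moreover have "(\<lambda>x. mon (bary v) f a x *\<^sub>R A a) \<in> bubble_normal v k f" if a: "a \<in> eidx f k" for a
    proof -
      obtain p where p: "p \<in> hom_polys (bary v) f (int k - int (card f))"
        "\<And>x. mon (bary v) f a x = (\<Prod>i\<in>f. bary v i x) * p x"
        using bubble_mon_factor[OF fin a] by metis
      show ?thesis unfolding bubble_normal_def p(2) using p(1) A(2) by (intro span_base) blast
    qed
    ultimately show "u \<in> bubble_normal v k f"
      unfolding bubble_normal_def by (simp only:) (intro span_sum)
  qed
qed

definition stens :: "nat \<Rightarrow> real^'n \<Rightarrow> real^'n^'n"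
  where "stens p y = symm ((ctr - v p) \<otimes>\<^sub>t y)"

lemma linear_stens: "linear (stens p)"
  by (rule linearI) (simp_all add: stens_def tensor_add_right tensor_scaleR_right symm_add symm_scaleR)

text \<open>A combination of the \<phi>_ij over pairs i < j, encoded by an antisymmetric matrix. On
  subcell m only row m is visible, which is the form that traces require.\<close>

definition phi_form :: "nat set \<Rightarrow> nat \<Rightarrow> (nat \<Rightarrow> nat \<Rightarrow> real) \<Rightarrow> real^'n \<Rightarrow> real^'n^'n"
  where "phi_form f p a x = (\<Sum>m\<in>N - f. indicator (subcell v m) x *\<^sub>R
    stens p (\<Sum>j\<in>N - f. a m j *\<^sub>R (v j - v p)))"

lemma linear_phi_form: "linear (phi_form f p)"
proof (rule linearI)
  fix a b
  show "phi_form f p (a + b) = phi_form f p a + phi_form f p b"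
    by (rule ext) (simp add: phi_form_def scaleR_add_left sum.distrib linear_add[OF linear_stens] scaleR_add_right)
next
  fix c :: real and a :: "nat \<Rightarrow> nat \<Rightarrow> real"
  show "phi_form f p (c *\<^sub>R a) = c *\<^sub>R phi_form f p a"
  proof
    fix x
    have "(\<Sum>j\<in>N - f. (c *\<^sub>R a) m j *\<^sub>R (v j - v p)) = c *\<^sub>R (\<Sum>j\<in>N - f. a m j *\<^sub>R (v j - v p))" for m
      by (simp add: scaleR_sum_right)
    then have "phi_form f p (c *\<^sub>R a) x = (\<Sum>m\<in>N - f. indicator (subcell v m) x *\<^sub>R
        stens p (c *\<^sub>R (\<Sum>j\<in>N - f. a m j *\<^sub>R (v j - v p))))"
      unfolding phi_form_def by (intro sum.cong refl) metis
    also have "\<dots> = (\<Sum>m\<in>N - f. c *\<^sub>R (indicator (subcell v m) x *\<^sub>R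
        stens p (\<Sum>j\<in>N - f. a m j *\<^sub>R (v j - v p))))"
      unfolding linear_scale[OF linear_stens] by (intro sum.cong refl) (rule scaleR_left_commute)
    also have "\<dots> = c *\<^sub>R phi_form f p a x"
      unfolding phi_form_def by (rule scaleR_sum_right[symmetric])
    finally show "phi_form f p (c *\<^sub>R a) x = (c *\<^sub>R phi_form f p a) x" by simp
  qed
qed

text \<open>A single generator corresponds to the elementary antisymmetric matrix E_ij -
  E_ji.\<close>

lemma phi_fun_form:
  assumes i: "i \<in> N - f" and j: "j \<in> N - f"
  shows "phi_fun v p i j = phi_form f p
    (\<lambda>m l. (if m = i \<and> l = j then 1 else 0) - (if m = j \<and> l = i then 1 else 0))" (is "_ = phi_form f p ?a")
proof
  fix x
  let ?t = "\<lambda>l. v l - v p"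
  have fin: "finite (N - f)" by simp
  have "(\<Sum>l\<in>N - f. ?a m l *\<^sub>R ?t l) = (if m = i then ?t j else 0) - (if m = j then ?t i else 0)" for m
  proof -
    have "(\<Sum>l\<in>N - f. ?a m l *\<^sub>R ?t l) = (\<Sum>l\<in>N - f. (if l = j then (if m = i then ?t j else 0) else 0)
        - (if l = i then (if m = j then ?t i else 0) else 0))"
      by (intro sum.cong refl) simp
    also have "\<dots> = (if m = i then ?t j else 0) - (if m = j then ?t i else 0)"
      unfolding sum_subtractf using i j fin by (simp only: sum.delta if_True)
    finally show ?thesis .
  qed
  then have "phi_form f p ?a x = (\<Sum>m\<in>N - f. (if m = i then indicator (subcell v i) x *\<^sub>R stens p (?t j) else 0)
      - (if m = j then indicator (subcell v j) x *\<^sub>R stens p (?t i) else 0))"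
    unfolding phi_form_def
    by (intro sum.cong refl) (simp add: linear_diff[OF linear_stens] linear_0[OF linear_stens] scaleR_diff_right)
  also have "\<dots> = indicator (subcell v i) x *\<^sub>R stens p (?t j) - indicator (subcell v j) x *\<^sub>R stens p (?t i)"
    unfolding sum_subtractf using i j fin by (simp only: sum.delta if_True)
  finally show "phi_fun v p i j x = phi_form f p ?a x"
    unfolding phi_fun_def stens_def by simp
qed

text \<open>The pairs (i, j) and (j, i) together give a_ij \<phi>_ij by antisymmetry, and the
  diagonal is zero.\<close>

lemma phi_form_expand:
  assumes a: "a \<in> anti"
  shows "phi_form f p a x = (\<Sum>i\<in>N - f. \<Sum>j\<in>N - f. if i < j then a i j *\<^sub>R phi_fun v p i j x else 0)"
proof -
  define X where "X i j = indicator (subcell v i) x *\<^sub>R stens p (v j - v p)" for i j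
  have aa: "a i j = - a j i" for i j using a unfolding anti_def by blast
  have diag: "a i i = 0" for i using aa[of i i] by simp
  have e: "(if i < j then a i j *\<^sub>R X i j else 0) + (if i < j then a j i *\<^sub>R X j i else 0)
      = (if i < j then a i j *\<^sub>R phi_fun v p i j x else 0)" for i j
  proof -
    have "a j i *\<^sub>R X j i = - (a i j *\<^sub>R X j i)" unfolding aa[of j i] by simp
    moreover have "phi_fun v p i j x = X i j - X j i" unfolding phi_fun_def X_def stens_def ..
    ultimately show ?thesis by (simp add: scaleR_diff_right)
  qed
  have sw: "(\<Sum>i\<in>N - f. \<Sum>j\<in>N - f. if j < i then a i j *\<^sub>R X i j else 0)
    = (\<Sum>i\<in>N - f. \<Sum>j\<in>N - f. if i < j then a j i *\<^sub>R X j i else 0)"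
    by (rule sum.swap)
  have X2: "a i j *\<^sub>R X i j = (if i < j then a i j *\<^sub>R X i j else 0) + (if j < i then a i j *\<^sub>R X i j else 0)" for i j
    by (cases i j rule: linorder_cases) (simp_all add: diag)
  have "phi_form f p a x = (\<Sum>i\<in>N - f. \<Sum>j\<in>N - f. a i j *\<^sub>R X i j)"
    unfolding phi_form_def X_def linear_sum[OF linear_stens] linear_scale[OF linear_stens] scaleR_sum_right
    by (simp add: mult.commute)
  also have "\<dots> = (\<Sum>i\<in>N - f. \<Sum>j\<in>N - f. (if i < j then a i j *\<^sub>R X i j else 0) + (if j < i then a i j *\<^sub>R X i j else 0))"
    by (rule sum.cong[OF refl], rule sum.cong[OF refl], rule X2)
  also have "\<dots> = (\<Sum>i\<in>N - f. \<Sum>j\<in>N - f. if i < j then a i j *\<^sub>R X i j else 0)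
      + (\<Sum>i\<in>N - f. \<Sum>j\<in>N - f. if j < i then a i j *\<^sub>R X i j else 0)"
    unfolding sum.distrib by (rule refl)
  also have "\<dots> = (\<Sum>i\<in>N - f. \<Sum>j\<in>N - f. if i < j then a i j *\<^sub>R X i j else 0)
      + (\<Sum>i\<in>N - f. \<Sum>j\<in>N - f. if i < j then a j i *\<^sub>R X j i else 0)"
    by (rule arg_cong[OF sw])
  also have "\<dots> = (\<Sum>i\<in>N - f. \<Sum>j\<in>N - f. (if i < j then a i j *\<^sub>R X i j else 0)
      + (if i < j then a j i *\<^sub>R X j i else 0))"
    unfolding sum.distrib by (rule refl)
  also have "\<dots> = (\<Sum>i\<in>N - f. \<Sum>j\<in>N - f. if i < j then a i j *\<^sub>R phi_fun v p i j x else 0)"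
    by (rule sum.cong[OF refl], rule sum.cong[OF refl], rule e)
  finally show ?thesis .
qed

lemma phi_rep:
  assumes f: "f \<subseteq> N"
  shows "bubble_phi v base k f = combs (baryR v) f k (phi_form f (base f)) anti"
proof
  have fin: "finite f" using f finite_N by (rule finite_subset)
  let ?p = "base f"
  let ?G = "{\<lambda>x. (\<Prod>m\<in>f. baryR v m x) *\<^sub>R phi_fun v ?p i j x | i j. i \<in> N - f \<and> j \<in> N - f \<and> i < j}"
  let ?h = "\<lambda>a x. (\<Prod>m\<in>f. baryR v m x) *\<^sub>R phi_form f ?p a x"
  have lin: "linear ?h"
    by (rule linearI) (simp_all add: fun_eq_iff linear_add[OF linear_phi_form] linear_scale[OF linear_phi_form]
        scaleR_add_right mult.commute)
  \<comment> \<open>The inner span in \<open>bubble_phi\<close> carries the factor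
    \<open>b\<^sub>f\<^sup>R\<close>; it is parametrised by antisymmetric matrices.\<close>
  have G: "span ?G \<subseteq> ?h ` anti"
  proof (rule span_minimal[OF _ linear_subspace_image[OF lin subspace_anti]], rule subsetI)
    fix u assume "u \<in> ?G"
    then obtain i j where ij: "u = (\<lambda>x. (\<Prod>m\<in>f. baryR v m x) *\<^sub>R phi_fun v ?p i j x)"
      "i \<in> N - f" "j \<in> N - f" by blast
    let ?a = "\<lambda>m l. (if m = i \<and> l = j then 1 else 0) - (if m = j \<and> l = i then 1 else 0) :: real"
    have "u = ?h ?a" unfolding ij(1) phi_fun_form[OF ij(2,3)] ..
    moreover have "?a \<in> anti" unfolding anti_def by (intro CollectI allI) (simp only: minus_diff_eq conj_commute)
    ultimately show "u \<in> ?h ` anti" by (rule image_eqI)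
  qed
  show "bubble_phi v base k f \<subseteq> combs (baryR v) f k (phi_form f ?p) anti"
    unfolding bubble_phi_def N_def[symmetric]
  proof (rule span_minimal[OF _ subspace_combs[OF subspace_anti linear_phi_form]], rule subsetI)
    fix u assume "u \<in> {\<lambda>x. p x *\<^sub>R w x | p w. p \<in> hom_polys (baryR v) f (int k - int (card f)) \<and> w \<in> span ?G}"
    then obtain p w where u: "u = (\<lambda>x. p x *\<^sub>R w x)" and p: "p \<in> hom_polys (baryR v) f (int k - int (card f))"
      and w: "w \<in> span ?G" by blast
    obtain a where a: "a \<in> anti" "w = ?h a" using w G by blast
    have "u = (\<lambda>x. ((\<Prod>i\<in>f. baryR v i x) * p x) *\<^sub>R phi_form f ?p a x)"
      unfolding u a(2) by (simp add: mult.commute)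
    then show "u \<in> combs (baryR v) f k (phi_form f ?p) anti"
      using generator_in_combs[OF fin p subspace_anti linear_phi_form a(1)] by simp
  qed
  show "combs (baryR v) f k (phi_form f ?p) anti \<subseteq> bubble_phi v base k f"
  proof
    fix u assume "u \<in> combs (baryR v) f k (phi_form f ?p) anti"
    then obtain w where w: "u = (\<lambda>x. \<Sum>a\<in>eidx f k. mon (baryR v) f a x *\<^sub>R phi_form f ?p (w a) x)"
      "\<forall>a. w a \<in> anti"
      unfolding combs_def by blast
    have hG: "?h b \<in> span ?G" if b: "b \<in> anti" for b
    proof -
      have "?h b = (\<Sum>i\<in>N - f. \<Sum>j\<in>N - f. if i < j then b i j *\<^sub>R (\<lambda>x. (\<Prod>m\<in>f. baryR v m x) *\<^sub>R phi_fun v ?p i j x) else 0)"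
      proof
        fix x
        show "?h b x = (\<Sum>i\<in>N - f. \<Sum>j\<in>N - f. if i < j then b i j *\<^sub>R (\<lambda>x. (\<Prod>m\<in>f. baryR v m x) *\<^sub>R phi_fun v ?p i j x) else 0) x"
          unfolding phi_form_expand[OF b] sum_fun_apply scaleR_sum_right
          by (intro sum.cong refl) (simp add: mult.commute)
      qed
      also have "\<dots> \<in> span ?G"
      proof (intro span_sum)
        fix i j assume "i \<in> N - f" "j \<in> N - f"
        then show "(if i < j then b i j *\<^sub>R (\<lambda>x. (\<Prod>m\<in>f. baryR v m x) *\<^sub>R phi_fun v ?p i j x) else 0) \<in> span ?G"
          by (cases "i < j") (auto intro!: span_scale span_zero intro: span_base)
      qed
      finally show ?thesis .
    qed
    have "u = (\<Sum>a\<in>eidx f k. (\<lambda>x. mon (baryR v) f a x *\<^sub>R phi_form f ?p (w a) x))"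
      by (rule ext) (simp add: w(1) sum_fun_apply)
    moreover have "(\<lambda>x. mon (baryR v) f a x *\<^sub>R phi_form f ?p (w a) x) \<in> bubble_phi v base k f"
      if a: "a \<in> eidx f k" for a
    proof -
      obtain p where p: "p \<in> hom_polys (baryR v) f (int k - int (card f))"
        "\<And>x. mon (baryR v) f a x = (\<Prod>i\<in>f. baryR v i x) * p x"
        using bubble_mon_factor[OF fin a] by metis
      have eq: "(\<lambda>x. mon (baryR v) f a x *\<^sub>R phi_form f ?p (w a) x) = (\<lambda>x. p x *\<^sub>R ?h (w a) x)"
        by (rule ext) (simp add: p(2) mult.commute)
      show ?thesis
        unfolding bubble_phi_def N_def[symmetric]
        by (rule span_base, rule CollectI, rule exI[of _ p], rule exI[of _ "?h (w a)"],
            rule conjI[OF eq conjI[OF p(1) hG[OF spec[OF w(2)]]]])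
    qed
    ultimately show "u \<in> bubble_phi v base k f"
      unfolding bubble_phi_def by (simp only:) (intro span_sum)
  qed
qed

end

section \<open>Polynomial traces and their facet moments\<close>

lemma continuous_mon: "(\<And>i. i \<in> f \<Longrightarrow> continuous_on S (mu i)) \<Longrightarrow> continuous_on S (mon mu f b)"
  unfolding mon_def[abs_def] by (intro continuous_on_prod continuous_on_power) simp

lemma polys_vec_continuous:
  fixes T :: "real^'n \<Rightarrow> real^'n"
  assumes "\<And>i. (\<lambda>x. T x $ i) \<in> polys r"
  shows "continuous_on S T"
proof -
  have "continuous_on S (\<lambda>x. \<chi> i. T x $ i)"
    by (intro continuous_on_vec_lambda polys_continuous[OF assms])
  then show ?thesis by (simp add: vec_nth_inverse)
qed

lemma restrict_vec_polys_on:
  assumes "\<And>i. (\<lambda>x. T x $ i) \<in> polys r"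
  shows "(\<lambda>x. if x \<in> D then T x else 0) \<in> vec_polys_on r D"
  unfolding vec_polys_on_def polys_on_def
proof (intro CollectI allI)
  fix i
  have "(\<lambda>x. (if x \<in> D then T x else 0) $ i) = (\<lambda>x. if x \<in> D then T x $ i else 0)"
    by (rule ext) simp
  then show "\<exists>p. (\<lambda>x. (if x \<in> D then T x else 0) $ i) = (\<lambda>x. if x \<in> D then p x else 0) \<and> p \<in> polys r"
    using assms[of i] by (intro exI[of _ "\<lambda>x. T x $ i"] conjI)
qed

context simplex_face
begin

lemma vec_polys_on_bm:
  assumes "q \<in> vec_polys_on r (face v F)"
  shows "bm q"
proof -
  have "\<exists>p\<in>polys r. (\<lambda>x. q x $ i) = (\<lambda>x. if x \<in> face v F then p x else 0)" for i
    using assms unfolding vec_polys_on_def polys_on_def by blast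
  then obtain p where p: "\<And>i. p i \<in> polys r" "\<And>i. (\<lambda>x. q x $ i) = (\<lambda>x. if x \<in> face v F then p i x else 0)"
    by metis
  have "bm (\<lambda>x. if x \<in> face v F then (\<chi> i. p i x) else 0)"
    using face_closed by (intro bm_if bm_continuous continuous_on_vec_lambda polys_continuous[OF p(1)]) simp
  moreover have "q = (\<lambda>x. if x \<in> face v F then (\<chi> i. p i x) else 0)"
  proof
    fix x
    have "q x $ i = (if x \<in> face v F then p i x else 0)" for i using fun_cong[OF p(2)] .
    then show "q x = (if x \<in> face v F then (\<chi> i. p i x) else 0)" by (simp add: vec_eq_iff)
  qed
  ultimately show ?thesis by simp
qed

lemma bm_borel: "bm f \<Longrightarrow> f \<in> borel_measurable borel"
  unfolding bm_def by (rule conjunct1)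

text \<open>The difference of the two traces, restricted to the facet, is itself an admissible test
  field.\<close>

lemma face_unique:
  fixes T T' :: "real^'n \<Rightarrow> real^'n"
  assumes T: "\<And>i. (\<lambda>x. T x $ i) \<in> polys r" and T': "\<And>i. (\<lambda>x. T' x $ i) \<in> polys r"
    and eq: "\<And>q. q \<in> vec_polys_on r (face v F) \<Longrightarrow> fint (\<lambda>x. T x \<bullet> q x) = fint (\<lambda>x. T' x \<bullet> q x)"
    and x: "x \<in> rface m"
  shows "T x = T' x"
proof -
  define R where "R x = T x + (-1) *\<^sub>R T' x" for x
  have R: "(\<lambda>x. R x $ i) \<in> polys r" for i
    unfolding R_def using polys_add[OF T[of i] polys_scale[OF T'[of i], of "-1"]] by simp
  define q where "q = (\<lambda>x. if x \<in> face v F then R x else 0)"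
  have q: "q \<in> vec_polys_on r (face v F)" unfolding q_def by (rule restrict_vec_polys_on[OF R])
  have c: "continuous_on UNIV T" "continuous_on UNIV T'" "continuous_on UNIV R"
    using polys_vec_continuous T T' R by blast+
  have b: "bm (\<lambda>x. T x \<bullet> q x)" "bm (\<lambda>x. T' x \<bullet> q x)"
    by (intro bm_inner bm_continuous c vec_polys_on_bm[OF q])+
  have "fint (\<lambda>x. R x \<bullet> R x) = fint (\<lambda>x. T x \<bullet> q x + (-1) * (T' x \<bullet> q x))"
  proof (rule fint_cong)
    show "(\<lambda>x. R x \<bullet> R x) \<in> borel_measurable borel"
      by (intro bm_borel bm_inner bm_continuous c)
    show "(\<lambda>x. T x \<bullet> q x + (-1) * (T' x \<bullet> q x)) \<in> borel_measurable borel"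
      by (intro bm_borel bm_add bm_mult bm_const b)
    fix x assume "x \<in> rface m"
    then have "q x = R x" using rface_subset unfolding q_def by auto
    then show "R x \<bullet> R x = T x \<bullet> q x + (-1) * (T' x \<bullet> q x)"
      by (simp add: R_def inner_diff_left)
  qed
  also have "\<dots> = fint (\<lambda>x. T x \<bullet> q x) + fint (\<lambda>x. (-1) * (T' x \<bullet> q x))"
    by (intro fint_add bm_mult bm_const b)
  also have "\<dots> = 0" unfolding fint_scale eq[OF q] by simp
  finally have "R x \<bullet> R x = 0"
    using x c(3) by (intro fint_zero[of "\<lambda>x. R x \<bullet> R x"]) (auto intro: continuous_on_inner)
  then show ?thesis by (simp add: R_def)
qed

text \<open>Riesz representation for the facet inner product. The representer is rewritten as a
  homogeneous polynomial in the coordinates of the facet, so that \<open>u\<close> can be matched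
  one multi-index at a time.\<close>

lemma face_exists:
  fixes L :: "(real^'n \<Rightarrow> real^'n) \<Rightarrow> real"
  assumes L: "linear L"
  obtains u where "\<And>q. q \<in> vec_polys_on (Suc r) (face v F) \<Longrightarrow>
    fint (\<lambda>x. (\<Sum>a\<in>midx F (Suc r). mon (bary v) F a x *\<^sub>R u a) \<bullet> q x) = L q"
proof -
  let ?V = "vec_polys_on (Suc r) (face v F)"
  have repr: "\<exists>R. (\<forall>i. (\<lambda>x. R x $ i) \<in> polys (Suc r)) \<and> p = (\<lambda>x. if x \<in> face v F then R x else 0)"
    if "p \<in> ?V" for p
  proof -
    have "\<exists>s\<in>polys (Suc r). (\<lambda>x. p x $ i) = (\<lambda>x. if x \<in> face v F then s x else 0)" for i
      using that unfolding vec_polys_on_def polys_on_def by blast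
    then obtain s where s: "\<And>i. s i \<in> polys (Suc r)" "\<And>i. (\<lambda>x. p x $ i) = (\<lambda>x. if x \<in> face v F then s i x else 0)"
      by metis
    have "p x = (if x \<in> face v F then (\<chi> i. s i x) else 0)" for x
    proof -
      have "p x $ i = (if x \<in> face v F then s i x else 0)" for i using fun_cong[OF s(2)] .
      then show ?thesis by (simp add: vec_eq_iff)
    qed
    then show ?thesis using s(1) by (intro exI[of _ "\<lambda>x. \<chi> i. s i x"]) auto
  qed
  obtain S where S: "finite S" "S \<subseteq> ?V" "span S = ?V" by (rule vec_polys_on_finite)
  let ?B = "\<lambda>p q. fint (\<lambda>x. p x \<bullet> q x)"
  have "\<exists>p\<in>span S. \<forall>q\<in>span S. ?B p q = L q"
    using subspace_vec_polys_on[of "Suc r" "face v F"] S(1,2)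
  proof (rule riesz_finite_span)
    show "?B p q = ?B q p" for p q by (simp add: inner_commute)
  next
    fix p q z assume "p \<in> ?V" "q \<in> ?V" "z \<in> ?V"
    then show "?B (p + q) z = ?B p z + ?B q z"
      by (simp add: inner_add_left fint_add bm_inner vec_polys_on_bm)
  next
    show "?B (c *\<^sub>R p) z = c * ?B p z" for c p z by (simp add: fint_scale)
  next
    fix p assume pV: "p \<in> ?V" and 0: "?B p p = 0"
    obtain R where R: "\<And>i. (\<lambda>x. R x $ i) \<in> polys (Suc r)" "p = (\<lambda>x. if x \<in> face v F then R x else 0)"
      using repr[OF pV] by blast
    have c: "continuous_on UNIV R" by (rule polys_vec_continuous[OF R(1)])
    have "fint (\<lambda>x. R x \<bullet> R x) = ?B p p"
    proof (rule fint_cong)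
      show "(\<lambda>x. R x \<bullet> R x) \<in> borel_measurable borel" "(\<lambda>x. p x \<bullet> p x) \<in> borel_measurable borel"
        by (intro bm_borel bm_inner bm_continuous c vec_polys_on_bm[OF pV])+
      fix x assume "x \<in> rface m"
      then show "R x \<bullet> R x = p x \<bullet> p x" using rface_subset unfolding R(2) by auto
    qed
    then have R0: "R x = 0" if "x \<in> rface m" for x
      using fint_zero[of "\<lambda>x. R x \<bullet> R x" x] that c 0 by (simp add: continuous_on_inner)
    \<comment> \<open>Vanishing is known on the open facet; the factor \<lambda>_m carries it to the
      relative boundary.\<close>
    have "R x $ i = 0" if x: "x \<in> face v F" for x i
    proof -
      obtain s where "\<And>x. R x $ i = bary v m x * s x"
        using poly_vanish_face[OF m R(1)[of i]] R0 by (metis zero_index)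
      then show ?thesis using x unfolding face_F_iff by simp
    qed
    then show "p = 0" unfolding R(2) by (intro ext) (simp add: vec_eq_iff)
  qed (use L in \<open>auto simp: linear_add linear_scale\<close>)
  then obtain p where p: "p \<in> ?V" "\<And>q. q \<in> ?V \<Longrightarrow> ?B p q = L q" unfolding S(3) by blast
  obtain R where R: "\<And>i. (\<lambda>x. R x $ i) \<in> polys (Suc r)" "p = (\<lambda>x. if x \<in> face v F then R x else 0)"
    using repr[OF p(1)] by blast
  have fin: "finite F" by simp
  have "\<exists>c. \<forall>x. bary v m x = 0 \<longrightarrow> R x $ i = (\<Sum>a\<in>midx F (Suc r). c a * mon (bary v) F a x)" for i
  proof -
    obtain q s where q: "q \<in> hom_polys (bary v) F (int (Suc r))" "\<And>x. R x $ i = q x + bary v m x * s x"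
      using poly_split_face[OF m R(1)[of i]] by metis
    then show ?thesis using hom_polys_iff[OF fin, of q "bary v" "Suc r"] by auto
  qed
  then obtain c where c: "\<And>i x. bary v m x = 0 \<Longrightarrow> R x $ i = (\<Sum>a\<in>midx F (Suc r). c i a * mon (bary v) F a x)"
    by metis
  define u where "u a = (\<chi> i. c i a)" for a
  define U where "U x = (\<Sum>a\<in>midx F (Suc r). mon (bary v) F a x *\<^sub>R u a)" for x
  have mon_poly: "mon (bary v) F a \<in> polys (sum a F)" for a by (rule mon_in_polys[OF fin bary_in_polys])
  have Uc: "continuous_on UNIV U"
    unfolding U_def by (intro continuous_intros polys_continuous[OF mon_poly])
  have UR: "U x = R x" if "bary v m x = 0" for x
    using c[OF that] by (simp add: vec_eq_iff U_def u_def mult.commute)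
  show ?thesis
  proof (rule that[of u])
    fix q assume q: "q \<in> ?V"
    have "fint (\<lambda>x. U x \<bullet> q x) = ?B p q"
    proof (rule fint_cong)
      show "(\<lambda>x. U x \<bullet> q x) \<in> borel_measurable borel" "(\<lambda>x. p x \<bullet> q x) \<in> borel_measurable borel"
        by (intro bm_borel bm_inner bm_continuous Uc vec_polys_on_bm[OF p(1)] vec_polys_on_bm[OF q])+
      fix x assume x: "x \<in> rface m"
      then have "U x = R x" by (intro UR) (simp add: rface_def)
      then show "U x \<bullet> q x = p x \<bullet> q x" using x rface_subset unfolding R(2) by auto
    qed
    then show "fint (\<lambda>x. (\<Sum>a\<in>midx F (Suc r). mon (bary v) F a x *\<^sub>R u a) \<bullet> q x) = L q"
      unfolding U_def using p(2)[OF q] by simp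
  qed
qed

end

section \<open>Traces of the nodal part\<close>

text \<open>Writing k = \<open>Suc r\<close> makes r the degree of the interior moments and
  \<open>Suc (Suc r)\<close> that of the bubbles.\<close>

locale stress_element = simplex v N for v :: "nat \<Rightarrow> real^'n" and N +
  fixes base :: "nat set \<Rightarrow> nat" and k r :: nat
  assumes base: "\<And>f. f \<subseteq> N \<Longrightarrow> f \<noteq> {} \<Longrightarrow> base f \<in> f" and k: "k = Suc r"
begin

definition faces :: "nat set set" where "faces = {f. f \<subseteq> N \<and> f \<noteq> {} \<and> f \<noteq> N}"

lemma finite_faces [simp]: "finite faces"
  by (rule finite_subset[of _ "Pow N"]) (auto simp: faces_def)

lemma facesD: "f \<in> faces \<Longrightarrow> f \<subseteq> N" "f \<in> faces \<Longrightarrow> base f \<in> f" "f \<in> faces \<Longrightarrow> finite f"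
  using base finite_subset[OF _ finite_N] by (auto simp: faces_def)

definition valid :: "(nat set \<Rightarrow> (nat \<Rightarrow> nat) \<Rightarrow> real^'n^'n) \<Rightarrow> (nat set \<Rightarrow> (nat \<Rightarrow> nat) \<Rightarrow> nat \<Rightarrow> nat \<Rightarrow> real) \<Rightarrow> bool"
  where "valid A a \<longleftrightarrow> (\<forall>f\<in>faces. \<forall>b. A f b \<in> normal_tensors v f \<and> a f b \<in> anti)"

definition nfield :: "(nat set \<Rightarrow> (nat \<Rightarrow> nat) \<Rightarrow> real^'n^'n) \<Rightarrow> nat set \<Rightarrow> real^'n \<Rightarrow> real^'n^'n"
  where "nfield A f = (\<lambda>x. \<Sum>b\<in>eidx f k. mon (bary v) f b x *\<^sub>R A f b)"

definition pfield :: "(nat set \<Rightarrow> (nat \<Rightarrow> nat) \<Rightarrow> nat \<Rightarrow> nat \<Rightarrow> real) \<Rightarrow> nat set \<Rightarrow> real^'n \<Rightarrow> real^'n^'n"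
  where "pfield a f = (\<lambda>x. \<Sum>b\<in>eidx f k. mon (baryR v) f b x *\<^sub>R phi_form f (base f) (a f b) x)"

definition nodal :: "(nat set \<Rightarrow> (nat \<Rightarrow> nat) \<Rightarrow> real^'n^'n) \<Rightarrow> (nat set \<Rightarrow> (nat \<Rightarrow> nat) \<Rightarrow> nat \<Rightarrow> nat \<Rightarrow> real) \<Rightarrow>
    real^'n \<Rightarrow> real^'n^'n"
  where "nodal A a x = (\<Sum>f\<in>faces. nfield A f x + pfield a f x)"

text \<open>The value of \<open>phi_form\<close> on the open subcell m. It is zero for m in f
  because the \<phi>_ij live on subcells with index off f.\<close>

definition jump :: "(nat set \<Rightarrow> (nat \<Rightarrow> nat) \<Rightarrow> nat \<Rightarrow> nat \<Rightarrow> real) \<Rightarrow> nat set \<Rightarrow> (nat \<Rightarrow> nat) \<Rightarrow> nat \<Rightarrow> real^'n^'n"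
  where "jump a f b m = (if m \<in> f then 0
    else stens (base f) (\<Sum>j\<in>N - f. a f b m j *\<^sub>R (v j - v (base f))))"

text \<open>The polynomial field that agrees with \<open>nodal A a\<close> on the subcell opposite to vertex \<open>m\<close>.\<close>

definition branch :: "nat \<Rightarrow> (nat set \<Rightarrow> (nat \<Rightarrow> nat) \<Rightarrow> real^'n^'n) \<Rightarrow>
    (nat set \<Rightarrow> (nat \<Rightarrow> nat) \<Rightarrow> nat \<Rightarrow> nat \<Rightarrow> real) \<Rightarrow> real^'n \<Rightarrow> real^'n^'n"
  where "branch m A a x = (\<Sum>f\<in>faces. (\<Sum>b\<in>eidx f k. mon (bary v) f b x *\<^sub>R A f b)
    + (\<Sum>b\<in>eidx f k. mon (\<lambda>i y. bary v i y - bary v m y) f b x *\<^sub>R jump a f b m))"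

text \<open>In a point of subcell m alone all other characteristic functions vanish, and the nodal
  functions are \<lambda>_i - \<lambda>_m.\<close>

lemma nodal_branch:
  assumes m: "m \<in> N" and sub: "\<And>j. j \<in> N \<Longrightarrow> x \<in> subcell v j \<longleftrightarrow> j = m"
  shows "nodal A a x = branch m A a x"
proof -
  have xm: "x \<in> subcell v m" using sub[OF m] by simp
  have "pfield a f x = (\<Sum>b\<in>eidx f k. mon (\<lambda>i y. bary v i y - bary v m y) f b x *\<^sub>R jump a f b m)"
    if f: "f \<in> faces" for f
    unfolding pfield_def
  proof (rule sum.cong[OF refl])
    fix b
    have "mon (baryR v) f b x = mon (\<lambda>i y. bary v i y - bary v m y) f b x"
      unfolding mon_def
    proof (rule prod.cong[OF refl])
      fix i assume "i \<in> f"
      then have "i \<in> N" using facesD(1)[OF f] by blast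
      then show "baryR v i x ^ b i = (bary v i x - bary v m x) ^ b i"
        using baryR_subcell[OF _ m xm] by simp
    qed
    moreover have "phi_form f (base f) (a f b) x = jump a f b m"
    proof -
      let ?s = "\<lambda>l. stens (base f) (\<Sum>j\<in>N - f. a f b l j *\<^sub>R (v j - v (base f)))"
      have "phi_form f (base f) (a f b) x = (\<Sum>l\<in>N - f. if l = m then ?s m else 0)"
        unfolding phi_form_def by (intro sum.cong refl) (simp add: sub indicator_def)
      then show ?thesis using m by (simp add: jump_def)
    qed
    ultimately show "mon (baryR v) f b x *\<^sub>R phi_form f (base f) (a f b) x
      = mon (\<lambda>i y. bary v i y - bary v m y) f b x *\<^sub>R jump a f b m" by simp
  qed
  then show ?thesis unfolding nodal_def branch_def nfield_def by (intro sum.cong refl) simp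
qed

lemma rface_subcell:
  assumes x: "x \<in> rface m" and m: "m \<in> N" and j: "j \<in> N"
  shows "x \<in> subcell v j \<longleftrightarrow> j = m"
proof -
  have z: "bary v m x = 0" and pos: "\<And>i. i \<in> N \<Longrightarrow> i \<noteq> m \<Longrightarrow> 0 < bary v i x"
    using x unfolding rface_def by auto
  have ge: "\<forall>i\<in>N. 0 \<le> bary v i x" using z pos by (metis order_le_less)
  show ?thesis
  proof
    assume "x \<in> subcell v j"
    then have "bary v j x \<le> 0" using j m z unfolding subcell_iff[OF j] by metis
    then show "j = m" using pos[OF j] by (metis not_le)
  next
    assume "j = m"
    then show "x \<in> subcell v j" using ge z m by (simp add: subcell_iff cell_iff)
  qed
qed

lemma continuous_branch: "continuous_on S (branch m A a)"
  unfolding branch_def[abs_def]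
  by (intro continuous_on_sum continuous_on_add continuous_on_scaleR continuous_mon
      continuous_on_const continuous_bary continuous_on_diff)

definition supp :: "(nat \<Rightarrow> nat) \<Rightarrow> nat set" where "supp b = {i \<in> N. b i \<noteq> 0}"

text \<open>The face is recovered as the support of the multi-index, so the coefficient of a
  monomial in the trace involves a single face.\<close>

definition tcoef where "tcoef A a m b = face_trace (supp b) (base (supp b)) (A (supp b) b) (a (supp b) b) m"

definition tpoly where "tpoly A a m x = (\<Sum>b\<in>midx (N - {m}) k. mon (bary v) (N - {m}) b x *\<^sub>R tcoef A a m b)"

lemma eidx_supp: "f \<in> faces \<Longrightarrow> b \<in> eidx f k \<Longrightarrow> supp b = f"
  using facesD(1) by (auto simp: supp_def eidx_def midx_def)

lemma eidx_midx:
  assumes f: "f \<in> faces" and m: "m \<notin> f" and b: "b \<in> eidx f k"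
  shows "b \<in> midx (N - {m}) k"
proof -
  have "f \<subseteq> N - {m}" using facesD(1)[OF f] m by blast
  then have "sum b (N - {m}) = sum b f"
    using b by (intro sum.mono_neutral_right) (auto simp: eidx_def midx_def)
  then show ?thesis using b \<open>f \<subseteq> N - {m}\<close> by (auto simp: eidx_def midx_def)
qed

lemma midx_supp:
  assumes m: "m \<in> N" and b: "b \<in> midx (N - {m}) k"
  shows "supp b \<in> faces" and "m \<notin> supp b" and "b \<in> eidx (supp b) k"
proof -
  have sub: "supp b \<subseteq> N - {m}" using b by (auto simp: supp_def midx_def)
  then show ms: "m \<notin> supp b" by blast
  have s: "sum b (supp b) = sum b (N - {m})"
    using sub by (intro sum.mono_neutral_left) (auto simp: supp_def)
  then have sk: "sum b (supp b) = k" using b by (simp add: midx_def)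
  \<comment> \<open>The degree is positive, so the support is a genuine face.\<close>
  then have "supp b \<noteq> {}" using k by auto
  then show "supp b \<in> faces" using sub ms m unfolding faces_def by blast
  show "b \<in> eidx (supp b) k" using sk b by (auto simp: eidx_def midx_def supp_def)
qed

text \<open>The multi-indices on facet m are partitioned by their supports, which are faces avoiding
  m.\<close>

lemma sum_over_faces:
  assumes m: "m \<in> N"
  shows "(\<Sum>f\<in>{f \<in> faces. m \<notin> f}. \<Sum>b\<in>eidx f k. h f b) = (\<Sum>b\<in>midx (N - {m}) k. h (supp b) b)"
proof -
  have "(\<Sum>f\<in>{f \<in> faces. m \<notin> f}. \<Sum>b\<in>eidx f k. h f b)
    = (\<Sum>(f, b)\<in>(SIGMA f:{f \<in> faces. m \<notin> f}. eidx f k). h f b)"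
    by (rule sum.Sigma) (simp_all add: facesD(3))
  also have "\<dots> = (\<Sum>b\<in>midx (N - {m}) k. h (supp b) b)"
    by (rule sum.reindex_bij_witness[where i="\<lambda>b. (supp b, b)" and j=snd])
      (auto simp: eidx_supp eidx_midx midx_supp[OF m])
  finally show ?thesis .
qed

text \<open>Of the two halves of the symmetrised product, one carries the factor a_mm = 0; the other
  keeps the edge combination with factor (ctr - v_p) . grad m = 1/(d + 1).\<close>

lemma stens_trace:
  assumes f: "f \<subseteq> N" and p: "p \<in> f" and m: "m \<in> N - f" and a: "a \<in> anti"
  shows "stens p (\<Sum>j\<in>N - f. a m j *\<^sub>R (v j - v p)) *v grad m
    = (1 / (2 * (real CARD('n) + 1))) *\<^sub>R (\<Sum>j\<in>N - f. a m j *\<^sub>R (v j - v p))"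
proof -
  let ?y = "\<Sum>j\<in>N - f. a m j *\<^sub>R (v j - v p)"
  have "a m m = - a m m" using a unfolding anti_def by blast
  then have "?y \<bullet> grad m = 0" using grad_sum_edges[OF f p m, of "a m"] by (simp add: inner_commute)
  moreover have "(ctr - v p) \<bullet> grad m = 1 / (real CARD('n) + 1)"
    using f p m by (subst inner_commute) (auto simp: grad_diff bary_center bary_vertex)
  ultimately show ?thesis unfolding stens_def symm_tensor_mult by simp
qed

text \<open>Where \<lambda>_m = 0 the shifted coordinates agree with the original ones, so both
  families share the same monomials. Faces through m contribute nothing, as their monomials contain
  \<lambda>_m.\<close>

lemma branch_trace:
  assumes m: "m \<in> N" and val: "valid A a" and x: "bary v m x = 0"
  shows "branch m A a x *v grad m = tpoly A a m x"
proof -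
  let ?h = "\<lambda>f b. mon (bary v) f b x *\<^sub>R face_trace f (base f) (A f b) (a f b) m"
  have "branch m A a x *v grad m = (\<Sum>f\<in>faces. if m \<notin> f then (\<Sum>b\<in>eidx f k. ?h f b) else 0)"
    unfolding branch_def mult_vec_sum
  proof (rule sum.cong[OF refl])
    fix f assume f: "f \<in> faces"
    have mon: "mon (\<lambda>i y. bary v i y - bary v m y) f b x = mon (bary v) f b x" for b
      unfolding mon_def by (simp add: x)
    have "((\<Sum>b\<in>eidx f k. mon (bary v) f b x *\<^sub>R A f b)
      + (\<Sum>b\<in>eidx f k. mon (\<lambda>i y. bary v i y - bary v m y) f b x *\<^sub>R jump a f b m)) *v grad m
      = (\<Sum>b\<in>eidx f k. mon (bary v) f b x *\<^sub>R (A f b *v grad m + jump a f b m *v grad m))"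
      unfolding mon mult_vec_add mult_vec_sum mult_vec_scaleR by (simp add: sum.distrib scaleR_add_right)
    also have "\<dots> = (if m \<notin> f then (\<Sum>b\<in>eidx f k. ?h f b) else 0)"
    proof (cases "m \<in> f")
      case True
      have "mon (bary v) f b x = 0" if b: "b \<in> eidx f k" for b
      proof -
        have "b m \<noteq> 0" using b True by (simp add: eidx_def)
        then have "bary v m x ^ b m = 0" by (simp add: x)
        then show ?thesis unfolding mon_def using True facesD(3)[OF f] by (intro prod_zero) auto
      qed
      then show ?thesis using True by simp
    next
      case False
      have "jump a f b m *v grad m
        = (1 / (2 * (real CARD('n) + 1))) *\<^sub>R (\<Sum>j\<in>N - f. a f b m j *\<^sub>R (v j - v (base f)))" for b
        using False m val f unfolding jump_def valid_def
        by (simp only: if_False) (intro stens_trace facesD(1,2) DiffI; blast)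
      then show ?thesis using False by (simp add: face_trace_def)
    qed
    finally show "((\<Sum>b\<in>eidx f k. mon (bary v) f b x *\<^sub>R A f b)
      + (\<Sum>b\<in>eidx f k. mon (\<lambda>i y. bary v i y - bary v m y) f b x *\<^sub>R jump a f b m)) *v grad m
      = (if m \<notin> f then (\<Sum>b\<in>eidx f k. ?h f b) else 0)" .
  qed
  also have "\<dots> = (\<Sum>f\<in>{f \<in> faces. m \<notin> f}. \<Sum>b\<in>eidx f k. ?h f b)"
    by (rule sum.inter_filter[symmetric]) simp
  also have "\<dots> = (\<Sum>b\<in>midx (N - {m}) k. ?h (supp b) b)" by (rule sum_over_faces[OF m])
  also have "\<dots> = tpoly A a m x"
    unfolding tpoly_def
  proof (rule sum.cong[OF refl])
    fix b assume b: "b \<in> midx (N - {m}) k"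
    have "mon (bary v) (supp b) b x = mon (bary v) (N - {m}) b x"
      unfolding mon_def using b by (intro prod.mono_neutral_left) (auto simp: supp_def midx_def)
    then show "?h (supp b) b = mon (bary v) (N - {m}) b x *\<^sub>R tcoef A a m b"
      by (simp add: tcoef_def)
  qed
  finally show ?thesis .
qed

text \<open>Independence of the facet monomials isolates one multi-index on every facet containing
  f; \<open>face_trace_inj\<close> then applies to this single face.\<close>

lemma coefs_zero:
  assumes val: "valid A a" and 0: "\<And>m x. m \<in> N \<Longrightarrow> x \<in> rface m \<Longrightarrow> tpoly A a m x = 0"
    and f: "f \<in> faces" and b: "b \<in> eidx f k"
  shows "A f b = 0" and "\<And>i j. i \<in> N - f \<Longrightarrow> j \<in> N - f \<Longrightarrow> a f b i j = 0"
proof -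
  have t: "face_trace f (base f) (A f b) (a f b) m = 0" if m: "m \<in> N - f" for m
  proof -
    have mN: "m \<in> N" and mf: "m \<notin> f" using m by auto
    have "tcoef A a m b = 0"
      using mN _ eidx_midx[OF f mf b]
    proof (rule face_monomials_independent)
      show "(\<Sum>b\<in>midx (N - {m}) k. mon (bary v) (N - {m}) b x *\<^sub>R tcoef A a m b) = 0"
        if "x \<in> rface m" for x
        using 0[OF mN that] unfolding tpoly_def .
    qed
    then show ?thesis unfolding tcoef_def eidx_supp[OF f b] .
  qed
  have A: "A f b \<in> normal_tensors v f" and a: "\<And>i j. a f b i j = - a f b j i"
    using val f unfolding valid_def anti_def by blast+
  show "A f b = 0" by (rule face_trace_inj(1)[OF facesD(1)[OF f] facesD(2)[OF f] A a t])
  show "a f b i j = 0" if "i \<in> N - f" "j \<in> N - f" for i j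
    by (rule face_trace_inj(2)[OF facesD(1)[OF f] facesD(2)[OF f] A a t that])
qed

text \<open>The matrices \<open>a f b\<close> vanish at indices off f, and these are the only
  entries that \<open>phi_form\<close> reads.\<close>

lemma fields_zero:
  assumes val: "valid A a" and 0: "\<And>m x. m \<in> N \<Longrightarrow> x \<in> rface m \<Longrightarrow> tpoly A a m x = 0"
    and f: "f \<in> faces"
  shows "nfield A f x = 0" and "pfield a f x = 0"
proof -
  have z1: "A f b = 0" if "b \<in> eidx f k" for b
    by (rule coefs_zero(1)[OF val _ f that]) (rule 0)
  have z2: "a f b i j = 0" if "b \<in> eidx f k" "i \<in> N - f" "j \<in> N - f" for b i j
    by (rule coefs_zero(2)[OF val _ f that]) (rule 0)
  show "nfield A f x = 0" unfolding nfield_def using z1 by simp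
  have "phi_form f (base f) (a f b) x = 0" if b: "b \<in> eidx f k" for b
    unfolding phi_form_def
  proof (intro sum.neutral ballI)
    fix m assume m: "m \<in> N - f"
    have "(\<Sum>j\<in>N - f. a f b m j *\<^sub>R (v j - v (base f))) = 0"
      by (intro sum.neutral ballI) (simp add: z2[OF b m])
    then show "indicator (subcell v m) x *\<^sub>R stens (base f) (\<Sum>j\<in>N - f. a f b m j *\<^sub>R (v j - v (base f))) = 0"
      by (simp add: linear_0[OF linear_stens])
  qed
  then show "pfield a f x = 0" unfolding pfield_def by simp
qed

end

section \<open>The shape space as bubbles plus nodal fields\<close>

context stress_element
begin

lemma summands_eq: "summands CARD('n) = insert Bubble (Normal ` faces \<union> Phi ` faces)"
proof -
  have "(\<Union>l<CARD('n). subsimplices CARD('n) l) = faces"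
  proof (intro set_eqI iffI)
    fix f assume "f \<in> (\<Union>l<CARD('n). subsimplices CARD('n) l)"
    then obtain l where l: "l < CARD('n)" "f \<subseteq> N" "card f = Suc l"
      unfolding subsimplices_def N_def by blast
    then have "f \<noteq> {}" "f \<noteq> N" by auto
    then show "f \<in> faces" using l(2) unfolding faces_def by blast
  next
    fix f assume "f \<in> faces"
    then have f: "f \<subseteq> N" "f \<noteq> {}" "f \<noteq> N" unfolding faces_def by auto
    then have "card f < card N" by (intro psubset_card_mono) auto
    moreover have "card f \<noteq> 0" using f finite_subset[OF f(1) finite_N] by simp
    ultimately have "card f - 1 < CARD('n)" "card f = Suc (card f - 1)" by auto
    then show "f \<in> (\<Union>l<CARD('n). subsimplices CARD('n) l)"
      using f(1) unfolding subsimplices_def N_def by blast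
  qed
  then show ?thesis unfolding summands_def by blast
qed

lemma sum_summands:
  fixes g :: "summand \<Rightarrow> 'b::comm_monoid_add"
  shows "(\<Sum>s\<in>summands CARD('n). g s) = g Bubble + (\<Sum>f\<in>faces. g (Normal f) + g (Phi f))"
proof -
  have "(\<Sum>s\<in>summands CARD('n). g s) = g Bubble + (\<Sum>s\<in>Normal ` faces \<union> Phi ` faces. g s)"
    unfolding summands_eq by (subst sum.insert) auto
  also have "(\<Sum>s\<in>Normal ` faces \<union> Phi ` faces. g s) = (\<Sum>s\<in>Normal ` faces. g s) + (\<Sum>s\<in>Phi ` faces. g s)"
    by (rule sum.union_disjoint) auto
  also have "(\<Sum>s\<in>Normal ` faces. g s) = (\<Sum>f\<in>faces. g (Normal f))"
    by (subst sum.reindex) (auto simp: inj_on_def)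
  also have "(\<Sum>s\<in>Phi ` faces. g s) = (\<Sum>f\<in>faces. g (Phi f))"
    by (subst sum.reindex) (auto simp: inj_on_def)
  finally show ?thesis by (simp add: sum.distrib)
qed

lemma component_rep:
  assumes g: "\<And>s. s \<in> summands CARD('n) \<Longrightarrow> g s \<in> component v base k s"
  obtains A a where "valid A a" "g Bubble \<in> bubble_div v (Suc (Suc r))"
    "\<And>f. f \<in> faces \<Longrightarrow> g (Normal f) = nfield A f" "\<And>f. f \<in> faces \<Longrightarrow> g (Phi f) = pfield a f"
    "\<And>x. (\<Sum>s\<in>summands CARD('n). g s) x = g Bubble x + nodal A a x"
proof -
  have ex_A: "\<exists>w. f \<in> faces \<longrightarrow> (\<forall>b. w b \<in> normal_tensors v f)
      \<and> g (Normal f) = (\<lambda>x. \<Sum>b\<in>eidx f k. mon (bary v) f b x *\<^sub>R w b)" for f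
  proof (cases "f \<in> faces")
    case True
    then have "g (Normal f) \<in> combs (bary v) f k (\<lambda>A x. A) (normal_tensors v f)"
      using g[of "Normal f"] normal_rep[OF facesD(1)[OF True]] unfolding summands_eq by simp
    then show ?thesis unfolding combs_def by blast
  qed simp
  obtain A where A_all: "\<forall>f. f \<in> faces \<longrightarrow> (\<forall>b. A f b \<in> normal_tensors v f)
      \<and> g (Normal f) = (\<lambda>x. \<Sum>b\<in>eidx f k. mon (bary v) f b x *\<^sub>R A f b)"
    using choice[OF allI[OF ex_A]] ..
  have A: "A f b \<in> normal_tensors v f"
    "g (Normal f) = (\<lambda>x. \<Sum>b\<in>eidx f k. mon (bary v) f b x *\<^sub>R A f b)" if "f \<in> faces" for f b
    using spec[OF A_all, of f] that by simp_all
  have ex_a: "\<exists>w. f \<in> faces \<longrightarrow> (\<forall>b. w b \<in> anti)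
      \<and> g (Phi f) = (\<lambda>x. \<Sum>b\<in>eidx f k. mon (baryR v) f b x *\<^sub>R phi_form f (base f) (w b) x)" for f
  proof (cases "f \<in> faces")
    case True
    then have "g (Phi f) \<in> combs (baryR v) f k (phi_form f (base f)) anti"
      using g[of "Phi f"] phi_rep[OF facesD(1)[OF True]] unfolding summands_eq by simp
    then show ?thesis unfolding combs_def by blast
  qed simp
  obtain a where a_all: "\<forall>f. f \<in> faces \<longrightarrow> (\<forall>b. a f b \<in> anti)
      \<and> g (Phi f) = (\<lambda>x. \<Sum>b\<in>eidx f k. mon (baryR v) f b x *\<^sub>R phi_form f (base f) (a f b) x)"
    using choice[OF allI[OF ex_a]] ..
  have a: "a f b \<in> anti"
    "g (Phi f) = (\<lambda>x. \<Sum>b\<in>eidx f k. mon (baryR v) f b x *\<^sub>R phi_form f (base f) (a f b) x)"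
    if "f \<in> faces" for f b
    using spec[OF a_all, of f] that by simp_all
  have val: "valid A a" unfolding valid_def using A(1) a(1) by blast
  have bub: "g Bubble \<in> bubble_div v (Suc (Suc r))"
    using g[of Bubble] unfolding summands_eq by (simp add: k)
  have N: "g (Normal f) = nfield A f" if "f \<in> faces" for f unfolding nfield_def by (rule A(2)[OF that])
  have P: "g (Phi f) = pfield a f" if "f \<in> faces" for f unfolding pfield_def by (rule a(2)[OF that])
  have "(\<Sum>s\<in>summands CARD('n). g s) x = g Bubble x + nodal A a x" for x
  proof -
    have "(\<Sum>s\<in>summands CARD('n). g s) = g Bubble + (\<Sum>f\<in>faces. nfield A f + pfield a f)"
      unfolding sum_summands using N P by simp
    then show ?thesis by (simp add: sum_fun_apply nodal_def)
  qed
  with val bub N P show ?thesis by (rule that)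
qed

lemma shape_spaceI:
  assumes val: "valid A a" and tau: "tau \<in> bubble_div v (Suc (Suc r))"
  shows "(\<lambda>x. tau x + nodal A a x) \<in> shape_space v base k"
proof -
  define g where "g s = (case s of Bubble \<Rightarrow> tau | Normal f \<Rightarrow> nfield A f | Phi f \<Rightarrow> pfield a f)" for s
  have N: "nfield A f \<in> bubble_normal v k f" if f: "f \<in> faces" for f
    unfolding normal_rep[OF facesD(1)[OF f]] combs_def nfield_def
    using val f unfolding valid_def by blast
  have P: "pfield a f \<in> bubble_phi v base k f" if f: "f \<in> faces" for f
    unfolding phi_rep[OF facesD(1)[OF f]] combs_def pfield_def
    using val f unfolding valid_def by blast
  have g: "\<forall>s\<in>summands CARD('n). g s \<in> component v base k s"
    unfolding summands_eq using tau N P by (auto simp: g_def k)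
  have "(\<lambda>x. tau x + nodal A a x) = (\<Sum>s\<in>summands CARD('n). g s)"
    unfolding sum_summands by (rule ext) (simp add: g_def sum_fun_apply nodal_def)
  then show ?thesis unfolding shape_space_def using g by blast
qed

lemma shape_spaceE:
  assumes "tau \<in> shape_space v base k"
  obtains A a tb where "valid A a" "tb \<in> bubble_div v (Suc (Suc r))" "tau = (\<lambda>x. tb x + nodal A a x)"
proof -
  obtain g where g: "tau = (\<Sum>s\<in>summands CARD('n). g s)" "\<forall>s\<in>summands CARD('n). g s \<in> component v base k s"
    using assms unfolding shape_space_def by blast
  show ?thesis
  proof (rule component_rep[of g])
    show "g s \<in> component v base k s" if "s \<in> summands CARD('n)" for s using g(2) that by blast
    fix A a assume "valid A a" "g Bubble \<in> bubble_div v (Suc (Suc r))"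
      "\<And>x. (\<Sum>s\<in>summands CARD('n). g s) x = g Bubble x + nodal A a x"
    then show ?thesis unfolding g(1)[symmetric] by (intro that[of A a "g Bubble"]) auto
  qed
qed

text \<open>On each open subcell the vanishing sum is one continuous field, so it vanishes up to
  facet m. There the bubble has no normal trace, hence all nodal traces are zero and with them the
  nodal coefficients; only the bubble is left.\<close>

theorem direct_sum: "direct_sum_ae (cell v) (summands CARD('n)) (component v base k)"
  unfolding direct_sum_ae_def
proof (intro allI impI)
  fix g assume g: "(\<forall>s\<in>summands CARD('n). g s \<in> component v base k s) \<and>
    (AE x in MC. (\<Sum>s\<in>summands CARD('n). g s x) = 0)"
  show "\<forall>s\<in>summands CARD('n). AE x in MC. g s x = 0"
  proof (rule component_rep[of g])
    show "g s \<in> component v base k s" if "s \<in> summands CARD('n)" for s using g that by blast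
    fix A a assume val: "valid A a" and tb: "g Bubble \<in> bubble_div v (Suc (Suc r))"
      and N: "\<And>f. f \<in> faces \<Longrightarrow> g (Normal f) = nfield A f"
      and P: "\<And>f. f \<in> faces \<Longrightarrow> g (Phi f) = pfield a f"
      and sum: "\<And>x. (\<Sum>s\<in>summands CARD('n). g s) x = g Bubble x + nodal A a x"
    have ae: "AE x in MC. g Bubble x + nodal A a x = 0"
      using g unfolding sum[symmetric] sum_fun_apply by blast
    have t0: "tpoly A a m x = 0" if m: "m \<in> N" and x: "x \<in> rface m" for m x
    proof (rule bubble_repr[OF tb])
      fix Q assume Q: "\<And>i j. (\<lambda>x. Q x $ i $ j) \<in> polys (Suc (Suc r))"
        "g Bubble = (\<lambda>x. if x \<in> cell v then Q x else 0)"
        "\<And>m x. m \<in> N \<Longrightarrow> x \<in> rface m \<Longrightarrow> Q x *v grad m = 0"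
      define f where "f y = Q y + branch m A a y" for y
      have fc: "continuous_on S f" for S
        unfolding f_def by (intro continuous_on_add polys_matrix_continuous[OF Q(1)] continuous_branch)
      have sub: "isubcell m \<subseteq> cell v" using isubcell_subset icell_subset by blast
      have "AE x in MC. x \<in> isubcell m \<longrightarrow> f x = 0"
        using ae
      proof (rule eventually_mono)
        fix y assume y: "g Bubble y + nodal A a y = 0"
        show "y \<in> isubcell m \<longrightarrow> f y = 0"
        proof
          assume ym: "y \<in> isubcell m"
          then have "nodal A a y = branch m A a y"
            by (intro nodal_branch[OF m] isubcell_in_subcell[OF _ m])
          moreover have "g Bubble y = Q y" using ym sub unfolding Q(2) by auto
          ultimately show "f y = 0" using y by (simp add: f_def)
        qed
      qed
      then have "f y = 0" if "y \<in> isubcell m" for y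
        using open_AE_zero[OF open_isubcell sub fc _ that] by blast
      then have "f x = 0" by (rule rface_limit[OF fc m x])
      then have "f x *v grad m = 0" by simp
      moreover have "bary v m x = 0" using x unfolding rface_def by blast
      ultimately show ?thesis
        unfolding f_def mult_vec_add Q(3)[OF m x] using branch_trace[OF m val] by simp
    qed
    have z1: "g (Normal f) = 0" "g (Phi f) = 0" if f: "f \<in> faces" for f
    proof -
      have "nfield A f x = 0" "pfield a f x = 0" for x
        by (rule fields_zero[OF val _ f], rule t0, assumption+)+
      then show "g (Normal f) = 0" "g (Phi f) = 0"
        unfolding N[OF f] P[OF f] by (simp_all add: fun_eq_iff)
    qed
    have "nodal A a x = 0" for x
    proof -
      have "nfield A f x = 0" "pfield a f x = 0" if f: "f \<in> faces" for f
        using z1[OF f] unfolding N[OF f] P[OF f] by simp_all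
      then show ?thesis unfolding nodal_def by simp
    qed
    then have "AE x in MC. g Bubble x = 0" using ae by simp
    then show ?thesis unfolding summands_eq using z1 by auto
  qed
qed

section \<open>Unisolvence\<close>

lemma facets_eq: "subsimplices CARD('n) (CARD('n) - 1) = (\<lambda>m. N - {m}) ` N"
proof (intro set_eqI iffI)
  fix F assume "F \<in> subsimplices CARD('n) (CARD('n) - 1)"
  then have F: "F \<subseteq> N" "card F = CARD('n)" unfolding subsimplices_def N_def by auto
  then have "card (N - F) = 1" using finite_subset[OF F(1) finite_N] by (simp add: card_Diff_subset)
  then obtain m where "N - F = {m}" by (rule card_1_singletonE)
  then have "m \<in> N" "F = N - {m}" using F(1) by auto
  then show "F \<in> (\<lambda>m. N - {m}) ` N" by blast
next
  fix F assume "F \<in> (\<lambda>m. N - {m}) ` N"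
  then obtain m where m: "m \<in> N" "F = N - {m}" by blast
  then have "card F = CARD('n)" by simp
  then show "F \<in> subsimplices CARD('n) (CARD('n) - 1)"
    unfolding subsimplices_def N_def[symmetric] using m(2) by auto
qed

section \<open>Measurability, traces and moments of shape functions\<close>

lemma bm_bary: "bm (bary v i)"
  by (rule bm_continuous[OF continuous_bary])

lemma bm_baryR: "i \<in> N \<Longrightarrow> bm (baryR v i)"
  unfolding baryR_eq
  by (intro bm_if bm_continuous continuous_on_diff continuous_bary continuous_on_Min_image) simp_all

lemma bm_power: "bm f \<Longrightarrow> bm (\<lambda>x. f x ^ n)" for f :: "real^'n \<Rightarrow> real"
proof (induct n)
  case 0
  show ?case using bm_const[of "1::real"] by simp
next
  case (Suc n)
  then show ?case using bm_mult[of f "\<lambda>x. f x ^ n"] by simp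
qed

lemma bm_mon:
  assumes "finite f" and "\<And>i. i \<in> f \<Longrightarrow> bm (mu i)"
  shows "bm (mon mu f b)"
  using assms
proof (induct f rule: finite_induct)
  case empty
  show ?case using bm_const[of "1::real"] by (simp add: mon_def[abs_def])
next
  case (insert i f)
  then have "bm (\<lambda>x. mu i x ^ b i * mon mu f b x)" by (intro bm_mult bm_power) auto
  then show ?case using insert by (simp add: mon_def[abs_def])
qed

lemma bm_indicator: "compact S \<Longrightarrow> bm (\<lambda>x. indicator S x :: real)"
proof -
  assume "compact S"
  then have "bm (\<lambda>x. if x \<in> S then 1 else 0 :: real)"
    by (intro bm_if bm_const borel_compact)
  then show ?thesis by (simp add: indicator_def[abs_def] of_bool_def)
qed

lemma bm_nodal: "bm (nodal A a)"
proof -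
  have "bm (nfield A f)" if f: "f \<in> faces" for f
    unfolding nfield_def by (intro bm_sum bm_scaleR bm_mon bm_bary bm_const facesD(3)[OF f])
  moreover have "bm (pfield a f)" if f: "f \<in> faces" for f
    unfolding pfield_def phi_form_def
    using facesD(1)[OF f]
    by (intro bm_sum bm_scaleR bm_mon bm_baryR bm_const bm_indicator compact_subcell facesD(3)[OF f]) auto
  ultimately show ?thesis unfolding nodal_def[abs_def] by (intro bm_sum bm_add)
qed

lemma tpoly_polys: "(\<lambda>x. (c *\<^sub>R tpoly A a m x) $ i) \<in> polys k"
proof -
  have "mon (bary v) (N - {m}) b \<in> polys k" if "b \<in> midx (N - {m}) k" for b
    using mon_in_polys[of "N - {m}" "bary v" b] bary_in_polys that by (simp add: midx_def)
  then have "(\<lambda>x. \<Sum>b\<in>midx (N - {m}) k. (c * tcoef A a m b $ i) * mon (bary v) (N - {m}) b x) \<in> polys k"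
    by (intro polys_sum polys_scale)
  moreover have "(c *\<^sub>R tpoly A a m x) $ i
    = (\<Sum>b\<in>midx (N - {m}) k. (c * tcoef A a m b $ i) * mon (bary v) (N - {m}) b x)" for x
    by (simp add: tpoly_def sum_distrib_left mult_ac)
  ultimately show ?thesis by simp
qed

lemma bubble_bm: "tau \<in> bubble_div v s \<Longrightarrow> bm tau"
  unfolding bubble_div_def using sym_polys_on_bm by blast

text \<open>On the open facet the bubble has zero trace and the nodal field coincides with its
  branch on subcell m; the facet integral depends on these points only.\<close>

lemma face_dof_nodal:
  assumes F: "simplex_face v N m (n (N - {m}))" and c: "n (N - {m}) = c *\<^sub>R grad m"
    and val: "valid A a" and tb: "tb \<in> bubble_div v (Suc (Suc r))"
    and q: "q \<in> vec_polys_on k (face v (N - {m}))"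
  shows "face_dof v n (N - {m}) (\<lambda>x. tb x + nodal A a x) q
    = simplex_face.fint v N m (n (N - {m})) (\<lambda>x. (c *\<^sub>R tpoly A a m x) \<bullet> q x)"
proof -
  interpret simplex_face v N m "n (N - {m})" by (rule F)
  have "face_dof v n (N - {m}) (\<lambda>x. tb x + nodal A a x) q
    = fint (\<lambda>x. ((tb x + nodal A a x) *v n (N - {m})) \<bullet> q x)"
    unfolding face_dof_def fint_def ..
  also have "\<dots> = fint (\<lambda>x. (c *\<^sub>R tpoly A a m x) \<bullet> q x)"
  proof (rule fint_cong)
    have Tc: "continuous_on UNIV (\<lambda>x. c *\<^sub>R tpoly A a m x)"
      by (rule polys_vec_continuous[OF tpoly_polys])
    show "(\<lambda>x. (c *\<^sub>R tpoly A a m x) \<bullet> q x) \<in> borel_measurable borel"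
      by (intro bm_borel bm_inner bm_continuous Tc vec_polys_on_bm[OF q])
    show "(\<lambda>x. ((tb x + nodal A a x) *v n (N - {m})) \<bullet> q x) \<in> borel_measurable borel"
      by (intro bm_borel bm_inner bm_mult_vec bm_add bm_nodal bubble_bm[OF tb] vec_polys_on_bm[OF q])
    fix x assume x: "x \<in> rface m"
    have "tb x *v grad m = 0"
    proof (rule bubble_repr[OF tb])
      fix P assume P: "tb = (\<lambda>x. if x \<in> cell v then P x else 0)"
        "\<And>m x. m \<in> N \<Longrightarrow> x \<in> rface m \<Longrightarrow> P x *v grad m = 0"
      have "x \<in> cell v" using x rface_subset face_subset_cell by blast
      then show ?thesis unfolding P(1) using P(2)[OF m x] by simp
    qed
    moreover have "nodal A a x = branch m A a x"
      using rface_subcell[OF x m] by (rule nodal_branch[OF m])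
    moreover have "bary v m x = 0" using x unfolding rface_def by blast
    ultimately have "(tb x + nodal A a x) *v n (N - {m}) = c *\<^sub>R tpoly A a m x"
      unfolding c mult_vec_scaleR_right mult_vec_add using branch_trace[OF m val] by simp
    then show "((tb x + nodal A a x) *v n (N - {m})) \<bullet> q x = (c *\<^sub>R tpoly A a m x) \<bullet> q x" by simp
  qed
  finally show ?thesis .
qed

lemma cell_dof_nodal:
  assumes tb: "tb \<in> bubble_div v s" and q: "q \<in> sym_polys_on s' (cell v)"
  shows "cell_dof v (\<lambda>x. tb x + nodal A a x) q = cell_dof v tb q + cell_dof v (nodal A a) q"
proof -
  have "integrable MC (\<lambda>x. tb x \<bullet> q x)" "integrable MC (\<lambda>x. nodal A a x \<bullet> q x)"
    by (intro bm_integrable bm_inner bm_nodal bubble_bm[OF tb] sym_polys_on_bm[OF q])+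
  then show ?thesis unfolding cell_dof_def by (simp add: inner_add_left)
qed

text \<open>The pairs (f, b) decouple: for each one \<open>face_trace_surj\<close> meets the
  prescribed values on all facets containing f at once.\<close>

lemma nodal_exists:
  obtains A a where "valid A a" "\<And>m b. m \<in> N \<Longrightarrow> b \<in> midx (N - {m}) k \<Longrightarrow> tcoef A a m b = u m b"
proof -
  have ex: "\<exists>z. f \<in> faces \<longrightarrow> fst z \<in> normal_tensors v f \<and> snd z \<in> anti \<and>
    (\<forall>m\<in>N - f. face_trace f (base f) (fst z) (snd z) m = u m b)" for f b
  proof (cases "f \<in> faces")
    case True
    show ?thesis
    proof (rule face_trace_surj[OF facesD(1)[OF True] facesD(2)[OF True], of "\<lambda>m. u m b"])
      fix B e assume B: "B \<in> normal_tensors v f" and e: "\<And>i j. e i j = - e j i"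
        and t: "\<And>m. m \<in> N - f \<Longrightarrow> face_trace f (base f) B e m = u m b"
      have "e \<in> anti" unfolding anti_def using e by blast
      with B t show ?thesis by (intro exI[of _ "(B, e)"]) simp
    qed
  qed simp
  define z where "z f b = (SOME z. f \<in> faces \<longrightarrow> fst z \<in> normal_tensors v f \<and> snd z \<in> anti \<and>
    (\<forall>m\<in>N - f. face_trace f (base f) (fst z) (snd z) m = u m b))" for f b
  define A where "A f b = fst (z f b)" for f b
  define a where "a f b = snd (z f b)" for f b
  have Aa: "A f b \<in> normal_tensors v f" "a f b \<in> anti"
    "m \<in> N - f \<Longrightarrow> face_trace f (base f) (A f b) (a f b) m = u m b" if "f \<in> faces" for f b m
    using someI_ex[OF ex[of f b], folded z_def] that unfolding A_def a_def by blast+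
  have "tcoef A a m b = u m b" if m: "m \<in> N" and b: "b \<in> midx (N - {m}) k" for m b
    unfolding tcoef_def using midx_supp[OF m b] m by (intro Aa(3)) auto
  moreover have "valid A a" unfolding valid_def using Aa(1,2) by blast
  ultimately show ?thesis using that by blast
qed

lemma face_trace_diff:
  "face_trace f p (A - A') (\<lambda>i j. a i j - a' i j) m = face_trace f p A a m - face_trace f p A' a' m"
  unfolding face_trace_def matrix_vector_mult_diff_rdistrib scaleR_diff_left sum_subtractf
    scaleR_diff_right by simp

text \<open>Traces are linear in the coefficients, so \<open>fields_zero\<close> applies to the
  differences.\<close>

lemma nodal_unique:
  assumes val: "valid A a" and val': "valid A' a'"
    and eq: "\<And>m x. m \<in> N \<Longrightarrow> x \<in> rface m \<Longrightarrow> tpoly A a m x = tpoly A' a' m x"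
  shows "nodal A a x = nodal A' a' x"
proof -
  define B where "B f b = A f b - A' f b" for f b
  define e where "e f b i j = a f b i j - a' f b i j" for f b i j
  have tc: "tcoef B e m b = tcoef A a m b - tcoef A' a' m b" for m b
    unfolding tcoef_def B_def e_def by (rule face_trace_diff)
  have "tpoly B e m x = tpoly A a m x - tpoly A' a' m x" for m x
    unfolding tpoly_def tc scaleR_diff_right sum_subtractf ..
  then have 0: "tpoly B e m x = 0" if "m \<in> N" "x \<in> rface m" for m x using eq[OF that] by simp
  have "e f b \<in> anti" if "f \<in> faces" for f b
  proof -
    have "a f b \<in> anti" "a' f b \<in> anti" using val val' that unfolding valid_def by blast+
    moreover have "e f b = a f b - a' f b" unfolding e_def by (simp add: fun_eq_iff)
    ultimately show ?thesis by (simp only: subspace_diff[OF subspace_anti])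
  qed
  moreover have "B f b \<in> normal_tensors v f" if "f \<in> faces" for f b
    using val val' that unfolding valid_def B_def by (intro subspace_diff[OF subspace_normal_tensors]) blast+
  ultimately have vB: "valid B e" unfolding valid_def by blast
  have "nfield A f x = nfield A' f x" if f: "f \<in> faces" for f
  proof -
    have "nfield B f x = 0" by (rule fields_zero(1)[OF vB _ f]) (rule 0)
    moreover have "nfield B f x = nfield A f x - nfield A' f x"
      unfolding nfield_def B_def scaleR_diff_right sum_subtractf ..
    ultimately show ?thesis by simp
  qed
  moreover have "pfield a f x = pfield a' f x" if f: "f \<in> faces" for f
  proof -
    have "pfield e f x = 0" by (rule fields_zero(2)[OF vB _ f]) (rule 0)
    moreover have "phi_form f (base f) (e f b) x = phi_form f (base f) (a f b) x - phi_form f (base f) (a' f b) x" for b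
    proof -
      have "e f b = a f b - a' f b" unfolding e_def by (simp add: fun_eq_iff)
      then show ?thesis using linear_diff[OF linear_phi_form] by (simp add: fun_diff_def)
    qed
    then have "pfield e f x = pfield a f x - pfield a' f x"
      unfolding pfield_def by (simp only: scaleR_diff_right sum_subtractf)
    ultimately show ?thesis by simp
  qed
  ultimately show ?thesis unfolding nodal_def by simp
qed

text \<open>The system is triangular: facet moments do not see bubbles and fix the nodal part;
  interior moments, reduced by the nodal contribution, then fix the bubble.\<close>

theorem unisolvent:
  assumes n: "unit_normals v n"
  shows "uniquely_determined v n k (shape_space v base k)"
  unfolding uniquely_determined_def
proof (intro allI impI)
  fix LF :: "nat set \<Rightarrow> (real^'n \<Rightarrow> real^'n) \<Rightarrow> real" and LI :: "(real^'n \<Rightarrow> real^'n^'n) \<Rightarrow> real"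
  assume lin: "(\<forall>F\<in>subsimplices CARD('n) (CARD('n) - 1). linear (LF F)) \<and> linear LI"
  have F: "simplex_face v N m (n (N - {m}))" if m: "m \<in> N" for m
  proof unfold_locales
    have "N - {m} \<in> subsimplices CARD('n) (CARD('n) - 1)" unfolding facets_eq using m by blast
    then show "norm (n (N - {m})) = 1" "n (N - {m}) \<in> normal_space v (N - {m})"
      using n unfolding unit_normals_def by auto
  qed (rule m)
  have ex_c: "\<exists>c. m \<in> N \<longrightarrow> c \<noteq> 0 \<and> n (N - {m}) = c *\<^sub>R grad m" for m
    using simplex_face.nu_grad[OF F] by metis
  obtain c where "\<forall>m. m \<in> N \<longrightarrow> c m \<noteq> 0 \<and> n (N - {m}) = c m *\<^sub>R grad m"
    using choice[OF allI[OF ex_c]] ..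
  then have c: "c m \<noteq> 0" "n (N - {m}) = c m *\<^sub>R grad m" if "m \<in> N" for m using that by blast+
  have ex_u: "\<exists>u. m \<in> N \<longrightarrow> (\<forall>q\<in>vec_polys_on k (face v (N - {m})).
    simplex_face.fint v N m (n (N - {m})) (\<lambda>x. (\<Sum>b\<in>midx (N - {m}) k. mon (bary v) (N - {m}) b x *\<^sub>R u b) \<bullet> q x)
      = LF (N - {m}) q)" for m
  proof (cases "m \<in> N")
    case True
    then have L: "linear (LF (N - {m}))" using lin unfolding facets_eq by blast
    show ?thesis
      by (rule simplex_face.face_exists[OF F[OF True] L, of r]) (use k in blast)
  qed simp
  obtain u where u_all: "\<forall>m. m \<in> N \<longrightarrow> (\<forall>q\<in>vec_polys_on k (face v (N - {m})).
    simplex_face.fint v N m (n (N - {m})) (\<lambda>x. (\<Sum>b\<in>midx (N - {m}) k. mon (bary v) (N - {m}) b x *\<^sub>R u m b) \<bullet> q x)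
      = LF (N - {m}) q)"
    using choice[OF allI[OF ex_u]] ..
  have u: "simplex_face.fint v N m (n (N - {m})) (\<lambda>x. (\<Sum>b\<in>midx (N - {m}) k. mon (bary v) (N - {m}) b x *\<^sub>R u m b) \<bullet> q x)
      = LF (N - {m}) q" if "m \<in> N" "q \<in> vec_polys_on k (face v (N - {m}))" for m q
    using spec[OF u_all, of m] that by blast
  \<comment> \<open>The factor 1/c_m converts from the unit normal
    \<open>c m *\<^sub>R grad m\<close> to the gradient used in \<open>face_trace\<close>.\<close>
  obtain A a where val: "valid A a"
    and tc: "\<And>m b. m \<in> N \<Longrightarrow> b \<in> midx (N - {m}) k \<Longrightarrow> tcoef A a m b = (1 / c m) *\<^sub>R u m b"
    by (rule nodal_exists[of "\<lambda>m b. (1 / c m) *\<^sub>R u m b"]) blast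
  have ct: "c m *\<^sub>R tpoly A a m x = (\<Sum>b\<in>midx (N - {m}) k. mon (bary v) (N - {m}) b x *\<^sub>R u m b)"
    if m: "m \<in> N" for m x
    unfolding tpoly_def scaleR_sum_right
    by (intro sum.cong refl) (simp add: tc[OF m] c(1)[OF m])
  let ?V = "sym_polys_on r (cell v)"
  have bi: "integrable MC (\<lambda>x. nodal A a x \<bullet> q x)" if "q \<in> ?V" for q
    by (intro bm_integrable bm_inner bm_nodal sym_polys_on_bm[OF that])
  have "\<exists>tb\<in>bubble_div v (Suc (Suc r)). \<forall>q\<in>?V. cell_dof v tb q = LI q - cell_dof v (nodal A a) q"
  proof (rule bubble_exists[of r "\<lambda>q. LI q - cell_dof v (nodal A a) q"])
    fix p q assume pq: "p \<in> ?V" "q \<in> ?V"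
    have "cell_dof v (nodal A a) (p + q) = cell_dof v (nodal A a) p + cell_dof v (nodal A a) q"
      unfolding cell_dof_def using bi pq by (simp add: inner_add_right)
    then show "LI (p + q) - cell_dof v (nodal A a) (p + q)
      = LI p - cell_dof v (nodal A a) p + (LI q - cell_dof v (nodal A a) q)"
      using lin by (simp add: linear_add)
  next
    fix s p assume "p \<in> ?V"
    have "cell_dof v (nodal A a) (s *\<^sub>R p) = s * cell_dof v (nodal A a) p"
      unfolding cell_dof_def by simp
    then show "LI (s *\<^sub>R p) - cell_dof v (nodal A a) (s *\<^sub>R p) = s * (LI p - cell_dof v (nodal A a) p)"
      using lin by (simp add: linear_scale right_diff_distrib)
  next
    fix tb assume "tb \<in> bubble_div v (Suc (Suc r))"
      "\<And>q. q \<in> ?V \<Longrightarrow> cell_dof v tb q = LI q - cell_dof v (nodal A a) q"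
    then show ?thesis by blast
  qed
  then obtain tb where tb: "tb \<in> bubble_div v (Suc (Suc r))"
    "\<And>q. q \<in> ?V \<Longrightarrow> cell_dof v tb q = LI q - cell_dof v (nodal A a) q"
    by blast
  let ?tau = "\<lambda>x. tb x + nodal A a x"
  have kr: "k - 1 = r" using k by simp
  have match: "dofs_match v n k LF LI ?tau"
    unfolding dofs_match_def facets_eq kr
  proof (intro conjI ballI)
    fix G q assume "G \<in> (\<lambda>m. N - {m}) ` N" and q: "q \<in> vec_polys_on k (face v G)"
    then obtain m where m: "m \<in> N" "G = N - {m}" by blast
    show "face_dof v n G ?tau q = LF G q"
      using face_dof_nodal[where n=n, OF F[OF m(1)] c(2)[OF m(1)] val tb(1)] u[OF m(1)] q
      unfolding m(2) ct[OF m(1)] by simp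
  next
    fix q assume q: "q \<in> ?V"
    show "cell_dof v ?tau q = LI q"
      unfolding cell_dof_nodal[OF tb(1) q] tb(2)[OF q] by simp
  qed
  have "AE x in MC. tau' x = ?tau x"
    if tau': "tau' \<in> shape_space v base k" and match': "dofs_match v n k LF LI tau'" for tau'
  proof (rule shape_spaceE[OF tau'])
    fix A' a' tb' assume val': "valid A' a'" and tb': "tb' \<in> bubble_div v (Suc (Suc r))"
      and eq: "tau' = (\<lambda>x. tb' x + nodal A' a' x)"
    have "tpoly A' a' m x = tpoly A a m x" if m: "m \<in> N" and x: "x \<in> rface m" for m x
    proof -
      have "c m *\<^sub>R tpoly A' a' m x = c m *\<^sub>R tpoly A a m x"
      proof (rule simplex_face.face_unique[OF F[OF m] tpoly_polys tpoly_polys _ x])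
        fix q assume q: "q \<in> vec_polys_on k (face v (N - {m}))"
        have "face_dof v n (N - {m}) tau' q = face_dof v n (N - {m}) ?tau q"
          using match match' m q unfolding dofs_match_def facets_eq by simp
        then show "simplex_face.fint v N m (n (N - {m})) (\<lambda>x. (c m *\<^sub>R tpoly A' a' m x) \<bullet> q x)
          = simplex_face.fint v N m (n (N - {m})) (\<lambda>x. (c m *\<^sub>R tpoly A a m x) \<bullet> q x)"
          unfolding eq face_dof_nodal[where n=n, OF F[OF m] c(2)[OF m] val' tb' q]
            face_dof_nodal[where n=n, OF F[OF m] c(2)[OF m] val tb(1) q] .
      qed
      then show ?thesis using c(1)[OF m] by simp
    qed
    then have nod: "nodal A' a' x = nodal A a x" for x by (rule nodal_unique[OF val' val])
    have "AE x in MC. tb' x = tb x"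
    proof (rule bubble_unique[OF tb' tb(1)])
      fix q assume q: "q \<in> ?V"
      have "cell_dof v tau' q = cell_dof v ?tau q"
        using match match' q unfolding dofs_match_def kr by simp
      then have "cell_dof v tb' q + cell_dof v (nodal A' a') q = cell_dof v tb q + cell_dof v (nodal A a) q"
        unfolding eq cell_dof_nodal[OF tb' q] cell_dof_nodal[OF tb(1) q] .
      moreover have "cell_dof v (nodal A' a') q = cell_dof v (nodal A a) q"
        unfolding cell_dof_def nod ..
      ultimately show "cell_dof v tb' q = cell_dof v tb q" by simp
    qed
    then show ?thesis unfolding eq by (rule eventually_mono) (simp add: nod)
  qed
  then show "\<exists>tau\<in>shape_space v base k. dofs_match v n k LF LI tau \<and>
      (\<forall>tau'\<in>shape_space v base k. dofs_match v n k LF LI tau' \<longrightarrow> (AE x in MC. tau' x = tau x))"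
    using shape_spaceI[OF val tb(1)] match by blast
qed

end

theorem corollary4p10:
  fixes v :: "nat \<Rightarrow> real^'n" and n :: "nat set \<Rightarrow> real^'n"
    and base :: "nat set \<Rightarrow> nat" and k :: nat
  assumes "CARD('n) \<ge> 2" and "k \<ge> 1"
    and "is_simplex v"
    and "unit_normals v n"
    and "\<And>f. f \<subseteq> {0..CARD('n)} \<Longrightarrow> f \<noteq> {} \<Longrightarrow> base f \<in> f"
  shows "direct_sum_ae (cell v) (summands CARD('n)) (component v base k)
    \<and> uniquely_determined v n k (shape_space v base k)"
proof -
  \<comment> \<open>Here r is k - 1, and k \<ge> 1 makes k its successor.\<close>
  interpret stress_element v "{0..CARD('n)}" base k "k - 1"
    using assms by unfold_locales auto
  show ?thesis using direct_sum unisolvent[OF assms(4)] by blast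
qed

end
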